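(* Let $E$ be a vector bundle over a manifold $M$. There exists a 1-to-1 correspondence between equivalence classes of homological vector fields $\partial\in\mathrm{Der}_1(\mathsf{D}^\bullet(E),\pitchfork)$, $\partial^2=0$, and Loday algebroid structures on $E$.
   Context: All manifolds, bundles and sections are smooth; $\mathcal{A}=C^\infty(M)$, $\mathrm{Sec}(E)$ is the space of sections of $E$. Loday algebroids. A Loday bracket on a real vector space is an $\mathbb{R}$-bilinear bracket with $[x,[y,z]]=[[x,y],z]+[y,[x,z]]$. A Loday algebroid structure on $E$ is a Loday bracket $[\cdot,\cdot]$ on $\mathrm{Sec}(E)$ which is a bidifferential operator of total order $\le 1$ and such that every $\mathrm{ad}_X=[X,\cdot]$ is a derivative endomorphism, i.e. for every $f\in\mathcal{A}$ there is $\hat f\in\mathcal{A}$ with $[X,fY]-f[X,Y]=\hat f\,Y$ for all $Y$. Multidifferential operators. For an $\mathbb{R}$-multilinear map $D$ in $p$ arguments from $\mathrm{Sec}(E)$ (with values in $\mathrm{Sec}(E)$ or $\mathcal{A}$), put $(\delta_i(f)D)(X_1,\dots,X_p)=D(X_1,\dots,fX_i,\dots,X_p)-fD(X_1,\dots,X_p)$. $D$ is a differential operator of order $\le k$ in the $i$-th variable if $\delta_i(f_1)\cdots\delta_i(f_{k+1})D=0$ for all $f_1,\dots,f_{k+1}\in\mathcal{A}$; it is multidifferential if, for some $k$, it is of order $\le k$ in each variable; it is of total order (degree) $\le k$ if $\delta_{i_1}(f_1)\cdots\delta_{i_{k+1}}(f_{k+1})D=0$ for all $f_j\in\mathcal{A}$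 and all indices $i_1,\dots,i_{k+1}\in\{1,\dots,p\}$. Shuffle algebras. $\mathcal{D}^p(E)$ is the space of $p$-linear multidifferential operators $\mathrm{Sec}(E)^{\times p}\to C^\infty(M)$, $\mathcal{D}^0(E)=C^\infty(M)$, $\mathcal{D}^\bullet(E)=\bigoplus_{p\ge0}\mathcal{D}^p(E)$. For $\ell'\in\mathcal{D}^p(E)$, $\ell''\in\mathcal{D}^q(E)$ the shuffle product is $$(\ell'\pitchfork\ell'')(X_1,\dots,X_{p+q})=\sum_{\sigma\in\mathrm{sh}(p,q)}\mathrm{sign}(\sigma)\,\ell'(X_{\sigma_1},\dots,X_{\sigma_p})\,\ell''(X_{\sigma_{p+1}},\dots,X_{\sigma_{p+q}}),$$ where $\mathrm{sh}(p,q)$ is the set of permutations of $\{1,\dots,p+q\}$ with $\sigma_1<\dots<\sigma_p$ and $\sigma_{p+1}<\dots<\sigma_{p+q}$. This makes $\mathcal{D}^\bullet(E)$ a graded commutative associative unital $\mathbb{R}$-algebra. For $k\ge1$, $\mathsf{D}^k(E)\subset\mathcal{D}^k(E)$ consists of the operators of order $0$ in the last variable and of total order $\le k-1$; $\mathsf{D}^0(E)=C^\infty(M)$. So $\mathsf{D}^1(E)=\mathrm{Sec}(E^* )$. $\mathsf{D}^\bullet(E)=\bigoplus_{k\ge0}\mathsf{D}^k(E)$ is a subalgebra for $\pitchfork$, called the reduced shuffle algebra; the corresponding graded ringed space $(M,\mathsf{D}^\bullet(E))$ is called a supercommutative manifold. Derivations. A degree $1$ graded derivation of $\mathsf{D}^\bullet(E)$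 is an $\mathbb{R}$-linear map $\partial:\mathsf{D}^\bullet(E)\to\mathsf{D}^{\bullet+1}(E)$ with $\partial(\ell'\pitchfork\ell'')=(\partial\ell')\pitchfork\ell''+(-1)^p\ell'\pitchfork(\partial\ell'')$ for $\ell'\in\mathsf{D}^p(E)$. For such $\partial$, a bracket $[\cdot,\cdot]_\partial$ on $\mathrm{Sec}(E)$ is defined by $$\langle\mathfrak{l},[X,Y]_\partial\rangle=\langle X,\partial\langle\mathfrak{l},Y\rangle\rangle-\langle Y,\partial\langle\mathfrak{l},X\rangle\rangle-(\partial\mathfrak{l})(X,Y),\qquad X,Y\in\mathrm{Sec}(E),\ \mathfrak{l}\in\mathrm{Sec}(E^* ).$$ $\mathrm{Der}_1(\mathsf{D}^\bullet(E),\pitchfork)$ is the space of those degree $1$ graded derivations $\partial$ of the reduced shuffle algebra such that, for all $c\in\mathsf{D}^2(E)$ and $X_1,X_2,X_3\in\mathrm{Sec}(E)$, $$(\partial c)(X_1,X_2,X_3)=\sum_{i=1}^3(-1)^{i+1}\langle\partial(c(X_1,\dots\hat{\imath}\dots,X_3)),X_i\rangle+\sum_{i<j}(-1)^i\,c(X_1,\dots\hat{\imath}\dots,[X_i,X_j]_\partial,\dots,X_3),$$ where $\hat{\imath}$ means that $X_i$ is omitted and $[X_i,X_j]_\partial$ replaces $X_j$ in its place. A homological vector field of the supercommutative manifold $(M,\mathsf{D}^\bullet(E))$ is an element $\partial\in\mathrm{Der}_1(\mathsf{D}^\bullet(E),\pitchfork)$ with $\partial^2=0$. Two homological vector fields are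 equivalent if they coincide on $C^\infty(M)$ and on $\mathrm{Sec}(E^* )$. *)

theory Defs
  imports "HOL-Analysis.Analysis" "HOL-Combinatorics.Permutations"
begin

section \<open>Smooth manifolds and vector bundles\<close>

text \<open>Model spaces are finite-dimensional real inner product spaces rather than types of class
  \<^class>\<open>euclidean_space\<close>, because the latter have positive dimension and would exclude
  0-dimensional manifolds and bundles of rank 0.\<close>

definition finite_dim :: "'a::real_vector itself \<Rightarrow> bool" where
  "finite_dim _ \<longleftrightarrow> (\<exists>B::'a set. finite B \<and> span B = UNIV)"

primrec Ck_on :: "nat \<Rightarrow> 'a::real_normed_vector set \<Rightarrow> ('a \<Rightarrow> 'b::real_normed_vector) \<Rightarrow> bool" where
  "Ck_on 0 = (\<lambda>U f. continuous_on U f)"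
| "Ck_on (Suc k) = (\<lambda>U f. \<exists>f'. (\<forall>x\<in>U. (f has_derivative f' x) (at x)) \<and>
                                (\<forall>v. Ck_on k U (\<lambda>x. f' x v)))"

definition Cinf_on :: "'a::real_normed_vector set \<Rightarrow> ('a \<Rightarrow> 'b::real_normed_vector) \<Rightarrow> bool" where
  "Cinf_on U f \<longleftrightarrow> (\<forall>k. Ck_on k U f)"

text \<open>The points of the manifold are the elements of the type \<open>'m\<close>, whose classes provide the
  Hausdorff and second countability axioms.\<close>

definition smooth_atlas ::
    "('m::{t2_space,second_countable_topology} set \<times> ('m \<Rightarrow> 'e::real_inner)) set \<Rightarrow> bool" where
  "smooth_atlas C \<longleftrightarrow>
     finite_dim TYPE('e) \<and>
     \<Union>(fst ` C) = UNIV \<and>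
     (\<forall>(U, \<phi>)\<in>C. open U \<and> open (\<phi> ` U) \<and> homeomorphism U (\<phi> ` U) \<phi> (inv_into U \<phi>)) \<and>
     (\<forall>(U, \<phi>)\<in>C. \<forall>(V, \<psi>)\<in>C. Cinf_on (\<phi> ` (U \<inter> V)) (\<psi> \<circ> inv_into U \<phi>))"

definition smooth_map_on ::
    "('m set \<times> ('m \<Rightarrow> 'e::real_inner)) set \<Rightarrow> 'm set \<Rightarrow> ('m \<Rightarrow> 'b::real_normed_vector) \<Rightarrow> bool" where
  "smooth_map_on C W f \<longleftrightarrow> (\<forall>(U, \<phi>)\<in>C. Cinf_on (\<phi> ` (U \<inter> W)) (f \<circ> inv_into U \<phi>))"

text \<open>A vector bundle is given by an atlas of its base, its fibres and a vector bundle atlas.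
  The fibre over each point is a linear subspace of an auxiliary real vector space \<open>'v\<close> that
  carries no topology: fibres over different points are related only through the local
  trivializations, so this is an arbitrary family of vector spaces and not a subbundle of a
  trivial bundle.  A local trivialization over \<open>U\<close> is a family of linear isomorphisms from the
  fibres over points of \<open>U\<close> to the typical fibre \<open>'f\<close>.\<close>

record ('m, 'e, 'v, 'f) vbundle =
  charts :: "('m set \<times> ('m \<Rightarrow> 'e)) set"
  fibre :: "'m \<Rightarrow> 'v set"
  trivs :: "('m set \<times> ('m \<Rightarrow> 'v \<Rightarrow> 'f)) set"

definition vector_bundle ::
    "('m::{t2_space,second_countable_topology}, 'e::real_inner, 'v::real_vector, 'f::real_inner) vbundle
      \<Rightarrow> bool" where
  "vector_bundle E \<longleftrightarrow>
     smooth_atlas (charts E) \<and>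
     finite_dim TYPE('f) \<and>
     (\<forall>x. subspace (fibre E x)) \<and>
     \<Union>(fst ` trivs E) = UNIV \<and>
     (\<forall>(U, \<Phi>)\<in>trivs E. open U \<and>
        (\<forall>x\<in>U. bij_betw (\<Phi> x) (fibre E x) UNIV \<and>
           (\<forall>u\<in>fibre E x. \<forall>w\<in>fibre E x. \<Phi> x (u + w) = \<Phi> x u + \<Phi> x w) \<and>
           (\<forall>r. \<forall>u\<in>fibre E x. \<Phi> x (r *\<^sub>R u) = r *\<^sub>R \<Phi> x u))) \<and>
     (\<forall>(U, \<Phi>)\<in>trivs E. \<forall>(V, \<Psi>)\<in>trivs E. \<forall>w.
        smooth_map_on (charts E) (U \<inter> V) (\<lambda>x. \<Psi> x (inv_into (fibre E x) (\<Phi> x) w)))"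

definition Cinf :: "('m, 'e::real_inner, 'v, 'f) vbundle \<Rightarrow> ('m \<Rightarrow> real) set" where
  "Cinf E = {f. smooth_map_on (charts E) UNIV f}"

definition Sec :: "('m, 'e::real_inner, 'v, 'f::real_inner) vbundle \<Rightarrow> ('m \<Rightarrow> 'v) set" where
  "Sec E = {X. (\<forall>x. X x \<in> fibre E x) \<and>
               (\<forall>(U, \<Phi>)\<in>trivs E. smooth_map_on (charts E) U (\<lambda>x. \<Phi> x (X x)))}"


section \<open>Multidifferential operators\<close>

text \<open>A map in \<open>p\<close> arguments from \<^const>\<open>Sec\<close> is a function on lists of length \<open>p\<close>; arguments
  are numbered from 0.\<close>

definition fmult :: "('m \<Rightarrow> real) \<Rightarrow> ('m \<Rightarrow> 'w::real_vector) \<Rightarrow> 'm \<Rightarrow> 'w" where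
  "fmult f X = (\<lambda>x. f x *\<^sub>R X x)"

definition args :: "('m, 'e::real_inner, 'v, 'f::real_inner) vbundle \<Rightarrow> nat \<Rightarrow> ('m \<Rightarrow> 'v) list set" where
  "args E p = {Xs. length Xs = p \<and> set Xs \<subseteq> Sec E}"

definition \<delta> :: "nat \<Rightarrow> ('m \<Rightarrow> real) \<Rightarrow> (('m \<Rightarrow> 'v::real_vector) list \<Rightarrow> 'm \<Rightarrow> 'w::real_vector)
    \<Rightarrow> ('m \<Rightarrow> 'v) list \<Rightarrow> 'm \<Rightarrow> 'w" where
  "\<delta> i f D = (\<lambda>Xs x. D (Xs[i := fmult f (Xs ! i)]) x - f x *\<^sub>R D Xs x)"

definition order_le :: "('m, 'e::real_inner, 'v::real_vector, 'f::real_inner) vbundle \<Rightarrow> nat \<Rightarrow> nat \<Rightarrow> nat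
    \<Rightarrow> (('m \<Rightarrow> 'v) list \<Rightarrow> 'm \<Rightarrow> 'w::real_vector) \<Rightarrow> bool" where
  "order_le E p i k D \<longleftrightarrow>
     (\<forall>fs. length fs = k + 1 \<and> set fs \<subseteq> Cinf E \<longrightarrow>
        (\<forall>Xs\<in>args E p. foldr (\<delta> i) fs D Xs = (\<lambda>x. 0)))"

definition total_order_le :: "('m, 'e::real_inner, 'v::real_vector, 'f::real_inner) vbundle \<Rightarrow> nat \<Rightarrow> nat
    \<Rightarrow> (('m \<Rightarrow> 'v) list \<Rightarrow> 'm \<Rightarrow> 'w::real_vector) \<Rightarrow> bool" where
  "total_order_le E p k D \<longleftrightarrow>
     (\<forall>ifs. length ifs = k + 1 \<and> set ifs \<subseteq> {..<p} \<times> Cinf E \<longrightarrow>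
        (\<forall>Xs\<in>args E p. foldr (\<lambda>(i, f). \<delta> i f) ifs D Xs = (\<lambda>x. 0)))"

definition multilinear :: "('m, 'e::real_inner, 'v::real_vector, 'f::real_inner) vbundle \<Rightarrow> nat
    \<Rightarrow> (('m \<Rightarrow> 'v) list \<Rightarrow> 'm \<Rightarrow> 'w::real_vector) \<Rightarrow> bool" where
  "multilinear E p D \<longleftrightarrow>
     (\<forall>Xs\<in>args E p. \<forall>i<p. \<forall>Y\<in>Sec E. \<forall>Z\<in>Sec E. \<forall>r.
        D (Xs[i := (\<lambda>x. Y x + Z x)]) = (\<lambda>x. D (Xs[i := Y]) x + D (Xs[i := Z]) x) \<and>
        D (Xs[i := (\<lambda>x. r *\<^sub>R Y x)]) = (\<lambda>x. r *\<^sub>R D (Xs[i := Y]) x))"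

definition multidifferential :: "('m, 'e::real_inner, 'v::real_vector, 'f::real_inner) vbundle \<Rightarrow> nat
    \<Rightarrow> ('m \<Rightarrow> 'w::real_vector) set \<Rightarrow> (('m \<Rightarrow> 'v) list \<Rightarrow> 'm \<Rightarrow> 'w) \<Rightarrow> bool" where
  "multidifferential E p V D \<longleftrightarrow>
     (\<forall>Xs\<in>args E p. D Xs \<in> V) \<and> multilinear E p D \<and> (\<exists>k. \<forall>i<p. order_le E p i k D)"


section \<open>Loday algebroid structures\<close>

text \<open>Brackets are normalized to vanish outside \<^const>\<open>Sec\<close>, so that two structures are equal
  iff they agree on sections.\<close>

definition loday_algebroids :: "('m, 'e::real_inner, 'v::real_vector, 'f::real_inner) vbundle
    \<Rightarrow> (('m \<Rightarrow> 'v) \<Rightarrow> ('m \<Rightarrow> 'v) \<Rightarrow> 'm \<Rightarrow> 'v) set" where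
  "loday_algebroids E = {B.
     (\<forall>X Y. \<not> (X \<in> Sec E \<and> Y \<in> Sec E) \<longrightarrow> B X Y = (\<lambda>x. 0)) \<and>
     multidifferential E 2 (Sec E) (\<lambda>Xs. B (Xs ! 0) (Xs ! 1)) \<and>
     total_order_le E 2 1 (\<lambda>Xs. B (Xs ! 0) (Xs ! 1)) \<and>
     (\<forall>X\<in>Sec E. \<forall>Y\<in>Sec E. \<forall>Z\<in>Sec E.
        B X (B Y Z) = (\<lambda>x. B (B X Y) Z x + B Y (B X Z) x)) \<and>
     (\<forall>X\<in>Sec E. \<forall>f\<in>Cinf E. \<exists>g\<in>Cinf E. \<forall>Y\<in>Sec E.
        (\<lambda>x. B X (fmult f Y) x - f x *\<^sub>R B X Y x) = fmult g Y)}"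


section \<open>The reduced shuffle algebra\<close>

type_synonym ('m, 'v) cochain = "('m \<Rightarrow> 'v) list \<Rightarrow> 'm \<Rightarrow> real"

text \<open>A homogeneous element of degree \<open>p\<close> is extended by 0 to all other lists.  An element of the
  direct sum over all degrees is then a single function on lists, whose component of degree \<open>p\<close>
  is its restriction to lists of length \<open>p\<close>.\<close>

definition diff_ops :: "('m, 'e::real_inner, 'v::real_vector, 'f::real_inner) vbundle \<Rightarrow> nat
    \<Rightarrow> ('m, 'v) cochain set" where
  "diff_ops E p = {c. (\<forall>Xs. Xs \<notin> args E p \<longrightarrow> c Xs = (\<lambda>x. 0)) \<and> multidifferential E p (Cinf E) c}"

definition reduced_ops :: "('m, 'e::real_inner, 'v::real_vector, 'f::real_inner) vbundle \<Rightarrow> nat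
    \<Rightarrow> ('m, 'v) cochain set" where
  "reduced_ops E k = {c \<in> diff_ops E k.
     k \<ge> 1 \<longrightarrow> order_le E k (k - 1) 0 c \<and> total_order_le E k (k - 1) c}"

definition component :: "nat \<Rightarrow> ('m, 'v) cochain \<Rightarrow> ('m, 'v) cochain" where
  "component p c = (\<lambda>Xs. if length Xs = p then c Xs else (\<lambda>x. 0))"

definition reduced_shuffle :: "('m, 'e::real_inner, 'v::real_vector, 'f::real_inner) vbundle
    \<Rightarrow> ('m, 'v) cochain set" where
  "reduced_shuffle E = {c. (\<forall>p. component p c \<in> reduced_ops E p) \<and>
                           finite {p. component p c \<noteq> (\<lambda>Xs x. 0)}}"

definition sh :: "nat \<Rightarrow> nat \<Rightarrow> (nat \<Rightarrow> nat) set" where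
  "sh p q = {\<sigma>. \<sigma> permutes {..<p + q} \<and> strict_mono_on {..<p} \<sigma> \<and> strict_mono_on {p..<p + q} \<sigma>}"

text \<open>The bilinear extension of the shuffle product to the direct sum: on homogeneous factors of
  degrees \<open>p\<close> and \<open>q\<close> only the summand with that \<open>p\<close> and \<open>length Xs = p + q\<close> can be nonzero.\<close>

definition shuffle :: "('m, 'v) cochain \<Rightarrow> ('m, 'v) cochain \<Rightarrow> ('m, 'v) cochain" (infixl "\<pitchfork>" 70) where
  "c \<pitchfork> d = (\<lambda>Xs x. \<Sum>p\<le>length Xs. \<Sum>\<sigma>\<in>sh p (length Xs - p).
     of_int (sign \<sigma>) * c (map (\<lambda>i. Xs ! \<sigma> i) [0..<p]) x * d (map (\<lambda>i. Xs ! \<sigma> i) [p..<length Xs]) x)"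


section \<open>Homological vector fields\<close>

text \<open>A function as an element of degree 0.\<close>

definition fn :: "('m \<Rightarrow> real) \<Rightarrow> ('m, 'v) cochain" where
  "fn f = (\<lambda>Xs. if Xs = [] then f else (\<lambda>x. 0))"

definition graded_derivations :: "('m, 'e::real_inner, 'v::real_vector, 'f::real_inner) vbundle
    \<Rightarrow> (('m, 'v) cochain \<Rightarrow> ('m, 'v) cochain) set" where
  "graded_derivations E = {d \<in> extensional (reduced_shuffle E).
     (\<forall>k. \<forall>c\<in>reduced_ops E k. d c \<in> reduced_ops E (Suc k)) \<and>
     (\<forall>a\<in>reduced_shuffle E. \<forall>b\<in>reduced_shuffle E.
        d (\<lambda>Xs x. a Xs x + b Xs x) = (\<lambda>Xs x. d a Xs x + d b Xs x)) \<and>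
     (\<forall>r. \<forall>a\<in>reduced_shuffle E. d (\<lambda>Xs x. r * a Xs x) = (\<lambda>Xs x. r * d a Xs x)) \<and>
     (\<forall>p. \<forall>a\<in>reduced_ops E p. \<forall>b\<in>reduced_shuffle E.
        d (a \<pitchfork> b) = (\<lambda>Xs x. (d a \<pitchfork> b) Xs x + (- 1) ^ p * (a \<pitchfork> d b) Xs x))}"

text \<open>Sections of the dual bundle are the elements of \<open>reduced_ops E 1\<close>, with pairing
  \<open>\<langle>l, X\<rangle> = l [X]\<close>.\<close>

definition derived_bracket :: "('m, 'e::real_inner, 'v::real_vector, 'f::real_inner) vbundle
    \<Rightarrow> (('m, 'v) cochain \<Rightarrow> ('m, 'v) cochain) \<Rightarrow> ('m \<Rightarrow> 'v) \<Rightarrow> ('m \<Rightarrow> 'v) \<Rightarrow> 'm \<Rightarrow> 'v" where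
  "derived_bracket E d X Y =
     (if X \<in> Sec E \<and> Y \<in> Sec E
      then THE Z. Z \<in> Sec E \<and> (\<forall>l\<in>reduced_ops E 1.
             l [Z] = (\<lambda>x. d (fn (l [Y])) [X] x - d (fn (l [X])) [Y] x - d l [X, Y] x))
      else (\<lambda>x. 0))"

definition Der1 :: "('m, 'e::real_inner, 'v::real_vector, 'f::real_inner) vbundle
    \<Rightarrow> (('m, 'v) cochain \<Rightarrow> ('m, 'v) cochain) set" where
  "Der1 E = {d \<in> graded_derivations E.
     \<forall>c\<in>reduced_ops E 2. \<forall>X1\<in>Sec E. \<forall>X2\<in>Sec E. \<forall>X3\<in>Sec E.
       d c [X1, X2, X3] = (\<lambda>x.
           d (fn (c [X2, X3])) [X1] x - d (fn (c [X1, X3])) [X2] x + d (fn (c [X1, X2])) [X3] x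
         - c [derived_bracket E d X1 X2, X3] x
         - c [X2, derived_bracket E d X1 X3] x
         + c [X1, derived_bracket E d X2 X3] x)}"

definition homological_fields :: "('m, 'e::real_inner, 'v::real_vector, 'f::real_inner) vbundle
    \<Rightarrow> (('m, 'v) cochain \<Rightarrow> ('m, 'v) cochain) set" where
  "homological_fields E = {d \<in> Der1 E. \<forall>c\<in>reduced_shuffle E. d (d c) = (\<lambda>Xs x. 0)}"

definition field_equiv :: "('m, 'e::real_inner, 'v::real_vector, 'f::real_inner) vbundle
    \<Rightarrow> ((('m, 'v) cochain \<Rightarrow> ('m, 'v) cochain) \<times> (('m, 'v) cochain \<Rightarrow> ('m, 'v) cochain)) set" where
  "field_equiv E = {(d, d'). d \<in> homological_fields E \<and> d' \<in> homological_fields E \<and>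
     (\<forall>c\<in>reduced_ops E 0 \<union> reduced_ops E 1. d c = d' c)}"

end

theory Submission
  imports Defs
begin

text \<open>
  A homological field \<open>\<partial>\<close> has the anchor \<open>\<rho>(X) f = \<langle>X, \<partial> f\<rangle>\<close>.  The right-hand side of the formula
  for \<open>[X, Y]\<close> is function-linear in the covector, so by reflexivity of the module of sections
  (local frames cut off by bump functions) it defines a section.  That \<open>\<partial>\<close> lands in the reduced
  operators gives the order conditions on the bracket, \<open>\<partial>\<^sup>2 f = 0\<close> makes the anchor a
  homomorphism, and \<open>\<partial>\<^sup>2 l = 0\<close> together with the prescribed form of \<open>\<partial>\<close> on 2-cochains is the
  Jacobi identity.  The bracket determines the anchor wherever some section is nonzero, and then
  \<open>\<partial>\<close> on functions and covectors, which is injectivity on equivalence classes.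

  Conversely, the Loday differential of a Loday algebroid is defined recursively by Cartan's formula
  \<open>\<iota>\<^sub>X \<partial> = L\<^sub>X - \<partial> \<iota>\<^sub>X\<close>, with \<open>\<iota>\<^sub>X\<close> the insertion of a first argument.  As \<open>\<iota>\<^sub>X\<close> is a graded
  derivation of the shuffle product, the identities \<open>[L\<^sub>X, L\<^sub>Y] = L\<^bsub>[X, Y]\<^esub>\<close>, \<open>[L\<^sub>X, \<partial>] = 0\<close>,
  \<open>\<partial>\<^sup>2 = 0\<close> and the Leibniz rules for \<open>L\<^sub>X\<close> and \<open>\<partial>\<close> all follow by induction on the list of
  arguments.  Orders add up under composition, which bounds the total order of \<open>\<partial>c\<close>; the terms
  spoiling order 0 in the last argument cancel.
\<close>

section \<open>Shuffles\<close>

text \<open>A product of two covectors is skew, whereas an operator of degree 2 need not be, so the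
  derivation rule does not extend the values on functions and covectors to the whole algebra; the
  additional formula in \<open>Der1\<close> reaches degree 2 only. Hence fields are compared up to
  equivalence, and surjectivity needs a differential constructed in every degree.

  The bracket is not skew either: only \<open>B X\<close> acts by derivations, and arguments must
  keep their order. Insertion of a first argument respects this order, which is why the shuffle
  product is accessed through its recursion on the first argument.

  The bounds on orders are balanced. A bracket of total order 1 substituted into an operator of
  total order k - 1 gives total order k, just what degree k + 1 allows. The mixed commutator in the
  bound on the bracket is also the source of the function-linearity of the anchor in its section.
  The derivative condition yields an anchor value for each section and function separately; how
  these values depend on both has to be recovered by testing on nonvanishing sections.\<close>

definition shift_perm :: "(nat \<Rightarrow> nat) \<Rightarrow> nat \<Rightarrow> nat" where
  "shift_perm \<sigma> i = (case i of 0 \<Rightarrow> 0 | Suc j \<Rightarrow> Suc (\<sigma> j))"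

text \<open>A shuffle of n + 1 letters arises from one of n letters by putting the value 0 at the
  start of a block. \<open>shift_perm\<close> alone serves the left block; precomposed with this
  cycle it puts 0 at position p, where the right block begins.\<close>

definition front_cycle :: "nat \<Rightarrow> nat \<Rightarrow> nat" where
  "front_cycle p i = (if i < p then Suc i else if i = p then 0 else i)"

lemma shift_perm_simps [simp]:
  "shift_perm \<sigma> 0 = 0" "shift_perm \<sigma> (Suc j) = Suc (\<sigma> j)"
  by (simp_all add: shift_perm_def)

lemma shift_perm_comp: "shift_perm (\<sigma> \<circ> \<tau>) = shift_perm \<sigma> \<circ> shift_perm \<tau>"
  by (auto simp: fun_eq_iff shift_perm_def split: nat.splits)

lemma shift_perm_id: "shift_perm id = id"
  by (auto simp: fun_eq_iff shift_perm_def split: nat.splits)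

lemma shift_perm_inj: "shift_perm \<sigma> = shift_perm \<tau> \<Longrightarrow> \<sigma> = \<tau>"
  by (metis ext nat.inject shift_perm_simps(2))

lemma permutes_by_inverse:
  assumes "\<And>x. x \<notin> S \<Longrightarrow> p x = x" "\<And>x. p (q x) = x" "\<And>x. q (p x) = x"
  shows "p permutes S"
  unfolding permutes_def using assms by metis

lemma shift_perm_permutes:
  assumes "\<sigma> permutes {..<n}" shows "shift_perm \<sigma> permutes {..<Suc n}"
proof (rule permutes_by_inverse[where q = "shift_perm (inv \<sigma>)"])
  show "shift_perm \<sigma> x = x" if "x \<notin> {..<Suc n}" for x
    using that assms by (auto simp: shift_perm_def permutes_def split: nat.splits)
  show "shift_perm \<sigma> (shift_perm (inv \<sigma>) x) = x" for x
    using permutes_inverses[OF assms] by (simp add: shift_perm_def split: nat.splits)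
  show "shift_perm (inv \<sigma>) (shift_perm \<sigma> x) = x" for x
    using permutes_inverses[OF assms] by (simp add: shift_perm_def split: nat.splits)
qed

lemma permutes_fix_0_shift:
  assumes "\<sigma> permutes {..<Suc n}" "\<sigma> 0 = 0"
  obtains \<tau> where "\<tau> permutes {..<n}" "\<sigma> = shift_perm \<tau>"
proof -
  \<comment> \<open>\<open>u\<close> conjugates with the successor. The truncated subtraction loses
    nothing, since a permutation fixing 0 maps successors to successors.\<close>
  define u where "u f i = f (Suc i) - 1" for f :: "nat \<Rightarrow> nat" and i
  have i0: "inv \<sigma> 0 = 0" using assms by (metis permutes_inverses(2))
  have s: "\<sigma> (Suc i) = Suc (u \<sigma> i)" "inv \<sigma> (Suc i) = Suc (u (inv \<sigma>) i)" for i
    using permutes_inverses[OF assms(1)] assms(2) i0 unfolding u_def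
    by (metis One_nat_def Suc_pred gr0I nat.distinct(1))+
  have "u \<sigma> permutes {..<n}"
  proof (rule permutes_by_inverse[where q = "u (inv \<sigma>)"])
    show "u \<sigma> x = x" if "x \<notin> {..<n}" for x
    proof -
      have "\<sigma> (Suc x) = Suc x" using that assms(1) by (intro permutes_not_in) auto
      then show ?thesis by (simp add: u_def)
    qed
    show "u \<sigma> (u (inv \<sigma>) x) = x" for x
      using permutes_inverses(1)[OF assms(1), of "Suc x"] s by simp
    show "u (inv \<sigma>) (u \<sigma> x) = x" for x
      using permutes_inverses(2)[OF assms(1), of "Suc x"] s by simp
  qed
  moreover have "\<sigma> = shift_perm (u \<sigma>)"
    using assms(2) s by (auto simp: fun_eq_iff shift_perm_def split: nat.splits)
  ultimately show ?thesis using that by blast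
qed

text \<open>Shifting sends the transposition of a and b to that of their successors, so a
  factorization into transpositions keeps its length.\<close>

lemma sign_shift_perm:
  assumes "\<sigma> permutes {..<n}" shows "sign (shift_perm \<sigma>) = sign \<sigma>"
  using assms finite_lessThan
proof (induction rule: permutes_induct)
  case id
  show ?case by (simp only: shift_perm_id)
next
  case (swap a b p)
  have tr: "shift_perm (Transposition.transpose a b) = Transposition.transpose (Suc a) (Suc b)"
    by (auto simp: fun_eq_iff shift_perm_def Transposition.transpose_def split: nat.splits)
  have p: "permutation p" "permutation (shift_perm p)"
    using swap shift_perm_permutes permutes_imp_permutation finite_lessThan by blast+
  have "sign (shift_perm (Transposition.transpose a b \<circ> p))
      = sign (Transposition.transpose (Suc a) (Suc b)) * sign (shift_perm p)"
    unfolding shift_perm_comp tr by (rule sign_compose[OF permutation_swap_id p(2)])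
  also have "\<dots> = sign (Transposition.transpose a b) * sign p"
    using swap by (simp only: sign_swap_id) simp
  also have "\<dots> = sign (Transposition.transpose a b \<circ> p)"
    by (rule sign_compose[OF permutation_swap_id p(1), symmetric])
  finally show ?case .
qed

text \<open>Unrolled, this writes the cycle as a product of p adjacent transpositions, which is how
  its sign is found.\<close>

lemma front_cycle_Suc: "front_cycle (Suc p) = front_cycle p \<circ> Transposition.transpose p (Suc p)"
  by (auto simp: fun_eq_iff front_cycle_def Transposition.transpose_def)

lemma front_cycle_permutes: "front_cycle p permutes {..p}"
proof (rule permutes_by_inverse[where q = "\<lambda>i. if i = 0 then p else if i \<le> p then i - 1 else i"])
qed (auto simp: front_cycle_def)

lemma sign_front_cycle: "sign (front_cycle p) = (- 1) ^ p"
proof (induction p)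
  case 0
  have "front_cycle 0 = id" by (auto simp: fun_eq_iff front_cycle_def)
  then show ?case by simp
next
  case (Suc p)
  have "permutation (front_cycle p)"
    using front_cycle_permutes permutes_imp_permutation finite_atMost by blast
  then have "sign (front_cycle p \<circ> Transposition.transpose p (Suc p))
      = sign (front_cycle p) * sign (Transposition.transpose p (Suc p))"
    by (rule sign_compose[OF _ permutation_swap_id])
  then show ?case using Suc by (simp only: front_cycle_Suc sign_swap_id) simp
qed

lemma shift_perm_sh_iff: "shift_perm \<tau> \<in> sh (Suc p) q \<longleftrightarrow> \<tau> \<in> sh p q"
proof -
  have "shift_perm \<tau> permutes {..<Suc (p + q)} \<longleftrightarrow> \<tau> permutes {..<p + q}"
    using shift_perm_permutes permutes_fix_0_shift[of "shift_perm \<tau>"] shift_perm_inj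
    by (metis shift_perm_simps(1))
  moreover have "strict_mono_on {..<Suc p} (shift_perm \<tau>) \<longleftrightarrow> strict_mono_on {..<p} \<tau>"
  proof
    assume *: "strict_mono_on {..<Suc p} (shift_perm \<tau>)"
    show "strict_mono_on {..<p} \<tau>"
    proof (rule strict_mono_onI)
      fix r s assume "r \<in> {..<p}" "s \<in> {..<p}" "r < s"
      then show "\<tau> r < \<tau> s" using strict_mono_onD[OF *, of "Suc r" "Suc s"] by auto
    qed
  next
    assume *: "strict_mono_on {..<p} \<tau>"
    show "strict_mono_on {..<Suc p} (shift_perm \<tau>)"
    proof (rule strict_mono_onI)
      fix r s assume "r \<in> {..<Suc p}" "s \<in> {..<Suc p}" "r < s"
      then show "shift_perm \<tau> r < shift_perm \<tau> s"
        using strict_mono_onD[OF *, of "r - 1" "s - 1"] by (cases r; cases s) auto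
    qed
  qed
  moreover have "strict_mono_on {Suc p..<Suc p + q} (shift_perm \<tau>) \<longleftrightarrow> strict_mono_on {p..<p + q} \<tau>"
  proof
    assume *: "strict_mono_on {Suc p..<Suc p + q} (shift_perm \<tau>)"
    show "strict_mono_on {p..<p + q} \<tau>"
    proof (rule strict_mono_onI)
      fix r s assume "r \<in> {p..<p + q}" "s \<in> {p..<p + q}" "r < s"
      then show "\<tau> r < \<tau> s" using strict_mono_onD[OF *, of "Suc r" "Suc s"] by auto
    qed
  next
    assume *: "strict_mono_on {p..<p + q} \<tau>"
    show "strict_mono_on {Suc p..<Suc p + q} (shift_perm \<tau>)"
    proof (rule strict_mono_onI)
      fix r s assume "r \<in> {Suc p..<Suc p + q}" "s \<in> {Suc p..<Suc p + q}" "r < s"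
      then show "shift_perm \<tau> r < shift_perm \<tau> s"
        using strict_mono_onD[OF *, of "r - 1" "s - 1"] by (cases r; cases s) auto
    qed
  qed
  ultimately show ?thesis by (simp add: sh_def)
qed

text \<open>Left positions are sent to their successors and right positions beyond p are kept, so
  both blocks of \<open>\<tau>\<close> reappear with values raised by one, and 0 stands in front of
  the right block.\<close>

lemma shift_cycle_sh_iff: "shift_perm \<tau> \<circ> front_cycle p \<in> sh p (Suc q) \<longleftrightarrow> \<tau> \<in> sh p q"
proof -
  let ?\<sigma> = "shift_perm \<tau> \<circ> front_cycle p"
  have fc: "front_cycle p permutes {..<Suc (p + q)}"
    by (rule permutes_subset[OF front_cycle_permutes]) auto
  have "?\<sigma> permutes {..<Suc (p + q)} \<longleftrightarrow> shift_perm \<tau> permutes {..<Suc (p + q)}"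
  proof
    assume "?\<sigma> permutes {..<Suc (p + q)}"
    then have "?\<sigma> \<circ> inv (front_cycle p) permutes {..<Suc (p + q)}"
      by (rule permutes_compose[OF permutes_inv[OF fc]])
    then show "shift_perm \<tau> permutes {..<Suc (p + q)}"
      by (simp add: comp_assoc permutes_inv_o[OF fc])
  qed (rule permutes_compose[OF fc])
  then have "?\<sigma> permutes {..<Suc (p + q)} \<longleftrightarrow> \<tau> permutes {..<p + q}"
    using shift_perm_permutes permutes_fix_0_shift[of "shift_perm \<tau>"] shift_perm_inj
    by (metis shift_perm_simps(1))
  moreover have "strict_mono_on {..<p} ?\<sigma> \<longleftrightarrow> strict_mono_on {..<p} \<tau>"
    by (auto simp: strict_mono_on_def front_cycle_def)
  moreover have "strict_mono_on {p..<Suc (p + q)} ?\<sigma> \<longleftrightarrow> strict_mono_on {p..<p + q} \<tau>"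
  proof
    assume *: "strict_mono_on {p..<Suc (p + q)} ?\<sigma>"
    show "strict_mono_on {p..<p + q} \<tau>"
    proof (rule strict_mono_onI)
      fix r s assume "r \<in> {p..<p + q}" "s \<in> {p..<p + q}" "r < s"
      then show "\<tau> r < \<tau> s"
        using strict_mono_onD[OF *, of "Suc r" "Suc s"] by (auto simp: front_cycle_def)
    qed
  next
    assume *: "strict_mono_on {p..<p + q} \<tau>"
    show "strict_mono_on {p..<Suc (p + q)} ?\<sigma>"
    proof (rule strict_mono_onI)
      fix r s assume "r \<in> {p..<Suc (p + q)}" "s \<in> {p..<Suc (p + q)}" "r < s"
      then show "?\<sigma> r < ?\<sigma> s"
        using strict_mono_onD[OF *, of "r - 1" "s - 1"]
        by (cases r; cases s) (auto simp: front_cycle_def)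
    qed
  qed
  ultimately show ?thesis by (simp add: sh_def)
qed

text \<open>A permutation increasing on a block takes its minimum there at the first position, so
  the value 0 sits at position 0 or at position p. The empty sets account for a block of length 0,
  which cannot contain that value.\<close>

lemma sh_decompose:
  assumes "p + q > 0"
  shows "sh p q = (case p of 0 \<Rightarrow> {} | Suc p' \<Rightarrow> shift_perm ` sh p' q) \<union>
                  (case q of 0 \<Rightarrow> {} | Suc q' \<Rightarrow> (\<lambda>\<tau>. shift_perm \<tau> \<circ> front_cycle p) ` sh p q')"
    (is "_ = ?A \<union> ?B")
proof
  show "?A \<union> ?B \<subseteq> sh p q"
    by (auto simp: shift_perm_sh_iff shift_cycle_sh_iff split: nat.splits)
next
  show "sh p q \<subseteq> ?A \<union> ?B"
  proof
    fix \<sigma> assume \<sigma>: "\<sigma> \<in> sh p q"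
    obtain n where n: "p + q = Suc n" using assms gr0_implies_Suc by blast
    have perm: "\<sigma> permutes {..<Suc n}" using \<sigma> by (simp add: sh_def n)
    obtain i where i: "\<sigma> i = 0" "i < Suc n"
      using permutes_surj[OF perm] perm permutes_in_image[OF perm]
      by (metis lessThan_iff permutes_inverses(1) zero_less_Suc)
    show "\<sigma> \<in> ?A \<union> ?B"
    proof (cases "i < p")
      case True
      have m: "strict_mono_on {..<p} \<sigma>" using \<sigma> by (simp add: sh_def)
      have "i = 0"
      proof (rule ccontr)
        assume "i \<noteq> 0"
        then show False using strict_mono_onD[OF m, of 0 i] True i by auto
      qed
      then obtain \<tau> where "\<sigma> = shift_perm \<tau>" using permutes_fix_0_shift[OF perm] i by blast
      moreover obtain p' where "p = Suc p'" using True by (cases p) auto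
      ultimately show ?thesis using \<sigma> by (simp add: shift_perm_sh_iff)
    next
      case False
      have m: "strict_mono_on {p..<p + q} \<sigma>" using \<sigma> by (simp add: sh_def)
      have ip: "i = p"
      proof (rule ccontr)
        assume "i \<noteq> p"
        then show False using strict_mono_onD[OF m, of p i] False i n by auto
      qed
      have fc: "front_cycle p permutes {..<Suc n}"
        by (rule permutes_subset[OF front_cycle_permutes]) (use ip i in auto)
      have "\<sigma> \<circ> inv (front_cycle p) permutes {..<Suc n}"
        by (rule permutes_compose[OF permutes_inv[OF fc] perm])
      moreover have "inv (front_cycle p) 0 = p"
        by (rule permutes_inv_eq[OF fc, THEN iffD2]) (simp add: front_cycle_def)
      ultimately obtain \<tau> where t: "\<sigma> \<circ> inv (front_cycle p) = shift_perm \<tau>"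
        using permutes_fix_0_shift i(1) ip by (metis comp_apply)
      have "\<sigma> = shift_perm \<tau> \<circ> front_cycle p"
        unfolding t[symmetric] by (simp add: comp_assoc permutes_inv_o[OF fc])
      moreover obtain q' where "q = Suc q'" using ip i n by (cases q) auto
      ultimately show ?thesis using \<sigma> by (auto simp: shift_cycle_sh_iff)
    qed
  qed
qed

section \<open>Splitting off the first argument of a shuffle product\<close>

definition shuffle_part :: "nat \<Rightarrow> nat \<Rightarrow> ('m, 'v) cochain \<Rightarrow> ('m, 'v) cochain \<Rightarrow> ('m, 'v) cochain" where
  "shuffle_part p q a b = (\<lambda>Xs x. \<Sum>\<sigma>\<in>sh p q. of_int (sign \<sigma>)
     * a (map (\<lambda>i. Xs ! \<sigma> i) [0..<p]) x * b (map (\<lambda>i. Xs ! \<sigma> i) [p..<p + q]) x)"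

lemma shuffle_eq_parts: "(a \<pitchfork> b) Xs x = (\<Sum>p\<le>length Xs. shuffle_part p (length Xs - p) a b Xs x)"
  unfolding shuffle_def shuffle_part_def by (intro sum.cong refl) simp

lemma finite_sh: "finite (sh p q)"
  unfolding sh_def by (rule finite_subset[OF _ finite_permutations[of "{..<p + q}"]]) auto

lemma sum_over_shift_perm:
  "(\<Sum>\<sigma>\<in>shift_perm ` sh p q. of_int (sign \<sigma>) * a (map (\<lambda>i. (X # Xs) ! \<sigma> i) [0..<Suc p]) x
      * b (map (\<lambda>i. (X # Xs) ! \<sigma> i) [Suc p..<Suc p + q]) x)
    = shuffle_part p q (\<lambda>Ys. a (X # Ys)) b Xs x"
proof -
  have "map (\<lambda>i. (X # Xs) ! shift_perm \<tau> i) [0..<Suc p] = X # map (\<lambda>i. Xs ! \<tau> i) [0..<p]"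
    "map (\<lambda>i. (X # Xs) ! shift_perm \<tau> i) [Suc p..<Suc p + q] = map (\<lambda>i. Xs ! \<tau> i) [p..<p + q]" for \<tau>
    by (simp_all add: upt_conv_Cons map_Suc_upt[symmetric] del: upt_Suc)
  moreover have "inj_on shift_perm (sh p q)" using shift_perm_inj by (auto intro: inj_onI)
  moreover have "sign (shift_perm \<tau>) = sign \<tau>" if "\<tau> \<in> sh p q" for \<tau>
    using that sign_shift_perm by (auto simp: sh_def)
  ultimately show ?thesis
    unfolding shuffle_part_def by (simp add: sum.reindex del: upt_Suc)
qed

text \<open>The factor \<open>(- 1) ^ p\<close> is the sign of the cycle, that is, of moving the
  first argument past the p arguments of the left factor.\<close>

lemma sum_over_shift_cycle:
  "(\<Sum>\<sigma>\<in>(\<lambda>\<tau>. shift_perm \<tau> \<circ> front_cycle p) ` sh p q. of_int (sign \<sigma>)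
      * a (map (\<lambda>i. (X # Xs) ! \<sigma> i) [0..<p]) x
      * b (map (\<lambda>i. (X # Xs) ! \<sigma> i) [p..<Suc (p + q)]) x)
    = (- 1) ^ p * shuffle_part p q a (\<lambda>Ys. b (X # Ys)) Xs x"
proof -
  let ?s = "\<lambda>\<tau>. shift_perm \<tau> \<circ> front_cycle p"
  have 1: "map (\<lambda>i. (X # Xs) ! ?s \<tau> i) [0..<p] = map (\<lambda>i. Xs ! \<tau> i) [0..<p]" for \<tau>
    by (auto simp: front_cycle_def)
  have 2: "map (\<lambda>i. (X # Xs) ! ?s \<tau> i) [p..<Suc (p + q)] = X # map (\<lambda>i. Xs ! \<tau> i) [p..<p + q]" for \<tau>
  proof -
    have "map (\<lambda>i. (X # Xs) ! ?s \<tau> i) [p..<Suc (p + q)]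
        = X # map (\<lambda>i. (X # Xs) ! ?s \<tau> i) (map Suc [p..<p + q])"
      by (simp add: upt_conv_Cons map_Suc_upt front_cycle_def del: upt_Suc)
    also have "map (\<lambda>i. (X # Xs) ! ?s \<tau> i) (map Suc [p..<p + q]) = map (\<lambda>i. Xs ! \<tau> i) [p..<p + q]"
      by (auto simp: front_cycle_def)
    finally show ?thesis .
  qed
  have inj: "inj_on ?s (sh p q)"
  proof (rule inj_onI)
    fix \<sigma> \<tau> assume "?s \<sigma> = ?s \<tau>"
    then have "?s \<sigma> \<circ> inv (front_cycle p) = ?s \<tau> \<circ> inv (front_cycle p)" by simp
    then show "\<sigma> = \<tau>"
      using shift_perm_inj by (simp add: comp_assoc permutes_inv_o[OF front_cycle_permutes])
  qed
  have sg: "sign (?s \<tau>) = (- 1) ^ p * sign \<tau>" if "\<tau> \<in> sh p q" for \<tau>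
  proof -
    have t: "\<tau> permutes {..<p + q}" using that by (simp add: sh_def)
    have "permutation (shift_perm \<tau>)" "permutation (front_cycle p)"
      using shift_perm_permutes[OF t] front_cycle_permutes permutes_imp_permutation
        finite_lessThan finite_atMost by blast+
    then show ?thesis by (simp add: sign_compose sign_shift_perm[OF t] sign_front_cycle)
  qed
  show ?thesis
    unfolding shuffle_part_def sum_distrib_left
    by (subst sum.reindex[OF inj], intro sum.cong refl) (simp only: o_apply[of _ ?s] 1 2 sg, simp add: mult_ac)
qed

lemma shuffle_part_Cons:
  assumes "p + q > 0"
  shows "shuffle_part p q a b (X # Xs) x =
    (case p of 0 \<Rightarrow> 0 | Suc p' \<Rightarrow> shuffle_part p' q (\<lambda>Ys. a (X # Ys)) b Xs x) +
    (case q of 0 \<Rightarrow> 0 | Suc q' \<Rightarrow> (- 1) ^ p * shuffle_part p q' a (\<lambda>Ys. b (X # Ys)) Xs x)"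
proof -
  let ?t = "\<lambda>\<sigma>. of_int (sign \<sigma>) * a (map (\<lambda>i. (X # Xs) ! \<sigma> i) [0..<p]) x
      * b (map (\<lambda>i. (X # Xs) ! \<sigma> i) [p..<p + q]) x"
  let ?A = "case p of 0 \<Rightarrow> {} | Suc p' \<Rightarrow> shift_perm ` sh p' q"
  let ?B = "case q of 0 \<Rightarrow> {} | Suc q' \<Rightarrow> (\<lambda>\<tau>. shift_perm \<tau> \<circ> front_cycle p) ` sh p q'"
  have fin: "finite ?A" "finite ?B" by (auto simp: finite_sh split: nat.splits)
  \<comment> \<open>The value at position p separates the two families: it is 0 precisely after the
    cycle.\<close>
  have "\<sigma> p \<noteq> 0" if "\<sigma> \<in> ?A" for \<sigma> using that by (auto split: nat.splits)
  moreover have "\<sigma> p = 0" if "\<sigma> \<in> ?B" for \<sigma> using that by (auto simp: front_cycle_def split: nat.splits)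
  ultimately have disj: "?A \<inter> ?B = {}" by blast
  have "shuffle_part p q a b (X # Xs) x = sum ?t ?A + sum ?t ?B"
    unfolding shuffle_part_def sh_decompose[OF assms] by (rule sum.union_disjoint[OF fin disj])
  moreover have "sum ?t ?A = (case p of 0 \<Rightarrow> 0 | Suc p' \<Rightarrow> shuffle_part p' q (\<lambda>Ys. a (X # Ys)) b Xs x)"
    using sum_over_shift_perm[where a = a and b = b and X = X and Xs = Xs and x = x and q = q] by (cases p) (simp_all del: upt_Suc)
  moreover have "sum ?t ?B = (case q of 0 \<Rightarrow> 0 | Suc q' \<Rightarrow> (- 1) ^ p * shuffle_part p q' a (\<lambda>Ys. b (X # Ys)) Xs x)"
    using sum_over_shift_cycle[where a = a and b = b and X = X and Xs = Xs and x = x and p = p] by (cases q) (simp_all del: upt_Suc)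
  ultimately show ?thesis by simp
qed

definition ins :: "('m \<Rightarrow> 'v) \<Rightarrow> ('m, 'v) cochain \<Rightarrow> ('m, 'v) cochain" where
  "ins X c = (\<lambda>Ys. c (X # Ys))"

text \<open>The grading involution on all degrees at once. It supplies the Koszul sign for factors
  that are not homogeneous, so that inductions over argument lists need not track degrees.\<close>

definition par :: "('m, 'v) cochain \<Rightarrow> ('m, 'v) cochain" where
  "par c = (\<lambda>Ys y. (- 1) ^ length Ys * c Ys y)"

lemma shuffle_Nil: "(a \<pitchfork> b) [] x = a [] x * b [] x"
proof -
  have "sh 0 0 = {id}" by (auto simp: sh_def)
  then show ?thesis by (simp add: shuffle_def)
qed

text \<open>Insertion of a first argument is a graded derivation of the shuffle product; together with
  \<open>shuffle_Nil\<close> this recursion determines the product.\<close>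

lemma shuffle_Cons: "(a \<pitchfork> b) (X # Xs) x = (ins X a \<pitchfork> b) Xs x + (par a \<pitchfork> ins X b) Xs x"
proof -
  let ?n = "length Xs"
  let ?f = "\<lambda>p. case p of 0 \<Rightarrow> 0 | Suc p' \<Rightarrow> shuffle_part p' (Suc ?n - p) (ins X a) b Xs x"
  let ?g = "\<lambda>p. case Suc ?n - p of 0 \<Rightarrow> 0 | Suc q' \<Rightarrow> (- 1) ^ p * shuffle_part p q' a (ins X b) Xs x"
  have "(a \<pitchfork> b) (X # Xs) x = (\<Sum>p\<le>Suc ?n. shuffle_part p (Suc ?n - p) a b (X # Xs) x)"
    by (simp add: shuffle_eq_parts del: sum.atMost_Suc)
  also have "\<dots> = (\<Sum>p\<le>Suc ?n. ?f p + ?g p)"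
    unfolding ins_def by (intro sum.cong refl, rule shuffle_part_Cons) simp
  also have "\<dots> = (\<Sum>p\<le>Suc ?n. ?f p) + (\<Sum>p\<le>Suc ?n. ?g p)" by (rule sum.distrib)
  also have "(\<Sum>p\<le>Suc ?n. ?f p) = (ins X a \<pitchfork> b) Xs x"
    unfolding sum.atMost_Suc_shift by (simp add: shuffle_eq_parts)
  also have "(\<Sum>p\<le>Suc ?n. ?g p) = (\<Sum>p\<le>?n. (- 1) ^ p * shuffle_part p (?n - p) a (ins X b) Xs x)"
    by (simp add: Suc_diff_le)
  also have "\<dots> = (par a \<pitchfork> ins X b) Xs x"
    unfolding shuffle_eq_parts shuffle_part_def sum_distrib_left
    by (intro sum.cong refl) (simp add: par_def mult_ac)
  finally show ?thesis .
qed

lemma shuffle_lin_left: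
  "((\<lambda>Ys y. r * a Ys y + s * a' Ys y) \<pitchfork> b) Xs x = r * (a \<pitchfork> b) Xs x + s * (a' \<pitchfork> b) Xs x"
  unfolding shuffle_def by (simp add: algebra_simps sum.distrib sum_distrib_left)

lemma shuffle_lin_right:
  "(a \<pitchfork> (\<lambda>Ys y. r * b Ys y + s * b' Ys y)) Xs x = r * (a \<pitchfork> b) Xs x + s * (a \<pitchfork> b') Xs x"
  unfolding shuffle_def by (simp add: algebra_simps sum.distrib sum_distrib_left)

section \<open>Cartan calculus\<close>

lemma set_update_subset: "set Ys \<subseteq> S \<Longrightarrow> Z \<in> S \<Longrightarrow> set (Ys[j := Z]) \<subseteq> S"
  using set_update_subset_insert[of Ys j Z] by blast

text \<open>The algebraic side of a Loday algebroid with an anchor, with \<open>S\<close> in the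
  role of the sections and \<open>A\<close> in that of the functions. Smoothness and orders are
  treated separately.\<close>

locale cartan_calculus =
  fixes S :: "('m \<Rightarrow> 'v::real_vector) set" and A :: "('m \<Rightarrow> real) set"
    and B :: "('m \<Rightarrow> 'v) \<Rightarrow> ('m \<Rightarrow> 'v) \<Rightarrow> 'm \<Rightarrow> 'v"
    and \<rho> :: "('m \<Rightarrow> 'v) \<Rightarrow> ('m \<Rightarrow> real) \<Rightarrow> 'm \<Rightarrow> real"
  assumes A_const: "(\<lambda>x. r) \<in> A"
    and A_add: "f \<in> A \<Longrightarrow> g \<in> A \<Longrightarrow> (\<lambda>x. f x + g x) \<in> A"
    and A_mult: "f \<in> A \<Longrightarrow> g \<in> A \<Longrightarrow> (\<lambda>x. f x * g x) \<in> A"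
    and B_closed: "X \<in> S \<Longrightarrow> Y \<in> S \<Longrightarrow> B X Y \<in> S"
    and \<rho>_closed: "X \<in> S \<Longrightarrow> f \<in> A \<Longrightarrow> \<rho> X f \<in> A"
    and \<rho>_add: "X \<in> S \<Longrightarrow> f \<in> A \<Longrightarrow> g \<in> A \<Longrightarrow> \<rho> X (\<lambda>x. f x + g x) = (\<lambda>x. \<rho> X f x + \<rho> X g x)"
    and \<rho>_scale: "X \<in> S \<Longrightarrow> f \<in> A \<Longrightarrow> \<rho> X (\<lambda>x. r * f x) = (\<lambda>x. r * \<rho> X f x)"
    and \<rho>_mult: "X \<in> S \<Longrightarrow> f \<in> A \<Longrightarrow> g \<in> A \<Longrightarrow>
      \<rho> X (\<lambda>x. f x * g x) = (\<lambda>x. \<rho> X f x * g x + f x * \<rho> X g x)"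
    and \<rho>_bracket: "X \<in> S \<Longrightarrow> Y \<in> S \<Longrightarrow> f \<in> A \<Longrightarrow>
      \<rho> (B X Y) f = (\<lambda>x. \<rho> X (\<rho> Y f) x - \<rho> Y (\<rho> X f) x)"
    and jacobi: "X \<in> S \<Longrightarrow> Y \<in> S \<Longrightarrow> Z \<in> S \<Longrightarrow>
      B X (B Y Z) = (\<lambda>x. B (B X Y) Z x + B Y (B X Z) x)"
begin

text \<open>The anchor is controlled on \<open>A\<close> only, so cochains must take values there.
  Imposing this for all lengths together makes the condition stable under
  \<open>ins\<close>.\<close>

definition good :: "('m, 'v) cochain \<Rightarrow> bool" where
  "good c \<longleftrightarrow> (\<forall>Ys. set Ys \<subseteq> S \<longrightarrow> c Ys \<in> A)"

text \<open>Additivity in one slot turns the Jacobi identity, an equation of sections, into an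
  equation between values of \<open>c\<close>.\<close>

definition madd :: "('m, 'v) cochain \<Rightarrow> bool" where
  "madd c \<longleftrightarrow> (\<forall>Ys Zs Y Z. set Ys \<subseteq> S \<longrightarrow> set Zs \<subseteq> S \<longrightarrow> Y \<in> S \<longrightarrow> Z \<in> S \<longrightarrow>
     c (Ys @ (\<lambda>x. Y x + Z x) # Zs) = (\<lambda>x. c (Ys @ Y # Zs) x + c (Ys @ Z # Zs) x))"

definition Lie :: "('m \<Rightarrow> 'v) \<Rightarrow> ('m, 'v) cochain \<Rightarrow> ('m, 'v) cochain" where
  "Lie X c = (\<lambda>Ys y. \<rho> X (c Ys) y - (\<Sum>j<length Ys. c (Ys[j := B X (Ys ! j)]) y))"

text \<open>The Loday differential, defined by Cartan's formula \<open>\<iota>\<^sub>X \<partial> + \<partial> \<iota>\<^sub>X = L\<^sub>X\<close>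
  instead of by its expansion \<open>dif_eq_sum\<close>.\<close>

primrec dif :: "('m \<Rightarrow> 'v) list \<Rightarrow> ('m, 'v) cochain \<Rightarrow> 'm \<Rightarrow> real" where
  "dif [] c = (\<lambda>y. 0)"
| "dif (X # Xs) c = (\<lambda>y. Lie X c Xs y - dif Xs (ins X c) y)"

lemma A_lin: "f \<in> A \<Longrightarrow> g \<in> A \<Longrightarrow> (\<lambda>x. r * f x + s * g x) \<in> A"
  by (intro A_add A_mult A_const)

lemma A_diff: "f \<in> A \<Longrightarrow> g \<in> A \<Longrightarrow> (\<lambda>x. f x - g x) \<in> A"
  using A_lin[of f g 1 "-1"] by simp

lemma A_sum: "(\<And>i. i \<in> I \<Longrightarrow> f i \<in> A) \<Longrightarrow> (\<lambda>x. \<Sum>i\<in>I. f i x) \<in> A"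
  by (induction I rule: infinite_finite_induct) (auto intro: A_const A_add)

lemma \<rho>_lin:
  assumes "X \<in> S" "f \<in> A" "g \<in> A"
  shows "\<rho> X (\<lambda>x. r * f x + s * g x) = (\<lambda>x. r * \<rho> X f x + s * \<rho> X g x)"
proof -
  have "(\<lambda>x. r * f x) \<in> A" "(\<lambda>x. s * g x) \<in> A" using assms A_mult A_const by blast+
  then show ?thesis using assms by (simp add: \<rho>_add \<rho>_scale)
qed

lemma \<rho>_zero: "X \<in> S \<Longrightarrow> \<rho> X (\<lambda>x. 0) = (\<lambda>x. 0)"
  using \<rho>_scale[of X "\<lambda>x. 0" 0] A_const by simp

lemma goodD: "good c \<Longrightarrow> set Ys \<subseteq> S \<Longrightarrow> c Ys \<in> A"
  unfolding good_def by blast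

lemma good_ins: "good c \<Longrightarrow> X \<in> S \<Longrightarrow> good (ins X c)"
  unfolding good_def ins_def by simp

lemma good_par: "good c \<Longrightarrow> good (par c)"
  unfolding good_def par_def by (auto intro: A_mult A_const)

lemma good_Lie: "good c \<Longrightarrow> X \<in> S \<Longrightarrow> good (Lie X c)"
  unfolding good_def[of "Lie X c"] unfolding Lie_def
  by (intro allI impI A_diff \<rho>_closed A_sum goodD[of c] set_update_subset B_closed)
    (auto dest: nth_mem)

lemma dif_in_A: "good c \<Longrightarrow> set Xs \<subseteq> S \<Longrightarrow> dif Xs c \<in> A"
proof (induction Xs arbitrary: c)
  case (Cons X Xs)
  then show ?case
    using goodD[OF good_Lie[of c X], of Xs] by (auto intro!: A_diff Cons.IH good_ins)
qed (simp add: A_const)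

lemma good_dif: "good c \<Longrightarrow> good (\<lambda>Xs. dif Xs c)"
  unfolding good_def[of "\<lambda>Xs. dif Xs c"] using dif_in_A by blast

lemma good_shuffle: "good a \<Longrightarrow> good b \<Longrightarrow> good (a \<pitchfork> b)"
proof -
  have "(a \<pitchfork> b) Xs \<in> A" if "good a" "good b" "set Xs \<subseteq> S" for a b Xs
    using that
  proof (induction Xs arbitrary: a b)
    case Nil
    have "(a \<pitchfork> b) [] = (\<lambda>x. a [] x * b [] x)" by (simp add: fun_eq_iff shuffle_Nil)
    then show ?case using Nil by (simp add: A_mult goodD)
  next
    case (Cons X Xs)
    have "(a \<pitchfork> b) (X # Xs) = (\<lambda>x. (ins X a \<pitchfork> b) Xs x + (par a \<pitchfork> ins X b) Xs x)"
      by (simp add: fun_eq_iff shuffle_Cons)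
    then show ?case using Cons by (simp add: A_add good_ins good_par)
  qed
  then show "good a \<Longrightarrow> good b \<Longrightarrow> good (a \<pitchfork> b)" unfolding good_def[of "a \<pitchfork> b"] by blast
qed

lemma madd_append:
  assumes "madd c" "set Ys \<subseteq> S" "set Zs \<subseteq> S" "Y \<in> S" "Z \<in> S"
  shows "c (Ys @ (\<lambda>x. Y x + Z x) # Zs) = (\<lambda>x. c (Ys @ Y # Zs) x + c (Ys @ Z # Zs) x)"
  using assms(1)[unfolded madd_def, rule_format, OF assms(2-)] .

lemma madd_ins: "madd c \<Longrightarrow> X \<in> S \<Longrightarrow> madd (ins X c)"
  unfolding madd_def[of "ins X c"] using madd_append[of c "X # _"] by (simp add: ins_def)

lemma maddD:
  assumes "madd c" "Y \<in> S" "Z \<in> S" "set Zs \<subseteq> S"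
  shows "c ((\<lambda>x. Y x + Z x) # Zs) x = c (Y # Zs) x + c (Z # Zs) x"
  using fun_cong[OF madd_append[OF assms(1) _ assms(4,2,3), of "[]"], of x] by simp

text \<open>The commutator of insertion and Lie derivative: the summand j = 0 of \<open>Lie\<close>
  brackets the inserted section itself and is split off.\<close>

lemma ins_Lie: "ins Y (Lie X c) = (\<lambda>Ys y. Lie X (ins Y c) Ys y - ins (B X Y) c Ys y)"
  unfolding Lie_def ins_def by (simp add: fun_eq_iff sum.lessThan_Suc_shift del: sum.lessThan_Suc)

lemma ins_dif: "ins Y (\<lambda>Xs. dif Xs c) = (\<lambda>Ys y. Lie Y c Ys y - dif Ys (ins Y c) y)"
  by (simp add: ins_def)

lemma ins_shuffle: "ins X (a \<pitchfork> b) = (\<lambda>Ys y. (ins X a \<pitchfork> b) Ys y + (par a \<pitchfork> ins X b) Ys y)"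
  by (simp add: ins_def[of X "a \<pitchfork> b"] fun_eq_iff shuffle_Cons)

lemma ins_par: "ins X (par c) = (\<lambda>Ys y. - par (ins X c) Ys y)"
  by (simp add: ins_def par_def)

lemma par_par: "par (par c) = c"
  by (simp add: par_def fun_eq_iff flip: mult.assoc power_add power_mult_distrib)

text \<open>Cochains are compared on lists from \<open>S\<close> only, since the differential will
  be replaced by its extension by zero; bracketing an entry does not leave such lists.\<close>

lemma Lie_cong:
  assumes "\<And>Ys. set Ys \<subseteq> S \<Longrightarrow> c Ys = d Ys" "X \<in> S" "set Xs \<subseteq> S"
  shows "Lie X c Xs = Lie X d Xs"
proof -
  have "c (Xs[j := B X (Xs ! j)]) = d (Xs[j := B X (Xs ! j)])" if "j < length Xs" for j
    using that assms(2,3) by (intro assms(1) set_update_subset B_closed) auto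
  then show ?thesis using assms by (simp add: Lie_def)
qed

lemma dif_cong:
  assumes "\<And>Ys. set Ys \<subseteq> S \<Longrightarrow> c Ys = d Ys" "set Xs \<subseteq> S"
  shows "dif Xs c = dif Xs d"
  using assms
proof (induction Xs arbitrary: c d)
  case (Cons X Xs)
  have "Lie X c Xs = Lie X d Xs" using Cons.prems by (intro Lie_cong) auto
  moreover have "dif Xs (ins X c) = dif Xs (ins X d)"
    using Cons.prems by (intro Cons.IH) (auto simp: ins_def)
  ultimately show ?case by simp
qed simp

lemma shuffle_cong:
  assumes "\<And>Ys. set Ys \<subseteq> S \<Longrightarrow> a Ys = a' Ys" "\<And>Ys. set Ys \<subseteq> S \<Longrightarrow> b Ys = b' Ys" "set Xs \<subseteq> S"
  shows "(a \<pitchfork> b) Xs = (a' \<pitchfork> b') Xs"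
  using assms
proof (induction Xs arbitrary: a a' b b')
  case Nil
  then show ?case by (simp add: fun_eq_iff shuffle_Nil)
next
  case (Cons X Xs)
  have "(ins X a \<pitchfork> b) Xs = (ins X a' \<pitchfork> b') Xs" "(par a \<pitchfork> ins X b) Xs = (par a' \<pitchfork> ins X b') Xs"
    using Cons.prems by (auto intro!: Cons.IH simp: ins_def par_def)
  then show ?case by (simp add: fun_eq_iff shuffle_Cons)
qed

lemma Lie_lin:
  assumes "good c" "good d" "X \<in> S" "set Xs \<subseteq> S"
  shows "Lie X (\<lambda>Ys y. r * c Ys y + s * d Ys y) Xs y = r * Lie X c Xs y + s * Lie X d Xs y"
  using assms by (simp add: Lie_def \<rho>_lin goodD sum.distrib sum_distrib_left algebra_simps)

lemma dif_lin:
  assumes "good c" "good d" "set Xs \<subseteq> S"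
  shows "dif Xs (\<lambda>Ys y. r * c Ys y + s * d Ys y) y = r * dif Xs c y + s * dif Xs d y"
  using assms
proof (induction Xs arbitrary: c d)
  case (Cons X Xs)
  have "ins X (\<lambda>Ys y. r * c Ys y + s * d Ys y) = (\<lambda>Ys y. r * ins X c Ys y + s * ins X d Ys y)"
    by (simp add: ins_def)
  then show ?case using Cons by (simp add: Lie_lin good_ins algebra_simps)
qed simp

lemmas Lie_add = Lie_lin[where r = 1 and s = 1, simplified]
lemmas Lie_sub = Lie_lin[where r = 1 and s = "-1", simplified]
lemmas dif_add = dif_lin[where r = 1 and s = 1, simplified]
lemmas dif_sub = dif_lin[where r = 1 and s = "-1", simplified]
lemmas dif_scale = dif_lin[where s = 0, simplified]
lemmas shuffle_sub_left = shuffle_lin_left[where r = 1 and s = "-1", simplified]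
lemmas shuffle_sub_right = shuffle_lin_right[where r = 1 and s = "-1", simplified]
lemmas shuffle_scale_left = shuffle_lin_left[where s = 0, simplified]

lemma Lie_par:
  assumes "good c" "X \<in> S" "set Xs \<subseteq> S"
  shows "Lie X (par c) Xs = par (Lie X c) Xs"
  using assms by (simp add: Lie_def par_def \<rho>_scale goodD sum_distrib_left right_diff_distrib)

lemma dif_par:
  assumes "good c" "set Xs \<subseteq> S"
  shows "dif Xs (par c) y = - ((- 1) ^ length Xs * dif Xs c y)"
  using assms
proof (induction Xs arbitrary: c)
  case (Cons X Xs)
  have "dif Xs (ins X (par c)) y = - dif Xs (par (ins X c)) y"
    using Cons.prems dif_scale[of "par (ins X c)" _ Xs "-1" y]
    by (simp add: ins_par good_par good_ins)
  then show ?case using Cons by (simp add: Lie_par par_def[of "Lie X c"] good_ins algebra_simps)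
qed simp

text \<open>Inserting a section Z reduces the claim for \<open>c\<close> to the claim for
  \<open>ins Z c\<close> plus terms in which Z has been bracketed twice; these match by the Jacobi
  identity in its left Leibniz form.\<close>

lemma Lie_Lie:
  assumes "good c" "madd c" "X \<in> S" "Y \<in> S" "set Ys \<subseteq> S"
  shows "Lie X (Lie Y c) Ys y - Lie Y (Lie X c) Ys y = Lie (B X Y) c Ys y"
  using assms
proof (induction Ys arbitrary: c)
  case Nil
  then show ?case by (simp add: Lie_def \<rho>_bracket goodD)
next
  case (Cons Z Zs)
  have Z: "Z \<in> S" "set Zs \<subseteq> S" using Cons.prems by auto
  \<comment> \<open>The two middle terms are symmetric under exchange of U and V, so they cancel in
    the commutator.\<close>
  have L: "Lie U (Lie V c) (Z # Zs) y = Lie U (Lie V (ins Z c)) Zs y - Lie U (ins (B V Z) c) Zs y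
      - Lie V (ins (B U Z) c) Zs y + c (B V (B U Z) # Zs) y" if "U \<in> S" "V \<in> S" for U V
  proof -
    have "Lie U (Lie V c) (Z # Zs) y = Lie U (ins Z (Lie V c)) Zs y - Lie V c (B U Z # Zs) y"
      using fun_cong[OF fun_cong[OF ins_Lie[of Z U "Lie V c"]], of Zs y] by (simp add: ins_def)
    moreover have "Lie U (ins Z (Lie V c)) Zs y = Lie U (Lie V (ins Z c)) Zs y - Lie U (ins (B V Z) c) Zs y"
      unfolding ins_Lie using that Cons.prems Z
      by (intro Lie_sub good_Lie good_ins B_closed)
    moreover have "Lie V c (B U Z # Zs) y = Lie V (ins (B U Z) c) Zs y - c (B V (B U Z) # Zs) y"
      using fun_cong[OF fun_cong[OF ins_Lie[of "B U Z" V c]], of Zs y] by (simp add: ins_def)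
    ultimately show ?thesis by simp
  qed
  have "Lie (B X Y) c (Z # Zs) y = Lie (B X Y) (ins Z c) Zs y - c (B (B X Y) Z # Zs) y"
    using fun_cong[OF fun_cong[OF ins_Lie[of Z "B X Y" c]], of Zs y] by (simp add: ins_def)
  moreover have "c (B X (B Y Z) # Zs) y = c (B (B X Y) Z # Zs) y + c (B Y (B X Z) # Zs) y"
    unfolding jacobi[OF Cons.prems(3,4) Z(1)] using Cons.prems Z by (intro maddD B_closed)
  moreover have "Lie X (Lie Y (ins Z c)) Zs y - Lie Y (Lie X (ins Z c)) Zs y = Lie (B X Y) (ins Z c) Zs y"
    using Cons.prems Z by (intro Cons.IH good_ins madd_ins)
  ultimately show ?case using L[of X Y] L[of Y X] Cons.prems by simp
qed

text \<open>After inserting Y, Cartan's formula turns the claim into the induction hypothesis for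
  \<open>ins Y c\<close> together with the commutator of \<open>Lie X\<close> and
  \<open>Lie Y\<close>, which is \<open>Lie_Lie\<close>.\<close>

lemma Lie_dif:
  assumes "good c" "madd c" "X \<in> S" "set Ys \<subseteq> S"
  shows "Lie X (\<lambda>Xs. dif Xs c) Ys y = dif Ys (Lie X c) y"
  using assms
proof (induction Ys arbitrary: c)
  case Nil
  then show ?case by (simp add: Lie_def \<rho>_zero)
next
  case (Cons Y Ys)
  have Y: "Y \<in> S" "set Ys \<subseteq> S" using Cons.prems by auto
  have "Lie X (\<lambda>Xs. dif Xs c) (Y # Ys) y
      = Lie X (ins Y (\<lambda>Xs. dif Xs c)) Ys y - dif (B X Y # Ys) c y"
    using fun_cong[OF fun_cong[OF ins_Lie[of Y X "\<lambda>Xs. dif Xs c"]], of Ys y] by (simp add: ins_def)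
  also have "Lie X (ins Y (\<lambda>Xs. dif Xs c)) Ys y
      = Lie X (Lie Y c) Ys y - Lie X (\<lambda>Xs. dif Xs (ins Y c)) Ys y"
    unfolding ins_dif using Cons.prems Y by (intro Lie_sub good_Lie good_dif good_ins)
  also have "Lie X (\<lambda>Xs. dif Xs (ins Y c)) Ys y = dif Ys (Lie X (ins Y c)) y"
    using Cons.prems Y by (intro Cons.IH good_ins madd_ins)
  also have "dif Ys (Lie X (ins Y c)) y = dif Ys (ins Y (Lie X c)) y + dif Ys (ins (B X Y) c) y"
    unfolding ins_Lie using Cons.prems Y
    by (subst dif_sub) (auto intro!: good_Lie good_ins B_closed)
  finally show ?case using Lie_Lie[OF Cons.prems(1,2,3) Y, of y] by simp
qed

text \<open>Applying Cartan's formula twice, an insertion passes through the square at the cost of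
  the commutator of \<open>Lie X\<close> with the differential, which vanishes.\<close>

lemma dif_dif:
  assumes "good c" "madd c" "set Xs \<subseteq> S"
  shows "dif Xs (\<lambda>Ys. dif Ys c) y = 0"
  using assms
proof (induction Xs arbitrary: c)
  case (Cons X Xs)
  then have X: "X \<in> S" "set Xs \<subseteq> S" by auto
  have "dif Xs (ins X (\<lambda>Ys. dif Ys c)) y = dif Xs (Lie X c) y - dif Xs (\<lambda>Ys. dif Ys (ins X c)) y"
    unfolding ins_dif using Cons.prems X by (intro dif_sub good_Lie good_dif good_ins)
  also have "dif Xs (\<lambda>Ys. dif Ys (ins X c)) y = 0"
    using Cons.prems X by (intro Cons.IH good_ins madd_ins)
  finally show ?case using Lie_dif[OF Cons.prems(1,2) X] by simp
qed simp

text \<open>The Leibniz rule of the anchor settles the empty list. The Lie derivative has degree 0,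
  so it commutes with \<open>par\<close> and the induction produces no signs.\<close>

lemma Lie_shuffle:
  assumes "good a" "good b" "X \<in> S" "set Ys \<subseteq> S"
  shows "Lie X (a \<pitchfork> b) Ys y = (Lie X a \<pitchfork> b) Ys y + (a \<pitchfork> Lie X b) Ys y"
  using assms
proof (induction Ys arbitrary: a b)
  case Nil
  have "(a \<pitchfork> b) [] = (\<lambda>x. a [] x * b [] x)" by (simp add: fun_eq_iff shuffle_Nil)
  then show ?case using Nil by (simp add: Lie_def shuffle_Nil \<rho>_mult goodD)
next
  case (Cons Y Ys)
  have Y: "Y \<in> S" "set Ys \<subseteq> S" using Cons.prems by auto
  have par: "(par (Lie X a) \<pitchfork> c) Ys y = (Lie X (par a) \<pitchfork> c) Ys y" for c
    using shuffle_cong[of "par (Lie X a)" "Lie X (par a)" c c Ys] Lie_par[OF Cons.prems(1,3)] Y(2)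
    by simp
  have "Lie X (a \<pitchfork> b) (Y # Ys) y = Lie X (ins Y (a \<pitchfork> b)) Ys y - (a \<pitchfork> b) (B X Y # Ys) y"
    using fun_cong[OF fun_cong[OF ins_Lie[of Y X "a \<pitchfork> b"]], of Ys y]
    by (simp add: ins_def[of Y "Lie X (a \<pitchfork> b)"] ins_def[of "B X Y" "a \<pitchfork> b"])
  also have "Lie X (ins Y (a \<pitchfork> b)) Ys y = Lie X (ins Y a \<pitchfork> b) Ys y + Lie X (par a \<pitchfork> ins Y b) Ys y"
    unfolding ins_shuffle using Cons.prems Y by (intro Lie_add good_shuffle good_par good_ins)
  also have "Lie X (ins Y a \<pitchfork> b) Ys y = (Lie X (ins Y a) \<pitchfork> b) Ys y + (ins Y a \<pitchfork> Lie X b) Ys y"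
    using Cons.prems Y by (intro Cons.IH good_ins)
  also have "Lie X (par a \<pitchfork> ins Y b) Ys y = (Lie X (par a) \<pitchfork> ins Y b) Ys y + (par a \<pitchfork> Lie X (ins Y b)) Ys y"
    using Cons.prems Y by (intro Cons.IH good_ins good_par)
  finally show ?case
    by (simp add: shuffle_Cons ins_Lie shuffle_sub_left shuffle_sub_right par)
qed

text \<open>\<open>Lie X\<close> is an even and \<open>ins X\<close> an odd derivation of the
  product, so Cartan's formula makes the differential an odd derivation by induction on the
  list.\<close>

lemma dif_shuffle:
  assumes "good a" "good b" "set Xs \<subseteq> S"
  shows "dif Xs (a \<pitchfork> b) y = ((\<lambda>Xs. dif Xs a) \<pitchfork> b) Xs y + (par a \<pitchfork> (\<lambda>Xs. dif Xs b)) Xs y"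
  using assms
proof (induction Xs arbitrary: a b)
  case Nil
  then show ?case by (simp add: shuffle_Nil)
next
  case (Cons X Xs)
  have X: "X \<in> S" "set Xs \<subseteq> S" using Cons.prems by auto
  \<comment> \<open>Both \<open>dif\<close> and \<open>ins\<close> anticommute with
    \<open>par\<close>; these two signs cancel the cross terms, in which one factor receives
    \<open>dif\<close> and the other \<open>ins X\<close>.\<close>
  have par_dif: "(par (\<lambda>Xs. dif Xs a) \<pitchfork> c) Xs y = - ((\<lambda>Xs. dif Xs (par a)) \<pitchfork> c) Xs y" for c
  proof -
    have "(par (\<lambda>Xs. dif Xs a) \<pitchfork> c) Xs = ((\<lambda>Xs y. (-1) * dif Xs (par a) y) \<pitchfork> c) Xs"
      by (rule shuffle_cong[OF _ _ X(2)]) (auto simp: par_def[of "\<lambda>Xs. dif Xs a"] dif_par[OF Cons.prems(1)])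
    then show ?thesis using shuffle_scale_left[of "-1" "\<lambda>Xs. dif Xs (par a)" c Xs y] by simp
  qed
  have ins_par: "(ins X (par a) \<pitchfork> c) Xs y = - (par (ins X a) \<pitchfork> c) Xs y" for c
    unfolding ins_par using shuffle_scale_left[of "-1" "par (ins X a)" c Xs y] by simp
  have "dif (X # Xs) (a \<pitchfork> b) y = Lie X (a \<pitchfork> b) Xs y - dif Xs (ins X (a \<pitchfork> b)) y" by simp
  also have "Lie X (a \<pitchfork> b) Xs y = (Lie X a \<pitchfork> b) Xs y + (a \<pitchfork> Lie X b) Xs y"
    using Cons.prems X by (intro Lie_shuffle)
  also have "dif Xs (ins X (a \<pitchfork> b)) y = dif Xs (ins X a \<pitchfork> b) y + dif Xs (par a \<pitchfork> ins X b) y"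
    unfolding ins_shuffle using Cons.prems X by (intro dif_add good_shuffle good_par good_ins)
  also have "dif Xs (ins X a \<pitchfork> b) y
      = ((\<lambda>Xs. dif Xs (ins X a)) \<pitchfork> b) Xs y + (par (ins X a) \<pitchfork> (\<lambda>Xs. dif Xs b)) Xs y"
    using Cons.prems X by (intro Cons.IH good_ins)
  also have "dif Xs (par a \<pitchfork> ins X b) y
      = ((\<lambda>Xs. dif Xs (par a)) \<pitchfork> ins X b) Xs y + (par (par a) \<pitchfork> (\<lambda>Xs. dif Xs (ins X b))) Xs y"
    using Cons.prems X by (intro Cons.IH good_ins good_par)
  finally show ?case
    by (simp add: shuffle_Cons ins_dif shuffle_sub_left shuffle_sub_right par_dif ins_par par_par)
qed

text \<open>The recursion serves the algebraic identities, but linearity in the arguments and total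
  order are estimated summand by summand, which requires this closed form.\<close>

lemma dif_eq_sum:
  "dif Xs c y = (\<Sum>i<length Xs. (- 1) ^ i * Lie (Xs ! i) (\<lambda>Zs. c (take i Xs @ Zs)) (drop (Suc i) Xs) y)"
proof (induction Xs arbitrary: c)
  case (Cons X Xs)
  then show ?case
    by (simp add: sum.lessThan_Suc_shift ins_def sum_negf del: sum.lessThan_Suc)
qed simp

end

section \<open>Smooth functions and bump functions\<close>

text \<open>Derivatives in \<open>Ck_on\<close> are taken in the ambient space, so agreement on a
  set can be transferred only because the set is open.\<close>

lemma Ck_on_cong:
  assumes "open U" "\<And>x. x \<in> U \<Longrightarrow> f x = g x" "Ck_on k U f"
  shows "Ck_on k U g"
proof (cases k)
  case 0
  then show ?thesis using assms continuous_on_cong[of U U f g] by simp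
next
  case (Suc j)
  then obtain f' where f': "\<forall>x\<in>U. (f has_derivative f' x) (at x)" "\<forall>v. Ck_on j U (\<lambda>x. f' x v)"
    using assms(3) by auto
  have "\<forall>x\<in>U. (g has_derivative f' x) (at x)"
    using f'(1) assms(1,2) has_derivative_transform_within_open by blast
  then show ?thesis using f'(2) Suc by auto
qed

lemma Ck_on_subset: "V \<subseteq> U \<Longrightarrow> Ck_on k U f \<Longrightarrow> Ck_on k V f"
proof (induction k arbitrary: f)
  case 0
  then show ?case by (auto intro: continuous_on_subset)
next
  case (Suc k)
  then show ?case by (simp add: subset_iff) blast
qed

lemma Ck_on_Suc_imp: "Ck_on (Suc k) U f \<Longrightarrow> Ck_on k U f"
proof (induction k arbitrary: f)
  case 0
  then show ?case
    by (auto intro!: continuous_at_imp_continuous_on dest: has_derivative_continuous)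
next
  case (Suc k)
  from Suc.prems obtain f' where f': "\<forall>x\<in>U. (f has_derivative f' x) (at x)"
    "\<forall>v. Ck_on (Suc k) U (\<lambda>x. f' x v)" unfolding Ck_on.simps(2)[of "Suc k"] by blast
  with Suc.IH show ?case unfolding Ck_on.simps(2)[of k] by blast
qed

lemma Ck_on_local:
  assumes "\<And>x. x \<in> U \<Longrightarrow> \<exists>V. open V \<and> x \<in> V \<and> Ck_on k V f"
  shows "Ck_on k U f"
  using assms
proof (induction k arbitrary: f)
  case 0
  then show ?case
    by (metis Ck_on.simps(1) continuous_at_imp_continuous_on continuous_on_eq_continuous_at)
next
  case (Suc k)
  \<comment> \<open>Different neighbourhoods come with different derivative functions;
    \<open>F\<close> is one global choice, with which all of them agree by uniqueness of the
    derivative.\<close>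
  define F where "F = (\<lambda>x. frechet_derivative f (at x))"
  have *: "\<exists>V. open V \<and> x \<in> V \<and> (\<forall>y\<in>V. (f has_derivative F y) (at y)) \<and> (\<forall>v. Ck_on k V (\<lambda>y. F y v))"
    if x: "x \<in> U" for x
  proof -
    obtain V f' where V: "open V" "x \<in> V" "\<forall>y\<in>V. (f has_derivative f' y) (at y)"
      "\<forall>v. Ck_on k V (\<lambda>y. f' y v)"
      using Suc.prems[OF x] by auto
    have eq: "f' y = F y" if "y \<in> V" for y
      using V(3) that unfolding F_def by (metis frechet_derivative_at)
    have "Ck_on k V (\<lambda>y. F y v)" for v
      by (rule Ck_on_cong[OF V(1) _ V(4)[rule_format]]) (simp add: eq)
    then show ?thesis using V eq by (intro exI[of _ V]) auto
  qed
  have "\<forall>x\<in>U. (f has_derivative F x) (at x)" using * by blast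
  moreover have "Ck_on k U (\<lambda>x. F x v)" for v
    by (rule Suc.IH) (use * in blast)
  ultimately show ?case by auto
qed

lemma Ck_on_const: "Ck_on k U (\<lambda>x. c)"
proof (induction k arbitrary: c)
  case (Suc k)
  then show ?case by (auto intro!: exI[of _ "\<lambda>x v. 0"])
qed simp

lemma Ck_on_add: "Ck_on k U f \<Longrightarrow> Ck_on k U g \<Longrightarrow> Ck_on k U (\<lambda>x. f x + g x)"
proof (induction k arbitrary: f g)
  case 0
  then show ?case by (auto intro: continuous_intros)
next
  case (Suc k)
  then obtain f' g' where
    "\<forall>x\<in>U. (f has_derivative f' x) (at x)" "\<forall>v. Ck_on k U (\<lambda>x. f' x v)"
    "\<forall>x\<in>U. (g has_derivative g' x) (at x)" "\<forall>v. Ck_on k U (\<lambda>x. g' x v)" by auto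
  then show ?case using Suc.IH
    by (auto intro!: exI[of _ "\<lambda>x v. f' x v + g' x v"] has_derivative_add)
qed

lemma (in bounded_bilinear) Ck_on_prod:
  "Ck_on k U f \<Longrightarrow> Ck_on k U g \<Longrightarrow> Ck_on k U (\<lambda>x. prod (f x) (g x))"
proof (induction k arbitrary: f g)
  case 0
  then show ?case by (auto intro: continuous_on)
next
  case (Suc k)
  then obtain f' g' where *:
    "\<forall>x\<in>U. (f has_derivative f' x) (at x)" "\<forall>v. Ck_on k U (\<lambda>x. f' x v)"
    "\<forall>x\<in>U. (g has_derivative g' x) (at x)" "\<forall>v. Ck_on k U (\<lambda>x. g' x v)" by auto
  have "Ck_on k U f" "Ck_on k U g" using Suc.prems Ck_on_Suc_imp by blast+
  then show ?case using * Suc.IH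
    by (auto intro!: exI[of _ "\<lambda>x v. prod (f x) (g' x v) + prod (f' x v) (g x)"] FDERIV Ck_on_add)
qed

lemma Ck_on_inverse:
  fixes f :: "'a::real_normed_vector \<Rightarrow> real"
  shows "Ck_on k U f \<Longrightarrow> (\<And>x. x \<in> U \<Longrightarrow> f x \<noteq> 0) \<Longrightarrow> Ck_on k U (\<lambda>x. inverse (f x))"
proof (induction k)
  case 0
  then show ?case by (auto intro!: continuous_on_inverse)
next
  case (Suc k)
  then obtain f' where *:
    "\<forall>x\<in>U. (f has_derivative f' x) (at x)" "\<forall>v. Ck_on k U (\<lambda>x. f' x v)" by auto
  have f: "Ck_on k U (\<lambda>x. inverse (f x))" using Suc Ck_on_Suc_imp by blast
  have "Ck_on k U (\<lambda>x. (- 1) * (inverse (f x) * f' x v * inverse (f x)))" for v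
    by (intro bounded_bilinear.Ck_on_prod[OF bounded_bilinear_mult] f *(2)[rule_format] Ck_on_const)
  then show ?case using * Suc.prems(2)
    by (auto intro!: exI[of _ "\<lambda>x v. - (inverse (f x) * f' x v * inverse (f x))"] Deriv.has_derivative_inverse)
qed

text \<open>The division by powers of t closes the family under differentiation: the derivative of a
  member is a combination of the members m + 1 and m + 2. Smoothness then follows by induction on
  the regularity with m arbitrary.\<close>

definition flat :: "nat \<Rightarrow> real \<Rightarrow> real" where
  "flat m t = (if t > 0 then exp (- inverse t) / t ^ m else 0)"

lemma flat_tendsto_0: "(flat m \<longlongrightarrow> 0) (at_right 0)"
proof -
  have "((\<lambda>t. (inverse t) ^ m / exp (inverse t)) \<longlongrightarrow> (0::real)) (at_right 0)"
    using filterlim_compose[OF tendsto_power_div_exp_0 filterlim_inverse_at_top_right] .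
  moreover have "\<forall>\<^sub>F t in at_right 0. (inverse t) ^ m / exp (inverse t) = flat m t"
    unfolding eventually_at_filter flat_def
    by (auto simp: exp_minus field_simps power_inverse)
  ultimately show ?thesis by (rule Lim_transform_eventually)
qed

lemma flat_has_derivative:
  "(flat m has_real_derivative (flat (m + 2) t - real m * flat (m + 1) t)) (at t)"
proof -
  consider "t < 0" | "t > 0" | "t = 0" by linarith
  then show ?thesis
  proof cases
    case 1
    have "((\<lambda>t. 0) has_real_derivative 0) (at t)" by simp
    then have "(flat m has_real_derivative 0) (at t)"
      by (rule has_field_derivative_transform_within_open[where S="{..<0}"]) (use 1 in \<open>auto simp: flat_def\<close>)
    then show ?thesis using 1 by (simp add: flat_def)
  next
    case 2
    have "((\<lambda>t. exp (- inverse t) / t ^ m) has_real_derivative (flat (m + 2) t - real m * flat (m + 1) t)) (at t)"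
    proof (cases m)
      case (Suc j)
      \<comment> \<open>Differentiating the denominator lowers its exponent by a truncated
        subtraction; this equation restores the missing power.\<close>
      have "j = 0 \<or> t ^ j = t * t ^ (j - Suc 0)" by (cases j) auto
      then show ?thesis
        using 2 Suc by (auto intro!: derivative_eq_intros simp: flat_def field_simps power2_eq_square)
    qed (use 2 in \<open>auto intro!: derivative_eq_intros simp: flat_def field_simps power2_eq_square\<close>)
    then show ?thesis
      by (rule has_field_derivative_transform_within_open[where S="{0<..}"]) (use 2 in \<open>auto simp: flat_def\<close>)
  next
    case 3
    \<comment> \<open>To the right of 0 the difference quotient is the next member of the family, to
      the left it is 0.\<close>
    have "((\<lambda>h. flat m h / h) \<longlongrightarrow> 0) (at 0)"
    proof (rule filterlim_split_at)
      have "((\<lambda>h. 0) \<longlongrightarrow> (0::real)) (at_left 0)" by simp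
      moreover have "\<forall>\<^sub>F h in at_left 0. 0 = flat m h / h"
        unfolding eventually_at_filter flat_def by simp
      ultimately show "((\<lambda>h. flat m h / h) \<longlongrightarrow> 0) (at_left 0)" by (rule Lim_transform_eventually)
      have "\<forall>\<^sub>F h in at_right 0. flat (Suc m) h = flat m h / h"
        unfolding eventually_at_filter flat_def by simp
      then show "((\<lambda>h. flat m h / h) \<longlongrightarrow> 0) (at_right 0)" by (rule Lim_transform_eventually[OF flat_tendsto_0])
    qed
    then show ?thesis using 3 by (simp add: DERIV_def flat_def)
  qed
qed

lemma Ck_on_flat:
  fixes f :: "'a::real_normed_vector \<Rightarrow> real"
  shows "Ck_on k U f \<Longrightarrow> Ck_on k U (\<lambda>x. flat m (f x))"
proof (induction k arbitrary: m)
  case 0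
  have "continuous_on UNIV (flat m)"
    using flat_has_derivative by (meson DERIV_isCont continuous_at_imp_continuous_on)
  then show ?case using 0 by (auto intro: continuous_on_compose2)
next
  case (Suc k)
  then obtain f' where *:
    "\<forall>x\<in>U. (f has_derivative f' x) (at x)" "\<forall>v. Ck_on k U (\<lambda>x. f' x v)" by auto
  have f: "Ck_on k U f" using Suc Ck_on_Suc_imp by blast
  define G where "G t = flat (m + 2) t - real m * flat (m + 1) t" for t
  have G: "Ck_on k U (\<lambda>x. flat (m + 2) (f x) + (- real m) * flat (m + 1) (f x))"
    by (intro bounded_bilinear.Ck_on_prod[OF bounded_bilinear_mult] Ck_on_add Suc.IH f Ck_on_const)
  have "((\<lambda>x. flat m (f x)) has_derivative (\<lambda>v. G (f x) * f' x v)) (at x)" if "x \<in> U" for x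
    using has_derivative_compose[OF *(1)[rule_format, OF that]
        flat_has_derivative[unfolded has_field_derivative_def]] unfolding G_def .
  moreover have "Ck_on k U (\<lambda>x. G (f x) * f' x v)" for v
    by (intro bounded_bilinear.Ck_on_prod[OF bounded_bilinear_mult] *(2)[rule_format])
      (use G in \<open>simp add: G_def\<close>)
  ultimately show ?case
    unfolding Ck_on.simps by (intro exI[of _ "\<lambda>x v. G (f x) * f' x v"]) blast
qed

text \<open>Supplies coordinates in a model space or typical fibre without a distinguished basis.
  Dropping 0 from an orthogonal spanning set makes every denominator nonzero; in dimension 0 the set
  is empty.\<close>

lemma finite_dim_orthogonal_basis:
  assumes "finite_dim TYPE('a::real_inner)"
  obtains C :: "'a::real_inner set" where "finite C" "0 \<notin> C" "\<And>w. w = (\<Sum>b\<in>C. (w \<bullet> b / (b \<bullet> b)) *\<^sub>R b)"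
proof -
  obtain B :: "'a set" where "finite B" "span B = UNIV" using assms unfolding finite_dim_def by blast
  then obtain C' :: "'a set" where C': "finite C'" "span C' = UNIV" "pairwise orthogonal C'"
    using basis_orthogonal[of B] by auto
  define C where "C = C' - {0}"
  have sp: "span C = UNIV" using C'(2) unfolding C_def by simp
  have fC: "finite C" using C' C_def by simp
  have "w = (\<Sum>b\<in>C. (w \<bullet> b / (b \<bullet> b)) *\<^sub>R b)" for w
  proof -
    obtain u where u: "w = (\<Sum>b\<in>C. u b *\<^sub>R b)"
      using span_finite[OF fC] sp by (metis (no_types, lifting) UNIV_I imageE)
    have "w \<bullet> b = u b * (b \<bullet> b)" if b: "b \<in> C" for b
    proof -
      have "w \<bullet> b = (\<Sum>c\<in>C. u c * (c \<bullet> b))" unfolding u by (simp add: inner_sum_left)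
      also have "\<dots> = (\<Sum>c\<in>C. if c = b then u b * (b \<bullet> b) else 0)"
        using C'(3) b by (intro sum.cong refl) (auto simp: pairwise_def orthogonal_def C_def)
      also have "\<dots> = u b * (b \<bullet> b)" using fC b by simp
      finally show ?thesis .
    qed
    then show ?thesis by (subst u) (auto intro!: sum.cong simp: C_def)
  qed
  then show ?thesis using that[of C] fC C_def by blast
qed

text \<open>Adding one vector presents the box as the continuous image of an interval times the
  smaller box.\<close>

lemma compact_coordinate_box:
  fixes C :: "'a::real_inner set"
  assumes "finite C"
  shows "compact {\<Sum>b\<in>C. a b *\<^sub>R b | a. \<forall>b\<in>C. \<bar>a b\<bar> \<le> R b}"
  using assms
proof (induction C)
  case (insert c C)
  let ?K = "{\<Sum>b\<in>C. a b *\<^sub>R b | a. \<forall>b\<in>C. \<bar>a b\<bar> \<le> R b}"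
  have "{\<Sum>b\<in>insert c C. a b *\<^sub>R b | a. \<forall>b\<in>insert c C. \<bar>a b\<bar> \<le> R b}
      = (\<lambda>(t, y). t *\<^sub>R c + y) ` ({- R c..R c} \<times> ?K)" (is "?L = ?R")
  proof
    show "?L \<subseteq> ?R" using insert by (auto simp: image_iff abs_le_iff) 
  next
    show "?R \<subseteq> ?L"
    proof clarsimp
      fix t a assume "- R c \<le> t" "t \<le> R c" "\<forall>b\<in>C. \<bar>a b\<bar> \<le> R b"
      moreover have "(\<Sum>b\<in>C. a b *\<^sub>R b) = (\<Sum>b\<in>C. (a(c := t)) b *\<^sub>R b)"
        using insert by (intro sum.cong) auto
      ultimately show "\<exists>aa. t *\<^sub>R c + (\<Sum>b\<in>C. a b *\<^sub>R b) = (\<Sum>b\<in>insert c C. aa b *\<^sub>R b) \<and>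
           \<bar>aa c\<bar> \<le> R c \<and> (\<forall>b\<in>C. \<bar>aa b\<bar> \<le> R b)"
        using insert by (intro exI[of _ "a(c := t)"]) auto
    qed
  qed
  moreover have "compact ((\<lambda>(t, y). t *\<^sub>R c + y) ` ({- R c..R c} \<times> ?K))"
    by (intro compact_continuous_image compact_Times insert.IH)
      (auto simp: case_prod_unfold intro!: continuous_intros)
  ultimately show ?case by simp
qed simp

text \<open>By Cauchy-Schwarz the coordinate of w along b is at most r / norm b, so the closed ball
  is a closed subset of a compact box. Compactness is what makes the support of a bump function
  closed in the manifold.\<close>

lemma compact_cball_finite_dim:
  assumes "finite_dim TYPE('a::real_inner)"
  shows "compact (cball (a::'a::real_inner) r)"
proof -
  obtain C :: "'a set" where C: "finite C" "0 \<notin> C" "\<And>w. w = (\<Sum>b\<in>C. (w \<bullet> b / (b \<bullet> b)) *\<^sub>R b)"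
    using finite_dim_orthogonal_basis[OF assms] by blast
  let ?K = "{\<Sum>b\<in>C. a b *\<^sub>R b | a. \<forall>b\<in>C. \<bar>a b\<bar> \<le> r / norm b}"
  have "cball 0 r \<subseteq> ?K"
  proof
    fix w :: 'a assume "w \<in> cball 0 r"
    then have w: "norm w \<le> r" by simp
    have "\<bar>w \<bullet> b / (b \<bullet> b)\<bar> \<le> r / norm b" if "b \<in> C" for b
    proof -
      have "norm b > 0" using that C(2) by auto
      moreover have "\<bar>w \<bullet> b\<bar> \<le> r * norm b"
        using Cauchy_Schwarz_ineq2[of w b] w by (meson mult_right_mono norm_ge_zero order_trans)
      ultimately show ?thesis
        by (simp add: dot_square_norm power2_eq_square field_simps abs_mult)
    qed
    then show "w \<in> ?K" using C(3)[of w] by (intro CollectI exI[of _ "\<lambda>b. w \<bullet> b / (b \<bullet> b)"]) auto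
  qed
  moreover have "compact (cball 0 r \<inter> ?K)"
    by (intro closed_Int_compact closed_cball compact_coordinate_box C(1))
  ultimately have "compact (cball (0::'a) r)" by (simp add: inf.absorb1)
  then have "compact ((+) a ` cball 0 r)" by (rule compact_translation)
  then show ?thesis by (simp add: cball_translation)
qed

section \<open>Charts, smooth maps on the base and extension by zero\<close>

lemma atlas_cover: "smooth_atlas C \<Longrightarrow> \<Union>(fst ` C) = UNIV"
  unfolding smooth_atlas_def by (elim conjE)

lemma atlas_inj: "smooth_atlas C \<Longrightarrow> (U, \<phi>) \<in> C \<Longrightarrow> inj_on \<phi> U"
proof (rule inj_on_inverseI)
  fix x assume A: "smooth_atlas C" "(U, \<phi>) \<in> C" "x \<in> U"
  then have "homeomorphism U (\<phi> ` U) \<phi> (inv_into U \<phi>)" unfolding smooth_atlas_def by blast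
  then show "inv_into U \<phi> (\<phi> x) = x" using A(3) by (rule homeomorphism_apply1)
qed

lemma atlas_open_image:
  assumes "smooth_atlas C" "(U, \<phi>) \<in> C" "open W"
  shows "open (\<phi> ` (U \<inter> W))"
proof -
  have h: "homeomorphism U (\<phi> ` U) \<phi> (inv_into U \<phi>)" "open (\<phi> ` U)"
    using assms unfolding smooth_atlas_def by auto
  have "openin (top_of_set (\<phi> ` U)) (\<phi> ` (U \<inter> W))"
    by (rule homeomorphism_imp_open_map[OF h(1)]) (use assms in auto)
  then show ?thesis using h(2) openin_open_eq by blast
qed

lemma smooth_map_onI:
  "(\<And>U \<phi> k. (U, \<phi>) \<in> C \<Longrightarrow> Ck_on k (\<phi> ` (U \<inter> W)) (\<lambda>x. f (inv_into U \<phi> x))) \<Longrightarrow> smooth_map_on C W f"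
  unfolding smooth_map_on_def Cinf_on_def o_def by blast

lemma smooth_map_onD:
  "smooth_map_on C W f \<Longrightarrow> (U, \<phi>) \<in> C \<Longrightarrow> Ck_on k (\<phi> ` (U \<inter> W)) (\<lambda>x. f (inv_into U \<phi> x))"
  unfolding smooth_map_on_def Cinf_on_def o_def by blast

lemma smooth_map_on_local:
  assumes A: "smooth_atlas C"
    and loc: "\<And>x. x \<in> W \<Longrightarrow> \<exists>V g. open V \<and> x \<in> V \<and> smooth_map_on C V g \<and> (\<forall>y\<in>V. g y = f y)"
  shows "smooth_map_on C W f"
proof (rule smooth_map_onI)
  fix U \<phi> k assume U: "(U, \<phi>) \<in> C"
  show "Ck_on k (\<phi> ` (U \<inter> W)) (\<lambda>x. f (inv_into U \<phi> x))"
  proof (rule Ck_on_local)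
    fix z assume "z \<in> \<phi> ` (U \<inter> W)"
    then obtain x where x: "x \<in> U" "x \<in> W" "z = \<phi> x" by blast
    then obtain V g where V: "open V" "x \<in> V" "smooth_map_on C V g" "\<forall>y\<in>V. g y = f y"
      using loc by blast
    have o: "open (\<phi> ` (U \<inter> V))" using atlas_open_image[OF A U V(1)] .
    have "Ck_on k (\<phi> ` (U \<inter> V)) (\<lambda>x. g (inv_into U \<phi> x))"
      using V(3) U by (rule smooth_map_onD)
    then have "Ck_on k (\<phi> ` (U \<inter> V)) (\<lambda>x. f (inv_into U \<phi> x))"
      by (rule Ck_on_cong[OF o, rotated]) (use V(4) atlas_inj[OF A U] in \<open>clarsimp\<close>)
    then show "\<exists>V. open V \<and> z \<in> V \<and> Ck_on k V (\<lambda>x. f (inv_into U \<phi> x))"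
      using o x V(2) by blast
  qed
qed

lemma smooth_map_on_cong:
  assumes "smooth_atlas C" "open W" "smooth_map_on C W g" "\<And>y. y \<in> W \<Longrightarrow> g y = f y"
  shows "smooth_map_on C W f"
  by (rule smooth_map_on_local[OF assms(1)], rule exI[of _ W], rule exI[of _ g]) (simp add: assms)

lemma smooth_map_on_subset: "V \<subseteq> W \<Longrightarrow> smooth_map_on C W f \<Longrightarrow> smooth_map_on C V f"
  by (rule smooth_map_onI, erule Ck_on_subset[OF _ smooth_map_onD, rotated]) auto

lemma smooth_map_on_const: "smooth_map_on C W (\<lambda>x. c)"
  unfolding smooth_map_on_def Cinf_on_def o_def by (auto intro: Ck_on_const)

lemma smooth_map_on_add:
  "smooth_map_on C W f \<Longrightarrow> smooth_map_on C W g \<Longrightarrow> smooth_map_on C W (\<lambda>x. f x + g x)"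
  by (intro smooth_map_onI Ck_on_add) (auto dest: smooth_map_onD)

lemma smooth_map_on_bilinear:
  "bounded_bilinear h \<Longrightarrow> smooth_map_on C W f \<Longrightarrow> smooth_map_on C W g
    \<Longrightarrow> smooth_map_on C W (\<lambda>x. h (f x) (g x))"
  by (rule smooth_map_onI, erule bounded_bilinear.Ck_on_prod) (erule smooth_map_onD, assumption)+

lemmas smooth_map_on_scaleR = smooth_map_on_bilinear[OF bounded_bilinear_scaleR]
lemmas smooth_map_on_mult = smooth_map_on_bilinear[OF bounded_bilinear_mult]
lemmas smooth_map_on_inner = smooth_map_on_bilinear[OF bounded_bilinear_inner]

lemma smooth_map_on_flat:
  "smooth_map_on C W f \<Longrightarrow> smooth_map_on C W (\<lambda>x. flat m (f x))"
  by (rule smooth_map_onI, rule Ck_on_flat, erule smooth_map_onD)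

lemma smooth_map_on_inverse:
  fixes f :: "_ \<Rightarrow> real"
  assumes "smooth_atlas C" "smooth_map_on C W f" "\<And>x. x \<in> W \<Longrightarrow> f x \<noteq> 0"
  shows "smooth_map_on C W (\<lambda>x. inverse (f x))"
proof (rule smooth_map_onI, rule Ck_on_inverse)
  fix U \<phi> k assume U: "(U, \<phi>) \<in> C"
  show "Ck_on k (\<phi> ` (U \<inter> W)) (\<lambda>x. f (inv_into U \<phi> x))"
    using assms(2) U by (rule smooth_map_onD)
  show "f (inv_into U \<phi> z) \<noteq> 0" if "z \<in> \<phi> ` (U \<inter> W)" for z
    using that assms(3) atlas_inj[OF assms(1) U] by auto
qed

text \<open>In a chart the function depends on the squared distance from the centre. The set
  \<open>K\<close> is the preimage of a closed ball, hence compact, hence closed because the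
  manifold is Hausdorff; this is recorded since extending by zero needs an open complement.\<close>

lemma bump_exists:
  fixes C :: "('m::{t2_space,second_countable_topology} set \<times> ('m \<Rightarrow> 'e::real_inner)) set"
  assumes A: "smooth_atlas C" and W: "open W" "x \<in> W"
  obtains \<beta> :: "'m \<Rightarrow> real" and K where "smooth_map_on C UNIV \<beta>" "\<beta> x \<noteq> 0" "closed K" "K \<subseteq> W"
    "\<And>y. y \<notin> K \<Longrightarrow> \<beta> y = 0"
proof -
  have "x \<in> \<Union>(fst ` C)" using atlas_cover[OF A] by blast
  then obtain U \<phi> where U: "(U, \<phi>) \<in> C" "x \<in> U" by auto
  have oU: "open U" and h: "homeomorphism U (\<phi> ` U) \<phi> (inv_into U \<phi>)"
    using A U unfolding smooth_atlas_def by auto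
  have "open (\<phi> ` (U \<inter> W))" by (rule atlas_open_image[OF A U(1) W(1)])
  then obtain r where r: "r > 0" "cball (\<phi> x) r \<subseteq> \<phi> ` (U \<inter> W)"
    using U W by (meson IntI image_eqI open_contains_cball_eq)
  define K where "K = inv_into U \<phi> ` cball (\<phi> x) r"
  define \<beta> where "\<beta> y = (if y \<in> U then flat 0 (r * r - (\<phi> y - \<phi> x) \<bullet> (\<phi> y - \<phi> x)) else 0)" for y
  have fd: "finite_dim TYPE('e)" using A unfolding smooth_atlas_def by blast
  have "continuous_on (cball (\<phi> x) r) (inv_into U \<phi>)"
    by (rule continuous_on_subset[OF homeomorphism_cont2[OF h]]) (use r(2) in auto)
  then have "compact K" unfolding K_def by (rule compact_continuous_image[OF _ compact_cball_finite_dim[OF fd]])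
  then have cK: "closed K" by (rule compact_imp_closed)
  have KW: "K \<subseteq> U \<inter> W" unfolding K_def using r(2) atlas_inj[OF A U(1)] by auto
  have zero: "\<beta> y = 0" if "y \<notin> K" for y
  proof (cases "y \<in> U")
    case True
    have "\<phi> y \<notin> cball (\<phi> x) r"
      using that True atlas_inj[OF A U(1)] unfolding K_def by (metis image_eqI inv_into_f_f)
    then have "norm (\<phi> y - \<phi> x) > r" by (simp add: dist_norm norm_minus_commute)
    then have "norm (\<phi> y - \<phi> x) * norm (\<phi> y - \<phi> x) > r * r" using r(1) by (intro mult_strict_mono) auto
    then show ?thesis by (simp add: \<beta>_def flat_def dot_square_norm power2_eq_square)
  qed (simp add: \<beta>_def)
  \<comment> \<open>Compatibility of charts says that a chart is itself a smooth map on its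
    domain.\<close>
  have "\<forall>(V, \<psi>)\<in>C. \<forall>(U, \<phi>)\<in>C. Cinf_on (\<psi> ` (V \<inter> U)) (\<phi> \<circ> inv_into V \<psi>)"
    using A unfolding smooth_atlas_def by (elim conjE)
  then have phi: "smooth_map_on C U \<phi>" using U(1) unfolding smooth_map_on_def by blast
  have diff: "smooth_map_on C U (\<lambda>y. \<phi> y + (- \<phi> x))"
    by (intro smooth_map_on_add phi smooth_map_on_const)
  have "smooth_map_on C U (\<lambda>y. flat 0 (r * r + (- 1) * ((\<phi> y + (- \<phi> x)) \<bullet> (\<phi> y + (- \<phi> x)))))"
    by (intro smooth_map_on_flat smooth_map_on_add smooth_map_on_mult smooth_map_on_inner diff smooth_map_on_const)
  then have sU: "smooth_map_on C U \<beta>"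
    by (rule smooth_map_on_cong[OF A oU]) (simp add: \<beta>_def)
  have "smooth_map_on C UNIV \<beta>"
  proof (rule smooth_map_on_local[OF A])
    fix y
    show "\<exists>V g. open V \<and> y \<in> V \<and> smooth_map_on C V g \<and> (\<forall>z\<in>V. g z = \<beta> z)"
    proof (cases "y \<in> U")
      case True then show ?thesis using oU sU by blast
    next
      case False
      then have "y \<in> - K" using KW by blast
      then show ?thesis using cK zero
        by (intro exI[of _ "- K"] exI[of _ "\<lambda>z. 0"]) (auto intro: smooth_map_on_const)
    qed
  qed
  moreover have "\<beta> x \<noteq> 0" using U r(1) by (simp add: \<beta>_def flat_def)
  ultimately show ?thesis using that cK KW zero by blast
qed

text \<open>\<open>V\<close> is covered by the open sets \<open>V \<inter> W\<close>, where
  \<open>f\<close> is smooth by hypothesis, and \<open>V - K\<close>, where it is 0.\<close>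

lemma smooth_extend_by_zero:
  assumes A: "smooth_atlas C" and W: "open W" "closed K" "K \<subseteq> W" "open V"
    and f: "smooth_map_on C (V \<inter> W) f" and z: "\<And>y. y \<in> V \<Longrightarrow> y \<notin> K \<Longrightarrow> f y = 0"
  shows "smooth_map_on C V f"
proof (rule smooth_map_on_local[OF A])
  fix y assume y: "y \<in> V"
  show "\<exists>V g. open V \<and> y \<in> V \<and> smooth_map_on C V g \<and> (\<forall>z\<in>V. g z = f z)"
  proof (cases "y \<in> W")
    case True then show ?thesis using W f y by (intro exI[of _ "V \<inter> W"] exI[of _ f]) auto
  next
    case False
    then have "y \<in> V - K" using W y by blast
    then show ?thesis using W z
      by (intro exI[of _ "V - K"] exI[of _ "\<lambda>z. 0"]) (auto intro: smooth_map_on_const)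
  qed
qed

declare One_nat_def [simp del]

section \<open>Sections and covectors\<close>

text \<open>Used to see that the set where a cut-off function does not vanish, and where one can
  divide by it, is open.\<close>

lemma smooth_imp_continuous:
  assumes A: "smooth_atlas C" and f: "smooth_map_on C UNIV f"
  shows "continuous_on UNIV f"
proof (rule continuous_at_imp_continuous_on, rule ballI)
  fix x
  have "x \<in> \<Union>(fst ` C)" using atlas_cover[OF A] by blast
  then obtain U \<phi> where U: "(U, \<phi>) \<in> C" "x \<in> U" by auto
  have oU: "open U" and h: "homeomorphism U (\<phi> ` U) \<phi> (inv_into U \<phi>)"
    using A U unfolding smooth_atlas_def by auto
  have "continuous_on (\<phi> ` U) (\<lambda>z. f (inv_into U \<phi> z))"
    using smooth_map_onD[OF f U(1), of 0] by simp
  then have "continuous_on U (\<lambda>y. f (inv_into U \<phi> (\<phi> y)))"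
    by (rule continuous_on_compose2[OF _ homeomorphism_cont1[OF h]]) simp
  then have "continuous_on U f"
    by (rule continuous_on_eq) (use atlas_inj[OF A U(1)] in simp)
  then show "isCont f x" using oU U(2) continuous_on_eq_continuous_at by blast
qed

lemma args_1: "args E 1 = (\<lambda>X. [X]) ` Sec E"
  unfolding args_def by (auto simp: One_nat_def length_Suc_conv)

locale smooth_vector_bundle =
  fixes E :: "('m::{t2_space,second_countable_topology}, 'e::real_inner, 'v::real_vector, 'f::real_inner) vbundle"
  assumes vb: "vector_bundle E"
begin

section \<open>Fibres and local trivializations\<close>

lemma atlas: "smooth_atlas (charts E)"
  using vb unfolding vector_bundle_def by (elim conjE)

lemma fibre_subspace: "subspace (fibre E x)"
  using vb unfolding vector_bundle_def by (elim conjE) (erule spec)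

lemma triv_cover: obtains U \<Phi> where "(U, \<Phi>) \<in> trivs E" "x \<in> U"
proof -
  have "\<Union>(fst ` trivs E) = UNIV" using vb unfolding vector_bundle_def by (elim conjE)
  then have "x \<in> \<Union>(fst ` trivs E)" by blast
  then show ?thesis using that by auto
qed

lemma
  assumes "(U, \<Phi>) \<in> trivs E"
  shows triv_open: "open U"
    and triv_bij: "x \<in> U \<Longrightarrow> bij_betw (\<Phi> x) (fibre E x) UNIV"
    and triv_add: "x \<in> U \<Longrightarrow> u \<in> fibre E x \<Longrightarrow> u' \<in> fibre E x \<Longrightarrow> \<Phi> x (u + u') = \<Phi> x u + \<Phi> x u'"
    and triv_scale: "x \<in> U \<Longrightarrow> u \<in> fibre E x \<Longrightarrow> \<Phi> x (r *\<^sub>R u) = r *\<^sub>R \<Phi> x u"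
    and triv_transition: "(V, \<Psi>) \<in> trivs E \<Longrightarrow>
      smooth_map_on (charts E) (U \<inter> V) (\<lambda>x. \<Psi> x (inv_into (fibre E x) (\<Phi> x) w))"
proof -
  have *: "\<forall>(U, \<Phi>)\<in>trivs E. open U \<and>
        (\<forall>x\<in>U. bij_betw (\<Phi> x) (fibre E x) UNIV \<and>
           (\<forall>u\<in>fibre E x. \<forall>w\<in>fibre E x. \<Phi> x (u + w) = \<Phi> x u + \<Phi> x w) \<and>
           (\<forall>r. \<forall>u\<in>fibre E x. \<Phi> x (r *\<^sub>R u) = r *\<^sub>R \<Phi> x u))"
    and **: "\<forall>(U, \<Phi>)\<in>trivs E. \<forall>(V, \<Psi>)\<in>trivs E. \<forall>w.
        smooth_map_on (charts E) (U \<inter> V) (\<lambda>x. \<Psi> x (inv_into (fibre E x) (\<Phi> x) w))"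
    using vb unfolding vector_bundle_def by - (elim conjE, assumption)+
  from bspec[OF * assms] show "open U"
    "x \<in> U \<Longrightarrow> bij_betw (\<Phi> x) (fibre E x) UNIV"
    "x \<in> U \<Longrightarrow> u \<in> fibre E x \<Longrightarrow> u' \<in> fibre E x \<Longrightarrow> \<Phi> x (u + u') = \<Phi> x u + \<Phi> x u'"
    "x \<in> U \<Longrightarrow> u \<in> fibre E x \<Longrightarrow> \<Phi> x (r *\<^sub>R u) = r *\<^sub>R \<Phi> x u" by auto
  show "smooth_map_on (charts E) (U \<inter> V) (\<lambda>x. \<Psi> x (inv_into (fibre E x) (\<Phi> x) w))"
    if "(V, \<Psi>) \<in> trivs E" using bspec[OF ** assms] that by auto
qed

lemma triv_inv:
  assumes "(U, \<Phi>) \<in> trivs E" "x \<in> U"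
  shows "inv_into (fibre E x) (\<Phi> x) w \<in> fibre E x" "\<Phi> x (inv_into (fibre E x) (\<Phi> x) w) = w"
  using triv_bij[OF assms] unfolding bij_betw_def by (auto intro: inv_into_into f_inv_into_f)

lemma triv_sum:
  assumes U: "(U, \<Phi>) \<in> trivs E" "x \<in> U" and I: "finite I" "\<And>i. i \<in> I \<Longrightarrow> u i \<in> fibre E x"
  shows "\<Phi> x (\<Sum>i\<in>I. r i *\<^sub>R u i) = (\<Sum>i\<in>I. r i *\<^sub>R \<Phi> x (u i))"
  using I
proof (induction I)
  case empty
  show ?case using triv_scale[OF U subspace_0[OF fibre_subspace], of 0] by simp
next
  case (insert i I)
  have "(\<Sum>i\<in>I. r i *\<^sub>R u i) \<in> fibre E x" "r i *\<^sub>R u i \<in> fibre E x"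
    using insert fibre_subspace by (auto intro!: subspace_sum subspace_scale)
  then show ?case using insert triv_add[OF U] triv_scale[OF U] by simp
qed

lemma triv_eqI:
  assumes "(U, \<Phi>) \<in> trivs E" "x \<in> U" "u \<in> fibre E x" "w \<in> fibre E x" "\<Phi> x u = \<Phi> x w"
  shows "u = w"
  using triv_bij[OF assms(1,2)] assms(3-) unfolding bij_betw_def inj_on_def by blast

section \<open>The algebra of smooth functions and its module of sections\<close>

lemma Cinf_const: "(\<lambda>x. c) \<in> Cinf E"
  unfolding Cinf_def using smooth_map_on_const by blast

lemma Cinf_add: "f \<in> Cinf E \<Longrightarrow> g \<in> Cinf E \<Longrightarrow> (\<lambda>x. f x + g x) \<in> Cinf E"
  unfolding Cinf_def using smooth_map_on_add by blast

lemma Cinf_mult: "f \<in> Cinf E \<Longrightarrow> g \<in> Cinf E \<Longrightarrow> (\<lambda>x. f x * g x) \<in> Cinf E"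
  unfolding Cinf_def using smooth_map_on_mult by blast

lemma Cinf_uminus: "f \<in> Cinf E \<Longrightarrow> (\<lambda>x. - f x) \<in> Cinf E"
  using Cinf_mult[OF Cinf_const[of "-1"]] by simp

lemma Cinf_diff: "f \<in> Cinf E \<Longrightarrow> g \<in> Cinf E \<Longrightarrow> (\<lambda>x. f x - g x) \<in> Cinf E"
  using Cinf_add[OF _ Cinf_uminus] by force

lemma Cinf_sum: "(\<And>i. i \<in> I \<Longrightarrow> f i \<in> Cinf E) \<Longrightarrow> (\<lambda>x. \<Sum>i\<in>I. f i x) \<in> Cinf E"
  by (induction I rule: infinite_finite_induct) (auto intro: Cinf_const Cinf_add)

lemma SecI:
  assumes "\<And>x. X x \<in> fibre E x"
    and "\<And>U \<Phi>. (U, \<Phi>) \<in> trivs E \<Longrightarrow> smooth_map_on (charts E) U (\<lambda>x. \<Phi> x (X x))"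
  shows "X \<in> Sec E"
  using assms unfolding Sec_def by blast

lemma Sec_fibre: "X \<in> Sec E \<Longrightarrow> X x \<in> fibre E x"
  unfolding Sec_def by blast

lemma Sec_smooth: "X \<in> Sec E \<Longrightarrow> (U, \<Phi>) \<in> trivs E \<Longrightarrow> smooth_map_on (charts E) U (\<lambda>x. \<Phi> x (X x))"
  unfolding Sec_def by blast

lemma Sec_add: "X \<in> Sec E \<Longrightarrow> Y \<in> Sec E \<Longrightarrow> (\<lambda>x. X x + Y x) \<in> Sec E"
proof (rule SecI)
  assume XY: "X \<in> Sec E" "Y \<in> Sec E"
  show "X x + Y x \<in> fibre E x" for x
    using XY by (intro subspace_add[OF fibre_subspace] Sec_fibre)
  fix U \<Phi> assume U: "(U, \<Phi>) \<in> trivs E"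
  have "smooth_map_on (charts E) U (\<lambda>x. \<Phi> x (X x) + \<Phi> x (Y x))"
    using XY U by (intro smooth_map_on_add Sec_smooth)
  then show "smooth_map_on (charts E) U (\<lambda>x. \<Phi> x (X x + Y x))"
    by (rule smooth_map_on_cong[OF atlas triv_open[OF U]]) (use XY in \<open>simp add: triv_add[OF U] Sec_fibre\<close>)
qed

lemma Sec_fmult: "f \<in> Cinf E \<Longrightarrow> X \<in> Sec E \<Longrightarrow> fmult f X \<in> Sec E"
  unfolding fmult_def
proof (rule SecI)
  assume XY: "f \<in> Cinf E" "X \<in> Sec E"
  show "f x *\<^sub>R X x \<in> fibre E x" for x
    using XY by (intro subspace_scale[OF fibre_subspace] Sec_fibre)
  fix U \<Phi> assume U: "(U, \<Phi>) \<in> trivs E"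
  have "smooth_map_on (charts E) U (\<lambda>x. f x *\<^sub>R \<Phi> x (X x))"
    using XY U smooth_map_on_subset[of U UNIV] unfolding Cinf_def
    by (intro smooth_map_on_scaleR Sec_smooth) auto
  then show "smooth_map_on (charts E) U (\<lambda>x. \<Phi> x (f x *\<^sub>R X x))"
    by (rule smooth_map_on_cong[OF atlas triv_open[OF U]]) (use XY in \<open>simp add: triv_scale[OF U] Sec_fibre\<close>)
qed

lemma Sec_scale: "X \<in> Sec E \<Longrightarrow> (\<lambda>x. r *\<^sub>R X x) \<in> Sec E"
  using Sec_fmult[OF Cinf_const[of r]] unfolding fmult_def .

lemma Sec_zero: "(\<lambda>x. 0) \<in> Sec E"
proof (rule SecI)
  show "0 \<in> fibre E x" for x by (rule subspace_0[OF fibre_subspace])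
  fix U \<Phi> assume U: "(U, \<Phi>) \<in> trivs E"
  have "\<Phi> x 0 = 0" if "x \<in> U" for x using triv_sum[OF U that, of "{}"] by simp
  then show "smooth_map_on (charts E) U (\<lambda>x. \<Phi> x 0)"
    by (intro smooth_map_on_cong[OF atlas triv_open[OF U] smooth_map_on_const[of _ _ 0]]) simp
qed

lemma Sec_diff: "X \<in> Sec E \<Longrightarrow> Y \<in> Sec E \<Longrightarrow> (\<lambda>x. X x - Y x) \<in> Sec E"
  using Sec_add[OF _ Sec_scale[of Y "-1"], of X] by simp

lemma Sec_sum: "(\<And>i. i \<in> I \<Longrightarrow> X i \<in> Sec E) \<Longrightarrow> (\<lambda>x. \<Sum>i\<in>I. X i x) \<in> Sec E"
  by (induction I rule: infinite_finite_induct) (auto intro: Sec_zero Sec_add)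

text \<open>In degree 1 both order conditions say that the commutator with a function vanishes.
  Covectors are therefore the function-linear functionals on sections; real homogeneity is the case
  of constant functions.\<close>

lemma reduced_ops_1_iff:
  "l \<in> reduced_ops E 1 \<longleftrightarrow>
     (\<forall>Xs. Xs \<notin> args E 1 \<longrightarrow> l Xs = (\<lambda>x. 0)) \<and> (\<forall>X\<in>Sec E. l [X] \<in> Cinf E) \<and>
     (\<forall>X\<in>Sec E. \<forall>Y\<in>Sec E. l [\<lambda>x. X x + Y x] = (\<lambda>x. l [X] x + l [Y] x)) \<and>
     (\<forall>f\<in>Cinf E. \<forall>X\<in>Sec E. l [fmult f X] = (\<lambda>x. f x * l [X] x))" (is "?L \<longleftrightarrow> ?R")
proof
  assume L: ?L
  then have d: "l \<in> diff_ops E 1" and o: "order_le E 1 0 0 l"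
    by (simp_all add: reduced_ops_def)
  have "l [fmult f X] = (\<lambda>x. f x * l [X] x)" if "f \<in> Cinf E" "X \<in> Sec E" for f X
  proof -
    have "foldr (\<delta> 0) [f] l [X] = (\<lambda>x. 0)"
      using o[unfolded order_le_def, rule_format, of "[f]" "[X]"] that by (simp add: args_1)
    then show ?thesis by (simp add: \<delta>_def fun_eq_iff)
  qed
  moreover have "l [\<lambda>x. X x + Y x] = (\<lambda>x. l [X] x + l [Y] x)" if XY: "X \<in> Sec E" "Y \<in> Sec E" for X Y
  proof -
    have "multilinear E 1 l" using d unfolding diff_ops_def multidifferential_def by blast
    then have "l ([X][0 := (\<lambda>x. X x + Y x)]) = (\<lambda>x. l ([X][0 := X]) x + l ([X][0 := Y]) x)"
      using XY by (auto simp: multilinear_def args_1)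
    then show ?thesis by simp
  qed
  ultimately show ?R using d unfolding diff_ops_def multidifferential_def args_1 by auto
next
  assume R: ?R
  have sc: "l [\<lambda>x. r *\<^sub>R X x] = (\<lambda>x. r * l [X] x)" if "X \<in> Sec E" for r X
    using R Cinf_const[of r] that unfolding fmult_def by fast
  have ml: "multilinear E 1 l"
    unfolding multilinear_def args_1 using R sc by auto
  have o: "order_le E 1 0 0 l"
    unfolding order_le_def args_1 using R by (auto simp: One_nat_def length_Suc_conv \<delta>_def)
  have t: "total_order_le E 1 0 l"
    unfolding total_order_le_def args_1 using R by (auto simp: One_nat_def length_Suc_conv \<delta>_def)
  show ?L using R ml o t unfolding reduced_ops_def diff_ops_def multidifferential_def args_1 by auto
qed

lemma
  assumes "l \<in> reduced_ops E 1"
  shows dual_Cinf: "X \<in> Sec E \<Longrightarrow> l [X] \<in> Cinf E"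
    and dual_add: "X \<in> Sec E \<Longrightarrow> Y \<in> Sec E \<Longrightarrow> l [\<lambda>x. X x + Y x] = (\<lambda>x. l [X] x + l [Y] x)"
    and dual_fmult: "f \<in> Cinf E \<Longrightarrow> X \<in> Sec E \<Longrightarrow> l [fmult f X] = (\<lambda>x. f x * l [X] x)"
    and dual_outside: "Xs \<notin> args E 1 \<Longrightarrow> l Xs = (\<lambda>x. 0)"
  using assms unfolding reduced_ops_1_iff by blast+

lemma dual_scale:
  "l \<in> reduced_ops E 1 \<Longrightarrow> X \<in> Sec E \<Longrightarrow> l [\<lambda>x. r *\<^sub>R X x] = (\<lambda>x. r * l [X] x)"
  using dual_fmult[OF _ Cinf_const[of r]] unfolding fmult_def by blast

lemma dual_zero: "l \<in> reduced_ops E 1 \<Longrightarrow> l [\<lambda>x. 0] = (\<lambda>x. 0)"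
  using dual_scale[OF _ Sec_zero, of l 0] by simp

lemma dual_diff:
  assumes "l \<in> reduced_ops E 1" "X \<in> Sec E" "Y \<in> Sec E"
  shows "l [\<lambda>x. X x - Y x] = (\<lambda>x. l [X] x - l [Y] x)"
  using dual_add[OF assms(1,2) Sec_scale[OF assms(3)], of "-1"] dual_scale[OF assms(1,3), of "-1"] by simp

lemma dual_sum:
  assumes l: "l \<in> reduced_ops E 1" and I: "finite I" "\<And>i. i \<in> I \<Longrightarrow> X i \<in> Sec E"
  shows "l [\<lambda>x. \<Sum>i\<in>I. X i x] = (\<lambda>x. \<Sum>i\<in>I. l [X i] x)"
  using I by (induction I) (simp_all add: dual_zero[OF l] dual_add[OF l] Sec_sum)

lemma dual_comb:
  assumes "finite I" "\<And>i. i \<in> I \<Longrightarrow> l i \<in> reduced_ops E 1" "\<And>i. i \<in> I \<Longrightarrow> f i \<in> Cinf E"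
  shows "(\<lambda>Xs x. \<Sum>i\<in>I. f i x * l i Xs x) \<in> reduced_ops E 1"
  unfolding reduced_ops_1_iff
proof (intro conjI ballI allI impI)
  show "(\<lambda>x. \<Sum>i\<in>I. f i x * l i Xs x) = (\<lambda>x. 0)" if "Xs \<notin> args E 1" for Xs
    using assms(2) that by (simp add: dual_outside)
  show "(\<lambda>x. \<Sum>i\<in>I. f i x * l i [X] x) \<in> Cinf E" if "X \<in> Sec E" for X
    using assms that by (intro Cinf_sum Cinf_mult) (auto intro: dual_Cinf)
  show "(\<lambda>x. \<Sum>i\<in>I. f i x * l i [\<lambda>x. X x + Y x] x) =
      (\<lambda>x. (\<Sum>i\<in>I. f i x * l i [X] x) + (\<Sum>i\<in>I. f i x * l i [Y] x))"
    if "X \<in> Sec E" "Y \<in> Sec E" for X Y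
    using assms(2) that by (simp add: dual_add distrib_left sum.distrib)
  show "(\<lambda>x. \<Sum>i\<in>I. f i x * l i [fmult g X] x) = (\<lambda>x. g x * (\<Sum>i\<in>I. f i x * l i [X] x))"
    if "g \<in> Cinf E" "X \<in> Sec E" for g X
    using assms(2) that by (simp add: dual_fmult sum_distrib_left mult.left_commute)
qed

text \<open>The square of \<open>\<beta>\<close> appears because both the sections \<open>e b\<close> and the covectors \<open>l b\<close> are
  local ones multiplied by \<open>\<beta>\<close>.\<close>

definition dual_frame_at :: "'m \<Rightarrow> ('m \<Rightarrow> real) \<Rightarrow> 'f set \<Rightarrow> ('f \<Rightarrow> ('m, 'v) cochain) \<Rightarrow> ('f \<Rightarrow> 'm \<Rightarrow> 'v) \<Rightarrow> bool"
  where "dual_frame_at x \<beta> I l e \<longleftrightarrow>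
    \<beta> \<in> Cinf E \<and> \<beta> x \<noteq> 0 \<and> finite I \<and> l ` I \<subseteq> reduced_ops E 1 \<and> e ` I \<subseteq> Sec E \<and>
    (\<forall>X\<in>Sec E. \<forall>y. (\<beta> y * \<beta> y) *\<^sub>R X y = (\<Sum>b\<in>I. l b [X] y *\<^sub>R e b y)) \<and>
    (\<forall>b\<in>I. \<forall>y. \<beta> y = 0 \<longrightarrow> e b y = 0) \<and>
    (\<forall>b\<in>I. \<forall>X\<in>Sec E. \<forall>y. X y = 0 \<longrightarrow> l b [X] y = 0) \<and>
    ((\<exists>w::'f. w \<noteq> 0) \<longrightarrow> (\<exists>b\<in>I. e b x \<noteq> 0))"

lemma
  assumes "dual_frame_at x \<beta> I l e"
  shows frame_bump: "\<beta> \<in> Cinf E" "\<beta> x \<noteq> 0"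
    and frame_finite: "finite I"
    and frame_dual: "b \<in> I \<Longrightarrow> l b \<in> reduced_ops E 1"
    and frame_Sec: "b \<in> I \<Longrightarrow> e b \<in> Sec E"
    and frame_expansion: "X \<in> Sec E \<Longrightarrow> (\<beta> y * \<beta> y) *\<^sub>R X y = (\<Sum>b\<in>I. l b [X] y *\<^sub>R e b y)"
    and frame_Sec_zero: "b \<in> I \<Longrightarrow> \<beta> y = 0 \<Longrightarrow> e b y = 0"
    and frame_dual_zero: "b \<in> I \<Longrightarrow> X \<in> Sec E \<Longrightarrow> X y = 0 \<Longrightarrow> l b [X] y = 0"
    and frame_nonzero: "\<exists>w::'f. w \<noteq> 0 \<Longrightarrow> \<exists>b\<in>I. e b x \<noteq> 0"
proof -
  show "\<beta> \<in> Cinf E" "\<beta> x \<noteq> 0" "finite I"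
    using assms unfolding dual_frame_at_def by - (elim conjE, assumption)+
  have *: "l ` I \<subseteq> reduced_ops E 1" "e ` I \<subseteq> Sec E"
    "\<forall>X\<in>Sec E. \<forall>y. (\<beta> y * \<beta> y) *\<^sub>R X y = (\<Sum>b\<in>I. l b [X] y *\<^sub>R e b y)"
    "\<forall>b\<in>I. \<forall>y. \<beta> y = 0 \<longrightarrow> e b y = 0"
    "\<forall>b\<in>I. \<forall>X\<in>Sec E. \<forall>y. X y = 0 \<longrightarrow> l b [X] y = 0"
    "(\<exists>w::'f. w \<noteq> 0) \<longrightarrow> (\<exists>b\<in>I. e b x \<noteq> 0)"
    using assms unfolding dual_frame_at_def by - (elim conjE, assumption)+
  show "b \<in> I \<Longrightarrow> l b \<in> reduced_ops E 1" using *(1) by blast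
  show "b \<in> I \<Longrightarrow> e b \<in> Sec E" using *(2) by blast
  show "X \<in> Sec E \<Longrightarrow> (\<beta> y * \<beta> y) *\<^sub>R X y = (\<Sum>b\<in>I. l b [X] y *\<^sub>R e b y)" using *(3) by blast
  show "b \<in> I \<Longrightarrow> \<beta> y = 0 \<Longrightarrow> e b y = 0" using *(4) by blast
  show "b \<in> I \<Longrightarrow> X \<in> Sec E \<Longrightarrow> X y = 0 \<Longrightarrow> l b [X] y = 0" using *(5) by blast
  show "\<exists>w::'f. w \<noteq> 0 \<Longrightarrow> \<exists>b\<in>I. e b x \<noteq> 0" using *(6) by blast
qed

text \<open>The constant frame of a trivialization and its coordinate functionals, built from an
  orthogonal basis of the typical fibre, become global after multiplication by a bump function
  supported inside the trivializing set.\<close>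

lemma dual_frame: "\<exists>\<beta> I l e. dual_frame_at x \<beta> I l e"
proof -
  obtain V \<Phi> where V: "(V, \<Phi>) \<in> trivs E" "x \<in> V" by (rule triv_cover)
  note oV = triv_open[OF V(1)]
  obtain \<beta> :: "'m \<Rightarrow> real" and K where \<beta>: "smooth_map_on (charts E) UNIV \<beta>" "\<beta> x \<noteq> 0" "closed K" "K \<subseteq> V"
    "\<And>y. y \<notin> K \<Longrightarrow> \<beta> y = 0"
    by (rule bump_exists[OF atlas oV V(2)]) blast
  have "finite_dim TYPE('f)" using vb unfolding vector_bundle_def by (elim conjE)
  then obtain I :: "'f set" where I: "finite I" "0 \<notin> I"
    "\<And>w. w = (\<Sum>b\<in>I. (w \<bullet> b / (b \<bullet> b)) *\<^sub>R b)"
    by (rule finite_dim_orthogonal_basis) blast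
  have \<beta>s: "smooth_map_on (charts E) W \<beta>" for W
    using smooth_map_on_subset[OF _ \<beta>(1)] by blast
  let ?inv = "\<lambda>y. inv_into (fibre E y) (\<Phi> y)"
  define e where "e b = (\<lambda>y. if y \<in> V then \<beta> y *\<^sub>R ?inv y b else 0)" for b
  \<comment> \<open>Pairing with b divided by its squared norm extracts the coefficient of b in the
    orthogonal expansion.\<close>
  define l where "l b = (\<lambda>Xs y. if Xs \<in> args E 1 \<and> y \<in> V
      then \<beta> y * (\<Phi> y ((Xs ! 0) y) \<bullet> (b /\<^sub>R (b \<bullet> b))) else 0)" for b
  have l1: "l b [X] y = (if y \<in> V then \<beta> y * (\<Phi> y (X y) \<bullet> (b /\<^sub>R (b \<bullet> b))) else 0)"
    if "X \<in> Sec E" for b X y using that by (simp add: l_def args_1)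
  have e: "e b \<in> Sec E" for b
  proof (rule SecI)
    show "e b y \<in> fibre E y" for y
      unfolding e_def using triv_inv[OF V(1)] by (auto intro: subspace_scale[OF fibre_subspace] subspace_0[OF fibre_subspace])
    fix U \<Psi> assume U: "(U, \<Psi>) \<in> trivs E"
    have z: "\<Psi> y 0 = 0" if "y \<in> U" for y using triv_sum[OF U that, of "{}"] by simp
    show "smooth_map_on (charts E) U (\<lambda>y. \<Psi> y (e b y))"
    proof (rule smooth_extend_by_zero[OF atlas oV \<beta>(3,4) triv_open[OF U]])
      have "smooth_map_on (charts E) (U \<inter> V) (\<lambda>y. \<beta> y *\<^sub>R \<Psi> y (?inv y b))"
        using triv_transition[OF V(1) U, of b] by (intro smooth_map_on_scaleR \<beta>s) (simp add: Int_commute)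
      then show "smooth_map_on (charts E) (U \<inter> V) (\<lambda>y. \<Psi> y (e b y))"
        by (rule smooth_map_on_cong[OF atlas open_Int[OF triv_open[OF U] oV]])
          (simp add: e_def triv_scale[OF U] triv_inv[OF V(1)])
    qed (simp add: e_def \<beta>(5) z)
  qed
  have l: "l b \<in> reduced_ops E 1" for b
    unfolding reduced_ops_1_iff
  proof (intro conjI ballI allI impI)
    show "l b [X] \<in> Cinf E" if X: "X \<in> Sec E" for X
      unfolding Cinf_def
    proof (rule CollectI, rule smooth_extend_by_zero[OF atlas oV \<beta>(3,4) open_UNIV])
      have "smooth_map_on (charts E) V (\<lambda>y. \<beta> y * (\<Phi> y (X y) \<bullet> (b /\<^sub>R (b \<bullet> b))))"
        by (intro smooth_map_on_mult smooth_map_on_inner \<beta>s smooth_map_on_const Sec_smooth[OF X V(1)])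
      then have "smooth_map_on (charts E) V (l b [X])"
        by (rule smooth_map_on_cong[OF atlas oV]) (simp add: l1[OF X])
      then show "smooth_map_on (charts E) (UNIV \<inter> V) (l b [X])" by simp
    qed (simp add: l1[OF X] \<beta>(5))
    show "l b [\<lambda>x. X x + Y x] = (\<lambda>x. l b [X] x + l b [Y] x)" if "X \<in> Sec E" "Y \<in> Sec E" for X Y
      using that by (auto simp: l1 Sec_add triv_add[OF V(1)] Sec_fibre inner_add_left algebra_simps)
    show "l b [fmult f X] = (\<lambda>x. f x * l b [X] x)" if "f \<in> Cinf E" "X \<in> Sec E" for f X
      using that l1[OF Sec_fmult[OF that]] l1[OF that(2)]
      by (intro ext) (auto simp: fmult_def triv_scale[OF V(1)] Sec_fibre)
  qed (simp add: l_def)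
  have fr: "(\<beta> y * \<beta> y) *\<^sub>R X y = (\<Sum>b\<in>I. l b [X] y *\<^sub>R e b y)" if X: "X \<in> Sec E" for X y
  proof (cases "y \<in> V")
    case True
    let ?c = "\<lambda>b. \<Phi> y (X y) \<bullet> b / (b \<bullet> b)"
    have "\<Phi> y (\<Sum>b\<in>I. ?c b *\<^sub>R ?inv y b) = (\<Sum>b\<in>I. ?c b *\<^sub>R b)"
      using triv_sum[OF V(1) True I(1), of "?inv y" ?c] triv_inv[OF V(1) True] by simp
    also have "\<dots> = \<Phi> y (X y)" using I(3)[of "\<Phi> y (X y)"] by (rule sym)
    finally have "(\<Sum>b\<in>I. ?c b *\<^sub>R ?inv y b) = X y"
      by (intro triv_eqI[OF V(1) True])
        (auto intro!: subspace_sum[OF fibre_subspace] subspace_scale[OF fibre_subspace] triv_inv[OF V(1) True] Sec_fibre[OF X])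
    then have "(\<beta> y * \<beta> y) *\<^sub>R X y = (\<Sum>b\<in>I. (\<beta> y * \<beta> y) *\<^sub>R (?c b *\<^sub>R ?inv y b))"
      by (simp only: scaleR_sum_right[symmetric])
    also have "\<dots> = (\<Sum>b\<in>I. l b [X] y *\<^sub>R e b y)"
      using True by (intro sum.cong) (simp_all add: l1[OF X] e_def field_simps)
    finally show ?thesis .
  next
    case False
    then have "\<beta> y = 0" using \<beta>(4,5) by blast
    then show ?thesis using False by (simp add: e_def)
  qed
  have z: "l b [X] y = 0" if "X \<in> Sec E" "X y = 0" for b X y
    using that triv_sum[OF V(1), of y "{}"] by (simp add: l1)
  have nz: "\<exists>b\<in>I. e b x \<noteq> 0" if "\<exists>w::'f. w \<noteq> 0"
  proof -
    obtain w :: 'f where "w \<noteq> 0" using \<open>\<exists>w::'f. w \<noteq> 0\<close> by blast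
    then have "I \<noteq> {}" using I(3)[of w] by (metis sum.empty)
    then obtain b where b: "b \<in> I" "b \<noteq> 0" using I(2) by auto
    have "?inv x b \<noteq> 0" using triv_inv(2)[OF V, of b] triv_sum[OF V, of "{}"] b(2) by (metis finite.emptyI empty_iff sum.empty)
    then show ?thesis using b \<beta>(2) V(2) by (auto simp: e_def intro!: bexI[of _ b])
  qed
  have "\<beta> \<in> Cinf E" using \<beta>(1) by (simp add: Cinf_def)
  moreover have "e b y = 0" if "\<beta> y = 0" for b y using that by (simp add: e_def)
  ultimately have "dual_frame_at x \<beta> I l e"
    unfolding dual_frame_at_def using \<beta>(2) I(1) l e fr z nz by (intro conjI ballI allI impI image_subsetI) assumption+
  then show ?thesis by blast
qed

lemma dual_separates:
  assumes "W \<in> Sec E" "\<And>l. l \<in> reduced_ops E 1 \<Longrightarrow> l [W] y = 0"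
  shows "W y = 0"
proof -
  obtain \<beta> I l e where f: "dual_frame_at y \<beta> I l e" using dual_frame by blast
  have "(\<beta> y * \<beta> y) *\<^sub>R W y = 0" using frame_expansion[OF f assms(1), of y] assms(2) frame_dual[OF f] by (simp add: sum.neutral)
  then show ?thesis using frame_bump[OF f] by simp
qed

lemma dual_eqI:
  assumes "X \<in> Sec E" "Y \<in> Sec E" "\<And>l. l \<in> reduced_ops E 1 \<Longrightarrow> l [X] = l [Y]"
  shows "X = Y"
proof
  fix x
  have "(\<lambda>x. X x - Y x) x = 0"
    using assms by (intro dual_separates[of "\<lambda>x. X x - Y x"] Sec_diff) (simp_all add: dual_diff)
  then show "X x = Y x" by simp
qed

text \<open>A function-linear functional is local at points: multiply X by the squared bump and
  expand it in the frame; the coefficients vanish at y because the frame covectors are pointwise by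
  construction. Injectivity needs this at points where all sections vanish.\<close>

lemma dual_vanishes:
  assumes d: "d \<in> reduced_ops E 1" and X: "X \<in> Sec E" "X y = 0"
  shows "d [X] y = 0"
proof -
  obtain \<beta> I l e where f: "dual_frame_at y \<beta> I l e" using dual_frame by blast
  note bb = Cinf_mult[OF frame_bump(1)[OF f] frame_bump(1)[OF f]]
  have "fmult (\<lambda>z. \<beta> z * \<beta> z) X = (\<lambda>z. \<Sum>b\<in>I. fmult (l b [X]) (e b) z)"
    unfolding fmult_def using frame_expansion[OF f X(1)] by blast
  then have "d [fmult (\<lambda>z. \<beta> z * \<beta> z) X] = (\<lambda>z. \<Sum>b\<in>I. l b [X] z * d [e b] z)"
    using dual_sum[OF d frame_finite[OF f], of "\<lambda>b. fmult (l b [X]) (e b)"] frame_dual[OF f] frame_Sec[OF f] X(1)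
    by (simp add: Sec_fmult dual_Cinf dual_fmult[OF d])
  moreover have "d [fmult (\<lambda>z. \<beta> z * \<beta> z) X] = (\<lambda>z. (\<beta> z * \<beta> z) * d [X] z)"
    by (rule dual_fmult[OF d bb X(1)])
  ultimately have "(\<beta> y * \<beta> y) * d [X] y = (\<Sum>b\<in>I. l b [X] y * d [e b] y)" by metis
  also have "\<dots> = 0" using frame_dual_zero[OF f] X by (simp add: sum.neutral)
  finally show ?thesis using frame_bump(2)[OF f] by simp
qed

lemma nonvanishing_section:
  assumes "\<exists>w::'f. w \<noteq> 0"
  obtains Y where "Y \<in> Sec E" "Y x \<noteq> 0"
proof -
  obtain \<beta> I l e where f: "dual_frame_at x \<beta> I l e" using dual_frame by blast
  then show ?thesis using frame_nonzero[OF f assms] frame_Sec[OF f] that by blast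
qed

lemma Sec_trivial:
  assumes "\<not> (\<exists>w::'f. w \<noteq> 0)" "X \<in> Sec E"
  shows "X = (\<lambda>x. 0)"
proof
  fix x
  obtain U \<Phi> where U: "(U, \<Phi>) \<in> trivs E" "x \<in> U" by (rule triv_cover)
  have "\<Phi> x (X x) = \<Phi> x 0" using assms(1) by metis
  then show "X x = 0"
    by (intro triv_eqI[OF U]) (auto simp: Sec_fibre assms(2) subspace_0[OF fibre_subspace])
qed

text \<open>Near each point Z is a smooth section divided by a smooth function that does not vanish
  there.\<close>

lemma Sec_glue:
  assumes "\<And>x. \<exists>\<beta>\<in>Cinf E. \<beta> x \<noteq> 0 \<and> fmult \<beta> Z \<in> Sec E"
  shows "Z \<in> Sec E"
proof (rule SecI)
  have fib: "Z x \<in> fibre E x" for x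
  proof -
    obtain \<beta> where b: "\<beta> x \<noteq> 0" "fmult \<beta> Z \<in> Sec E" using assms by blast
    have "inverse (\<beta> x) *\<^sub>R (\<beta> x *\<^sub>R Z x) \<in> fibre E x"
      using Sec_fibre[OF b(2), of x] unfolding fmult_def by (rule subspace_scale[OF fibre_subspace])
    then show ?thesis using b(1) by simp
  qed
  then show "Z x \<in> fibre E x" for x .
  fix U \<Phi> assume U: "(U, \<Phi>) \<in> trivs E"
  show "smooth_map_on (charts E) U (\<lambda>x. \<Phi> x (Z x))"
  proof (rule smooth_map_on_local[OF atlas])
    fix x assume x: "x \<in> U"
    obtain \<beta> where b: "\<beta> \<in> Cinf E" "\<beta> x \<noteq> 0" "fmult \<beta> Z \<in> Sec E" using assms by blast
    have bs: "smooth_map_on (charts E) UNIV \<beta>" using b(1) by (simp add: Cinf_def)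
    define V where "V = U \<inter> {y. \<beta> y \<noteq> 0}"
    have "open {y. \<beta> y \<noteq> 0}"
      using smooth_imp_continuous[OF atlas bs] by (intro open_Collect_neq) auto
    then have oV: "open V" using triv_open[OF U] by (auto simp: V_def)
    have "smooth_map_on (charts E) V (\<lambda>y. inverse (\<beta> y) *\<^sub>R \<Phi> y (fmult \<beta> Z y))"
    proof (intro smooth_map_on_scaleR smooth_map_on_inverse[OF atlas])
      show "smooth_map_on (charts E) V \<beta>" by (rule smooth_map_on_subset[OF subset_UNIV bs])
      show "smooth_map_on (charts E) V (\<lambda>y. \<Phi> y (fmult \<beta> Z y))"
        by (rule smooth_map_on_subset[OF _ Sec_smooth[OF b(3) U]]) (simp add: V_def)
    qed (simp add: V_def)
    moreover have "inverse (\<beta> y) *\<^sub>R \<Phi> y (fmult \<beta> Z y) = \<Phi> y (Z y)" if "y \<in> V" for y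
      using that by (simp add: V_def fmult_def triv_scale[OF U] fib)
    ultimately show "\<exists>V g. open V \<and> x \<in> V \<and> smooth_map_on (charts E) V g \<and> (\<forall>y\<in>V. g y = \<Phi> y (Z y))"
      using oV x b(2) by (intro exI[of _ V] exI[of _ "\<lambda>y. inverse (\<beta> y) *\<^sub>R \<Phi> y (fmult \<beta> Z y)"]) (simp add: V_def)
  qed
qed

text \<open>Near a point every covector is a combination of frame covectors, so T is represented by
  the sum of the frame sections with coefficients T of the frame covectors. The local
  representatives are then glued, their agreement being tested on covectors.\<close>

lemma dual_reflexive:
  assumes T: "\<And>l. l \<in> reduced_ops E 1 \<Longrightarrow> T l \<in> Cinf E"
    and T_add: "\<And>l l'. l \<in> reduced_ops E 1 \<Longrightarrow> l' \<in> reduced_ops E 1 \<Longrightarrow>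
      T (\<lambda>Xs x. l Xs x + l' Xs x) = (\<lambda>x. T l x + T l' x)"
    and T_mult: "\<And>f l. f \<in> Cinf E \<Longrightarrow> l \<in> reduced_ops E 1 \<Longrightarrow> T (\<lambda>Xs x. f x * l Xs x) = (\<lambda>x. f x * T l x)"
  obtains Z where "Z \<in> Sec E" "\<And>l. l \<in> reduced_ops E 1 \<Longrightarrow> l [Z] = T l"
proof -
  have T_sum: "T (\<lambda>Xs x. \<Sum>i\<in>I. f i x * l i Xs x) = (\<lambda>x. \<Sum>i\<in>I. f i x * T (l i) x)"
    if "finite I" "\<And>i. i \<in> I \<Longrightarrow> l i \<in> reduced_ops E 1" "\<And>i. i \<in> I \<Longrightarrow> f i \<in> Cinf E"
    for I :: "'f set" and f l
    using that
  proof (induction I)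
    case empty
    have "(\<lambda>Xs x. 0) \<in> reduced_ops E 1" using dual_comb[of "{}"] by simp
    from T_mult[OF Cinf_const[of 0] this] show ?case by simp
  next
    case (insert i I)
    have "(\<lambda>Xs x. \<Sum>i\<in>I. f i x * l i Xs x) \<in> reduced_ops E 1"
      using insert by (intro dual_comb) auto
    moreover have "(\<lambda>Xs x. f i x * l i Xs x) \<in> reduced_ops E 1"
      using dual_comb[of "{i}" l f] insert by simp
    ultimately show ?case using insert by (simp add: T_add T_mult)
  qed
  have loc: "\<exists>\<beta> W. \<beta> \<in> Cinf E \<and> \<beta> x \<noteq> 0 \<and> W \<in> Sec E \<and> (\<forall>y. \<beta> y = 0 \<longrightarrow> W y = 0) \<and>
      (\<forall>l\<in>reduced_ops E 1. l [W] = (\<lambda>y. \<beta> y * T l y))" for x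
  proof -
    obtain \<beta> I l e where f: "dual_frame_at x \<beta> I l e" using dual_frame by blast
    note bb = Cinf_mult[OF frame_bump(1)[OF f] frame_bump(1)[OF f]]
    define W where "W = (\<lambda>z. \<Sum>b\<in>I. fmult (T (l b)) (e b) z)"
    have W: "W \<in> Sec E" unfolding W_def by (intro Sec_sum Sec_fmult T frame_dual[OF f] frame_Sec[OF f])
    have "k [W] = (\<lambda>y. (\<beta> y * \<beta> y) * T k y)" if k: "k \<in> reduced_ops E 1" for k
    proof -
      \<comment> \<open>The frame expansion, transposed from sections to covectors: the coefficient
        of \<open>l b\<close> is the value of k on \<open>e b\<close>.\<close>
      have "(\<lambda>Xs x. (\<beta> x * \<beta> x) * k Xs x) = (\<lambda>Xs x. \<Sum>b\<in>I. k [e b] x * l b Xs x)"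
      proof
        fix Xs
        show "(\<lambda>x. (\<beta> x * \<beta> x) * k Xs x) = (\<lambda>x. \<Sum>b\<in>I. k [e b] x * l b Xs x)"
        proof (cases "Xs \<in> args E 1")
          case True
          then obtain X where X: "X \<in> Sec E" "Xs = [X]" by (auto simp: args_1)
          have "fmult (\<lambda>z. \<beta> z * \<beta> z) X = (\<lambda>z. \<Sum>b\<in>I. fmult (l b [X]) (e b) z)"
            unfolding fmult_def using frame_expansion[OF f X(1)] by blast
          then have "k [fmult (\<lambda>z. \<beta> z * \<beta> z) X] = (\<lambda>z. \<Sum>b\<in>I. l b [X] z * k [e b] z)"
            using dual_sum[OF k frame_finite[OF f], of "\<lambda>b. fmult (l b [X]) (e b)"] frame_dual[OF f] frame_Sec[OF f] X(1)
            by (simp add: Sec_fmult dual_Cinf dual_fmult[OF k])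
          then show ?thesis using dual_fmult[OF k bb X(1)] X(2)
            by (simp add: mult.commute)
        next
          case False
          then show ?thesis using dual_outside[OF k] frame_dual[OF f] by (simp add: dual_outside)
        qed
      qed
      then have "T (\<lambda>Xs x. (\<beta> x * \<beta> x) * k Xs x) = T (\<lambda>Xs x. \<Sum>b\<in>I. k [e b] x * l b Xs x)" by simp
      then have "(\<lambda>x. (\<beta> x * \<beta> x) * T k x) = (\<lambda>x. \<Sum>b\<in>I. k [e b] x * T (l b) x)"
        using T_mult[OF bb k] T_sum[OF frame_finite[OF f] frame_dual[OF f], where f = "\<lambda>b. k [e b]"]
          frame_Sec[OF f] dual_Cinf[OF k]
        by simp
      moreover have "k [W] = (\<lambda>x. \<Sum>b\<in>I. T (l b) x * k [e b] x)"
        unfolding W_def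
        by (subst dual_sum[OF k frame_finite[OF f]])
          (auto simp: dual_fmult[OF k] Sec_fmult T frame_dual[OF f] frame_Sec[OF f])
      ultimately show ?thesis by (simp add: mult.commute)
    qed
    then show ?thesis using W bb frame_bump(2)[OF f] frame_Sec_zero[OF f]
      by (intro exI[of _ "\<lambda>y. \<beta> y * \<beta> y"] exI[of _ W]) (simp add: W_def fmult_def)
  qed
  then obtain \<beta> W where bW: "\<And>x. \<beta> x \<in> Cinf E" "\<And>x. \<beta> x x \<noteq> 0" "\<And>x. W x \<in> Sec E"
    "\<And>x y. \<beta> x y = 0 \<Longrightarrow> W x y = 0"
    "\<And>x l. l \<in> reduced_ops E 1 \<Longrightarrow> l [W x] = (\<lambda>y. \<beta> x y * T l y)"
    by metis
  \<comment> \<open>The value at y is taken from the representative centred at y, whose cut-off does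
    not vanish there; \<open>bZ\<close> shows that any other centre gives the same up to its
    cut-off.\<close>
  define Z where "Z y = inverse (\<beta> y y) *\<^sub>R W y y" for y
  have bZ: "fmult (\<beta> x) Z = W x" for x
  proof
    fix y
    \<comment> \<open>The coefficients are frozen at y, so this is a real combination of two
      sections. At y every covector l sends both terms to the product of both cut-offs with T
      l.\<close>
    have "(\<lambda>z. \<beta> y y *\<^sub>R W x z - \<beta> x y *\<^sub>R W y z) y = 0"
    proof (rule dual_separates[of "\<lambda>z. \<beta> y y *\<^sub>R W x z - \<beta> x y *\<^sub>R W y z"])
      show "(\<lambda>z. \<beta> y y *\<^sub>R W x z - \<beta> x y *\<^sub>R W y z) \<in> Sec E"
        by (intro Sec_diff Sec_scale bW)
      show "l [\<lambda>z. \<beta> y y *\<^sub>R W x z - \<beta> x y *\<^sub>R W y z] y = 0" if "l \<in> reduced_ops E 1" for l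
        by (simp add: dual_diff[OF that Sec_scale[OF bW(3)] Sec_scale[OF bW(3)]]
            dual_scale[OF that bW(3)] bW(5)[OF that])
    qed
    then have "\<beta> y y *\<^sub>R W x y = \<beta> x y *\<^sub>R W y y" by simp
    then have "inverse (\<beta> y y) *\<^sub>R (\<beta> y y *\<^sub>R W x y) = inverse (\<beta> y y) *\<^sub>R (\<beta> x y *\<^sub>R W y y)" by simp
    then show "fmult (\<beta> x) Z y = W x y" using bW(2)[of y] by (simp add: fmult_def Z_def mult.commute)
  qed
  have Z: "Z \<in> Sec E" by (rule Sec_glue) (metis bW(1-3) bZ)
  have "l [Z] = T l" if l: "l \<in> reduced_ops E 1" for l
  proof
    fix x
    have "\<beta> x x * l [Z] x = \<beta> x x * T l x"
      using dual_fmult[OF l bW(1) Z] bW(5)[OF l, of x] unfolding bZ by (metis (no_types))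
    then show "l [Z] x = T l x" using bW(2) by simp
  qed
  then show ?thesis using that Z by blast
qed

end

section \<open>Total order\<close>

text \<open>\<open>n\<close> nested commutators annihilate \<open>D\<close>; hence total order at most \<open>k\<close> is \<open>tot E p (Suc k) D\<close>.\<close>

primrec tot :: "('m, 'e::real_inner, 'v::real_vector, 'f::real_inner) vbundle \<Rightarrow> nat \<Rightarrow> nat
    \<Rightarrow> (('m \<Rightarrow> 'v) list \<Rightarrow> 'm \<Rightarrow> 'w::real_vector) \<Rightarrow> bool" where
  "tot E p 0 = (\<lambda>D. \<forall>Xs\<in>args E p. D Xs = (\<lambda>x. 0))"
| "tot E p (Suc n) = (\<lambda>D. \<forall>i<p. \<forall>f\<in>Cinf E. tot E p n (\<delta> i f D))"

text \<open>Additivity and homogeneity in one equation, so that sums, differences and multiples are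
  instances and a single computation per operator suffices.\<close>

definition slot_linear :: "('m, 'e::real_inner, 'v::real_vector, 'f::real_inner) vbundle \<Rightarrow> nat
    \<Rightarrow> (('m \<Rightarrow> 'v) list \<Rightarrow> 'm \<Rightarrow> 'w::real_vector) \<Rightarrow> bool" where
  "slot_linear E p D \<longleftrightarrow> (\<forall>Xs\<in>args E p. \<forall>i<p. \<forall>Y\<in>Sec E. \<forall>Z\<in>Sec E. \<forall>r s.
     D (Xs[i := (\<lambda>x. r *\<^sub>R Y x + s *\<^sub>R Z x)]) = (\<lambda>x. r *\<^sub>R D (Xs[i := Y]) x + s *\<^sub>R D (Xs[i := Z]) x))"

lemma tot_iff:
  "tot E p n D \<longleftrightarrow> (\<forall>ifs. length ifs = n \<and> set ifs \<subseteq> {..<p} \<times> Cinf E \<longrightarrow>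
     (\<forall>Xs\<in>args E p. foldr (\<lambda>(i, f). \<delta> i f) ifs D Xs = (\<lambda>x. 0)))"
proof (induction n arbitrary: D)
  case 0
  then show ?case by simp
next
  case (Suc n)
  show ?case
  proof
    assume L: "tot E p (Suc n) D"
    show "\<forall>ifs. length ifs = Suc n \<and> set ifs \<subseteq> {..<p} \<times> Cinf E \<longrightarrow>
       (\<forall>Xs\<in>args E p. foldr (\<lambda>(i, f). \<delta> i f) ifs D Xs = (\<lambda>x. 0))"
    proof (intro allI impI, elim conjE)
      fix ifs assume ifs: "length ifs = Suc n" "set ifs \<subseteq> {..<p} \<times> Cinf E"
      \<comment> \<open>\<open>foldr\<close> applies the last pair first, which is the commutator
        that the recursion of \<open>tot\<close> strips off.\<close>
      then obtain js i f where j: "ifs = js @ [(i, f)]" by (cases ifs rule: rev_cases) auto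
      then have "tot E p n (\<delta> i f D)" using L ifs by simp
      then show "\<forall>Xs\<in>args E p. foldr (\<lambda>(i, f). \<delta> i f) ifs D Xs = (\<lambda>x. 0)"
        using Suc.IH[of "\<delta> i f D"] ifs j by auto
    qed
  next
    assume R: "\<forall>ifs. length ifs = Suc n \<and> set ifs \<subseteq> {..<p} \<times> Cinf E \<longrightarrow>
       (\<forall>Xs\<in>args E p. foldr (\<lambda>(i, f). \<delta> i f) ifs D Xs = (\<lambda>x. 0))"
    have "tot E p n (\<delta> i f D)" if "i < p" "f \<in> Cinf E" for i f
      unfolding Suc.IH using R[rule_format, of "_ @ [(i, f)]"] that by auto
    then show "tot E p (Suc n) D" by simp
  qed
qed

lemma total_order_le_iff_tot: "total_order_le E p k D \<longleftrightarrow> tot E p (Suc k) D"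
  unfolding total_order_le_def tot_iff by (simp add: One_nat_def)

lemma total_order_imp_order_le:
  assumes "total_order_le E p k D" "i < p" shows "order_le E p i k D"
  unfolding order_le_def
proof (intro allI impI ballI)
  fix fs Xs assume fs: "length fs = k + 1 \<and> set fs \<subseteq> Cinf E" and Xs: "Xs \<in> args E p"
  have "foldr (\<lambda>(i, f). \<delta> i f) (map (Pair i) fs) D Xs = (\<lambda>x. 0)"
    using assms(1)[unfolded total_order_le_def, rule_format, of "map (Pair i) fs" Xs] assms(2) fs Xs by auto
  moreover have "foldr (\<lambda>(i, f). \<delta> i f) (map (Pair i) fs) D = foldr (\<delta> i) fs D"
    by (induction fs) auto
  ultimately show "foldr (\<delta> i) fs D Xs = (\<lambda>x. 0)" by simp
qed

lemma args_update: "Xs \<in> args E p \<Longrightarrow> Z \<in> Sec E \<Longrightarrow> Xs[i := Z] \<in> args E p"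
  unfolding args_def by (auto intro: set_update_subset[THEN subsetD])

lemma args_nth: "Xs \<in> args E p \<Longrightarrow> i < p \<Longrightarrow> Xs ! i \<in> Sec E"
  unfolding args_def by auto

lemma args_length: "Xs \<in> args E p \<Longrightarrow> length Xs = p"
  unfolding args_def by auto

definition rem :: "nat \<Rightarrow> 'a list \<Rightarrow> 'a list" where
  "rem i Xs = take i Xs @ drop (Suc i) Xs"

lemma rem_args: "Xs \<in> args E (Suc p) \<Longrightarrow> i \<le> p \<Longrightarrow> rem i Xs \<in> args E p"
  unfolding args_def rem_def by (auto dest: in_set_takeD in_set_dropD)

lemma rem_update_same: "rem i (Xs[i := Z]) = rem i Xs"
  unfolding rem_def by simp

text \<open>Deleting entry i lowers the later indices by one; updates at other positions survive
  under the corrected index.\<close>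

lemma rem_update:
  assumes "j \<noteq> i" "i < length Xs" "j < length Xs"
  shows "rem i (Xs[j := Z]) = (rem i Xs)[(if j < i then j else j - 1) := Z]"
    and "rem i Xs ! (if j < i then j else j - 1) = Xs ! j"
  using assms unfolding rem_def
  by (auto simp: list_update_append take_update_swap drop_update_swap nth_append Suc_diff_le list_update_beyond One_nat_def)

context smooth_vector_bundle
begin

section \<open>Calculus of nested commutators\<close>

lemma Sec_lin: "X \<in> Sec E \<Longrightarrow> Y \<in> Sec E \<Longrightarrow> (\<lambda>x. r *\<^sub>R X x + s *\<^sub>R Y x) \<in> Sec E"
  by (intro Sec_add Sec_scale)

lemma fmult_lin: "fmult f (\<lambda>x. r *\<^sub>R Y x + s *\<^sub>R Z x) = (\<lambda>x. r *\<^sub>R fmult f Y x + s *\<^sub>R fmult f Z x)"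
  by (simp add: fmult_def fun_eq_iff algebra_simps)

lemma args_fmult: "Xs \<in> args E p \<Longrightarrow> i < p \<Longrightarrow> f \<in> Cinf E \<Longrightarrow> Xs[i := fmult f (Xs ! i)] \<in> args E p"
  by (intro args_update Sec_fmult args_nth)

lemma tot_cong:
  assumes "\<And>Xs. Xs \<in> args E p \<Longrightarrow> D Xs = D' Xs" "tot E p n D"
  shows "tot E p n D'"
  using assms
proof (induction n arbitrary: D D')
  case (Suc n)
  have "tot E p n (\<delta> i f D')" if "i < p" "f \<in> Cinf E" for i f
    by (rule Suc.IH[of "\<delta> i f D"]) (use Suc.prems that in \<open>auto simp: \<delta>_def args_fmult\<close>)
  then show ?case by simp
qed simp

lemma tot_zero: "(\<And>Xs. Xs \<in> args E p \<Longrightarrow> D Xs = (\<lambda>x. 0)) \<Longrightarrow> tot E p n D"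
proof (induction n arbitrary: D)
  case (Suc n)
  have "tot E p n (\<delta> i f D)" if "i < p" "f \<in> Cinf E" for i f
    by (rule Suc.IH) (use Suc.prems that in \<open>auto simp: \<delta>_def args_fmult\<close>)
  then show ?case by simp
qed simp

lemma tot_lin:
  assumes "tot E p n D" "tot E p n D'"
  shows "tot E p n (\<lambda>Xs x. r *\<^sub>R D Xs x + s *\<^sub>R D' Xs x)"
  using assms
proof (induction n arbitrary: D D')
  case (Suc n)
  have "\<delta> i f (\<lambda>Xs x. r *\<^sub>R D Xs x + s *\<^sub>R D' Xs x) = (\<lambda>Xs x. r *\<^sub>R \<delta> i f D Xs x + s *\<^sub>R \<delta> i f D' Xs x)" for i f
    by (simp add: \<delta>_def fun_eq_iff algebra_simps)
  then show ?case using Suc by simp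
qed simp

lemma tot_add: "tot E p n D \<Longrightarrow> tot E p n D' \<Longrightarrow> tot E p n (\<lambda>Xs x. D Xs x + D' Xs x)"
  using tot_lin[of p n D D' 1 1] by simp

lemma tot_scale: "tot E p n D \<Longrightarrow> tot E p n (\<lambda>Xs x. r *\<^sub>R D Xs x)"
  using tot_lin[of p n D D r 0] by simp

lemma tot_sum: "(\<And>i. i \<in> I \<Longrightarrow> tot E p n (D i)) \<Longrightarrow> tot E p n (\<lambda>Xs x. \<Sum>i\<in>I. D i Xs x)"
  by (induction I rule: infinite_finite_induct) (simp_all add: tot_add tot_zero)

lemma slot_linearD:
  assumes "slot_linear E p D" "Xs \<in> args E p" "i < p" "Y \<in> Sec E" "Z \<in> Sec E"
  shows "D (Xs[i := (\<lambda>x. r *\<^sub>R Y x + s *\<^sub>R Z x)]) = (\<lambda>x. r *\<^sub>R D (Xs[i := Y]) x + s *\<^sub>R D (Xs[i := Z]) x)"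
  using assms(1)[unfolded slot_linear_def, rule_format, OF assms(2-)] .

lemma slot_linear_zero:
  assumes "slot_linear E p D" "Xs \<in> args E p" "i < p"
  shows "D (Xs[i := (\<lambda>x. 0)]) = (\<lambda>x. 0)"
  using slot_linearD[OF assms Sec_zero Sec_zero, of 0 0] by simp

lemma slot_linear_iff: "slot_linear E p D \<longleftrightarrow> multilinear E p D"
proof
  assume L: "slot_linear E p D"
  show "multilinear E p D"
    unfolding multilinear_def
  proof (intro ballI allI impI conjI)
    fix Xs i Y Z and r :: real assume *: "Xs \<in> args E p" "i < p" "Y \<in> Sec E" "Z \<in> Sec E"
    show "D (Xs[i := (\<lambda>x. Y x + Z x)]) = (\<lambda>x. D (Xs[i := Y]) x + D (Xs[i := Z]) x)"
      using slot_linearD[OF L *, of 1 1] by simp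
    show "D (Xs[i := (\<lambda>x. r *\<^sub>R Y x)]) = (\<lambda>x. r *\<^sub>R D (Xs[i := Y]) x)"
      using slot_linearD[OF L *, of r 0] by simp
  qed
next
  assume R: "multilinear E p D"
  show "slot_linear E p D"
    unfolding slot_linear_def
  proof (intro ballI allI impI)
    fix Xs i Y Z and r s :: real assume *: "Xs \<in> args E p" "i < p" "Y \<in> Sec E" "Z \<in> Sec E"
    note R' = R[unfolded multilinear_def, rule_format, OF *(1,2)]
    show "D (Xs[i := (\<lambda>x. r *\<^sub>R Y x + s *\<^sub>R Z x)]) = (\<lambda>x. r *\<^sub>R D (Xs[i := Y]) x + s *\<^sub>R D (Xs[i := Z]) x)"
      using R'[OF Sec_scale[OF *(3), of r] Sec_scale[OF *(4), of s]] R'[OF *(3,4), of r] R'[OF *(4,3), of s]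
      by simp
  qed
qed

lemma slot_linear_cong:
  assumes "\<And>Xs. Xs \<in> args E p \<Longrightarrow> D Xs = D' Xs" "slot_linear E p D"
  shows "slot_linear E p D'"
  using assms unfolding slot_linear_def by (simp add: args_update Sec_lin)

lemma slot_linear_lin:
  assumes "slot_linear E p D" "slot_linear E p D'"
  shows "slot_linear E p (\<lambda>Xs x. a *\<^sub>R D Xs x + b *\<^sub>R D' Xs x)"
  using assms unfolding slot_linear_def by (simp add: fun_eq_iff algebra_simps)

lemma slot_linear_zero_fun: "slot_linear E p (\<lambda>Xs x. 0)"
  unfolding slot_linear_def by simp

lemma slot_linear_scale: "slot_linear E p D \<Longrightarrow> slot_linear E p (\<lambda>Xs x. a *\<^sub>R D Xs x)"
  using slot_linear_lin[of p D D a 0] by simp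

lemma slot_linear_sum:
  "(\<And>i. i \<in> I \<Longrightarrow> slot_linear E p (D i)) \<Longrightarrow> slot_linear E p (\<lambda>Xs x. \<Sum>i\<in>I. D i Xs x)"
  by (induction I rule: infinite_finite_induct)
    (auto simp: slot_linear_zero_fun intro: slot_linear_lin[where a = 1 and b = 1, simplified])

lemma slot_linear_\<delta>:
  assumes "slot_linear E p D" "i < p" "f \<in> Cinf E"
  shows "slot_linear E p (\<delta> i f D)"
  unfolding slot_linear_def
proof (intro ballI allI impI)
  fix Xs j Y Z and r s :: real assume *: "Xs \<in> args E p" "j < p" "Y \<in> Sec E" "Z \<in> Sec E"
  show "\<delta> i f D (Xs[j := (\<lambda>x. r *\<^sub>R Y x + s *\<^sub>R Z x)]) =
      (\<lambda>x. r *\<^sub>R \<delta> i f D (Xs[j := Y]) x + s *\<^sub>R \<delta> i f D (Xs[j := Z]) x)"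
  proof (cases "i = j")
    case True
    then show ?thesis
      using slot_linearD[OF assms(1) *, of r s] *
        slot_linearD[OF assms(1) *(1,2) Sec_fmult[OF assms(3) *(3)] Sec_fmult[OF assms(3) *(4)], of r s]
      by (simp add: \<delta>_def args_length fmult_lin fun_eq_iff algebra_simps)
  next
    case False
    then show ?thesis
      using slot_linearD[OF assms(1) *, of r s]
        slot_linearD[OF assms(1) args_fmult[OF *(1) assms(2,3)] *(2-), of r s]
      by (simp add: \<delta>_def fun_eq_iff algebra_simps list_update_swap)
  qed
qed

text \<open>A commutator in slot i vanishes because \<open>h\<close> is function-linear, and one in
  any other slot passes to \<open>c\<close>, so the factor does not raise the order.\<close>

lemma tot_pointwise_mult:
  assumes h: "\<And>f X. f \<in> Cinf E \<Longrightarrow> X \<in> Sec E \<Longrightarrow> h (fmult f X) = (\<lambda>x. f x * h X x)" and i: "i \<le> p"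
  shows "tot E p n c \<Longrightarrow> tot E (Suc p) n (\<lambda>Xs x. (h (Xs ! i) x :: real) * c (rem i Xs) x)"
proof (induction n arbitrary: c)
  case 0
  then show ?case using i by (simp add: rem_args)
next
  case (Suc n)
  let ?G = "\<lambda>c Xs x. h (Xs ! i) x * c (rem i Xs) x"
  have "tot E (Suc p) n (\<delta> j f (?G c))" if j: "j < Suc p" and f: "f \<in> Cinf E" for j f
  proof (cases "j = i")
    case True
    show ?thesis
      by (rule tot_zero) (use True j f in \<open>simp add: \<delta>_def rem_update_same args_length args_nth h\<close>)
  next
    case False
    define l where "l = (if j < i then j else j - 1)"
    have "l < p" using False i j by (auto simp: l_def)
    then have "tot E (Suc p) n (?G (\<delta> l f c))" using Suc f by (intro Suc.IH) simp
    then show ?thesis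
    proof (rule tot_cong[rotated])
      fix Xs assume Xs: "Xs \<in> args E (Suc p)"
      have u: "rem i (Xs[j := Z]) = (rem i Xs)[l := Z]" "rem i Xs ! l = Xs ! j" for Z
        using rem_update[of j i Xs, folded l_def] False i j args_length[OF Xs] by auto
      show "?G (\<delta> l f c) Xs = \<delta> j f (?G c) Xs"
        using False by (simp add: \<delta>_def u fun_eq_iff right_diff_distrib mult_ac)
    qed
  qed
  then show ?case by simp
qed

end

section \<open>Products with arguments distributed by a permutation\<close>

definition lpart :: "nat \<Rightarrow> (nat \<Rightarrow> nat) \<Rightarrow> 'a list \<Rightarrow> 'a list" where
  "lpart p \<sigma> Xs = map (\<lambda>i. Xs ! \<sigma> i) [0..<p]"

definition rpart :: "nat \<Rightarrow> nat \<Rightarrow> (nat \<Rightarrow> nat) \<Rightarrow> 'a list \<Rightarrow> 'a list" where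
  "rpart p q \<sigma> Xs = map (\<lambda>i. Xs ! \<sigma> i) [p..<p + q]"

lemma parts_args:
  assumes "\<sigma> permutes {..<p + q}" "Xs \<in> args E (p + q)"
  shows "lpart p \<sigma> Xs \<in> args E p" "rpart p q \<sigma> Xs \<in> args E q"
proof -
  have "Xs ! \<sigma> i \<in> Sec E" if "i < p + q" for i
    using permutes_in_image[OF assms(1), of i] that by (intro args_nth[OF assms(2)]) auto
  then show "lpart p \<sigma> Xs \<in> args E p" "rpart p q \<sigma> Xs \<in> args E q"
    by (auto simp: args_def lpart_def rpart_def)
qed

lemma parts_update:
  assumes \<sigma>: "\<sigma> permutes {..<p + q}" and Xs: "length Xs = p + q" and j: "j < p + q"
  shows "lpart p \<sigma> (Xs[\<sigma> j := Z]) = (lpart p \<sigma> Xs)[j := Z]"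
    and "j < p \<Longrightarrow> lpart p \<sigma> Xs ! j = Xs ! \<sigma> j"
    and "rpart p q \<sigma> (Xs[\<sigma> j := Z]) = (if j < p then rpart p q \<sigma> Xs else (rpart p q \<sigma> Xs)[j - p := Z])"
    and "\<not> j < p \<Longrightarrow> rpart p q \<sigma> Xs ! (j - p) = Xs ! \<sigma> j"
proof -
  have inj: "\<sigma> j = \<sigma> i \<longleftrightarrow> i = j" for i using permutes_inj[OF \<sigma>] by (auto dest: injD)
  have "\<sigma> j < length Xs" using permutes_in_image[OF \<sigma>, of j] j Xs by simp
  then have upd: "Xs[\<sigma> j := Z] ! \<sigma> i = (if i = j then Z else Xs ! \<sigma> i)" for i
    by (simp only: nth_list_update inj)
  show "lpart p \<sigma> (Xs[\<sigma> j := Z]) = (lpart p \<sigma> Xs)[j := Z]"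
    by (rule nth_equalityI) (auto simp: lpart_def upd nth_list_update)
  show "rpart p q \<sigma> (Xs[\<sigma> j := Z]) = (if j < p then rpart p q \<sigma> Xs else (rpart p q \<sigma> Xs)[j - p := Z])"
    by (rule nth_equalityI) (auto simp: rpart_def upd nth_list_update)
  show "j < p \<Longrightarrow> lpart p \<sigma> Xs ! j = Xs ! \<sigma> j" by (simp add: lpart_def)
  show "\<not> j < p \<Longrightarrow> rpart p q \<sigma> Xs ! (j - p) = Xs ! \<sigma> j" using j by (auto simp: rpart_def)
qed

lemma lpart_update_beyond: "\<not> j < p \<Longrightarrow> (lpart p \<sigma> Xs)[j := Z] = lpart p \<sigma> Xs"
  by (simp add: lpart_def list_update_beyond)

context smooth_vector_bundle
begin

lemma Cinf_\<delta>:
  assumes "\<And>Xs. Xs \<in> args E p \<Longrightarrow> D Xs \<in> Cinf E" "i < p" "f \<in> Cinf E" "Xs \<in> args E p"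
  shows "\<delta> i f D Xs \<in> Cinf E"
  unfolding \<delta>_def using assms by (auto intro!: Cinf_diff Cinf_mult args_fmult)

lemma Sec_\<delta>:
  assumes "\<And>Xs. Xs \<in> args E p \<Longrightarrow> D Xs \<in> Sec E" "i < p" "f \<in> Cinf E" "Xs \<in> args E p"
  shows "\<delta> i f D Xs \<in> Sec E"
  unfolding \<delta>_def using assms Sec_fmult[of f "D Xs"]
  by (auto intro!: Sec_diff args_fmult simp: fmult_def[of f "D Xs"])

definition part_prod :: "nat \<Rightarrow> nat \<Rightarrow> (nat \<Rightarrow> nat) \<Rightarrow> ('m, 'v) cochain \<Rightarrow> ('m, 'v) cochain \<Rightarrow> ('m, 'v) cochain" where
  "part_prod p q \<sigma> a b = (\<lambda>Xs x. a (lpart p \<sigma> Xs) x * b (rpart p q \<sigma> Xs) x)"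

text \<open>Orders add: counts n and m mean orders n - 1 and m - 1, and the product has count n + m
  - 1. Each commutator acts on exactly one factor and lowers its count by one; when a count has
  reached 0 that factor vanishes.\<close>

lemma tot_part_prod:
  assumes \<sigma>: "\<sigma> permutes {..<p + q}"
  shows "tot E p n a \<Longrightarrow> tot E q m b \<Longrightarrow> n + m \<le> Suc r \<Longrightarrow> tot E (p + q) r (part_prod p q \<sigma> a b)"
proof (induction r arbitrary: n m a b)
  case (0 n m a b)
  then have "n = 0 \<or> m = 0" by auto
  then show ?case using 0 parts_args[OF \<sigma>, of _ E] by (auto simp: part_prod_def)
next
  case (Suc r n m a b)
  show ?case
  proof (cases "n = 0 \<or> m = 0")
    case True
    then show ?thesis using Suc.prems parts_args[OF \<sigma>, of _ E] by (intro tot_zero) (auto simp: part_prod_def)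
  next
    case False
    then obtain n' m' where nm: "n = Suc n'" "m = Suc m'" by (metis not0_implies_Suc)
    have "tot E (p + q) r (\<delta> k f (part_prod p q \<sigma> a b))" if k: "k < p + q" and f: "f \<in> Cinf E" for k f
    proof -
      \<comment> \<open>Argument k of the whole list is entry j of the concatenation of the two
        parts, so j < p decides which factor the commutator meets.\<close>
      define j where "j = inv \<sigma> k"
      have j: "j < p + q" "\<sigma> j = k"
        using permutes_in_image[OF permutes_inv[OF \<sigma>], of k] permutes_inverses(1)[OF \<sigma>] k
        by (auto simp: j_def)
      show ?thesis
      proof (cases "j < p")
        case True
        have "tot E (p + q) r (part_prod p q \<sigma> (\<delta> j f a) b)"
          using Suc.prems nm True f by (intro Suc.IH[of n' _ m]) auto
        then show ?thesis
          by (rule tot_cong[rotated])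
            (use True j in \<open>auto simp: part_prod_def \<delta>_def args_length parts_update[OF \<sigma>, where j = j, simplified j(2)] fun_eq_iff algebra_simps\<close>)
      next
        case False
        have "tot E (p + q) r (part_prod p q \<sigma> a (\<delta> (j - p) f b))"
          using Suc.prems nm False f j by (intro Suc.IH[of n _ m']) auto
        then show ?thesis
          by (rule tot_cong[rotated])
            (use False j in \<open>auto simp: part_prod_def \<delta>_def args_length lpart_update_beyond parts_update[OF \<sigma>, where j = j, simplified j(2)] fun_eq_iff algebra_simps\<close>)
      qed
    qed
    then show ?thesis by simp
  qed
qed

lemma slot_linear_part_prod:
  assumes \<sigma>: "\<sigma> permutes {..<p + q}" and a: "slot_linear E p a" and b: "slot_linear E q b"
  shows "slot_linear E (p + q) (part_prod p q \<sigma> a b)"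
  unfolding slot_linear_def
proof (intro ballI allI impI)
  fix Xs k Y Z and r s :: real
  assume Xs: "Xs \<in> args E (p + q)" and k: "k < p + q" and YZ: "Y \<in> Sec E" "Z \<in> Sec E"
  define j where "j = inv \<sigma> k"
  have j: "j < p + q" "\<sigma> j = k"
    using permutes_in_image[OF permutes_inv[OF \<sigma>], of k] permutes_inverses(1)[OF \<sigma>] k
    by (auto simp: j_def)
  note u = parts_update[OF \<sigma> args_length[OF Xs] j(1), unfolded j(2)]
  show "part_prod p q \<sigma> a b (Xs[k := (\<lambda>x. r *\<^sub>R Y x + s *\<^sub>R Z x)]) =
      (\<lambda>x. r *\<^sub>R part_prod p q \<sigma> a b (Xs[k := Y]) x + s *\<^sub>R part_prod p q \<sigma> a b (Xs[k := Z]) x)"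
  proof (cases "j < p")
    case True
    then show ?thesis
      using slot_linearD[OF a parts_args(1)[OF \<sigma> Xs] True YZ, of r s]
      by (simp add: part_prod_def u algebra_simps)
  next
    case False
    then have "j - p < q" using j by auto
    from slot_linearD[OF b parts_args(2)[OF \<sigma> Xs] this YZ, of r s] False
    show ?thesis by (simp add: part_prod_def u lpart_update_beyond algebra_simps)
  qed
qed

text \<open>The bracket terms of the Loday differential, for i < j: argument i is deleted and the
  bracket replaces argument j, which then has index j - 1.\<close>

definition subst :: "nat \<Rightarrow> nat \<Rightarrow> ('m, 'v) cochain \<Rightarrow> (('m \<Rightarrow> 'v) list \<Rightarrow> 'm \<Rightarrow> 'v) \<Rightarrow> ('m, 'v) cochain" where
  "subst i j c b = (\<lambda>Xs. c ((rem i Xs)[j - 1 := b [Xs ! i, Xs ! j]]))"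

lemma args_2: "X \<in> Sec E \<Longrightarrow> Y \<in> Sec E \<Longrightarrow> [X, Y] \<in> args E 2"
  by (simp add: args_def)

text \<open>Orders add under composition. A function in slot i or j has to pass first through
  \<open>b\<close> and then through slot j - 1 of \<open>c\<close>, giving one commutator with each;
  in any other slot only \<open>c\<close> is met. The counts are as for products.\<close>

lemma tot_subst:
  assumes ij: "i < j" "j \<le> p"
  shows "slot_linear E p c \<Longrightarrow> (\<And>Ys. Ys \<in> args E 2 \<Longrightarrow> b Ys \<in> Sec E) \<Longrightarrow> tot E p n c \<Longrightarrow> tot E 2 m b
    \<Longrightarrow> n + m \<le> Suc r \<Longrightarrow> tot E (Suc p) r (subst i j c b)"
proof (induction r arbitrary: n m c b)
  have z: "subst i j c b Xs = (\<lambda>x. 0)"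
    if c: "slot_linear E p c" and b: "\<And>Ys. Ys \<in> args E 2 \<Longrightarrow> b Ys \<in> Sec E" and t: "tot E p n c" "tot E 2 m b"
      and nm: "n = 0 \<or> m = 0" and Xs: "Xs \<in> args E (Suc p)" for n m c b Xs
  proof -
    have a2: "[Xs ! i, Xs ! j] \<in> args E 2" using ij by (intro args_2 args_nth[OF Xs]) auto
    have R: "rem i Xs \<in> args E p" using ij Xs by (intro rem_args) auto
    show ?thesis
    proof (cases "n = 0")
      case True
      then show ?thesis using t(1) args_update[OF R b[OF a2]] by (simp add: subst_def)
    next
      case False
      then have "b [Xs ! i, Xs ! j] = (\<lambda>x. 0)" using nm t(2) a2 by simp
      then show ?thesis using slot_linear_zero[OF c R, of "j - 1"] ij by (simp add: subst_def)
    qed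
  qed
  {
    case (0 n m c b)
    then have "n = 0 \<or> m = 0" by auto
    then show ?case using z[OF 0(1,2,3,4)] by simp
  next
    case (Suc r n m c b)
    note cb = Suc.prems(1,2)
    show ?case
    proof (cases "n = 0 \<or> m = 0")
      case True
      then show ?thesis using z[OF Suc.prems(1-4)] by (intro tot_zero)
    next
      case False
      then obtain n' m' where nm: "n = Suc n'" "m = Suc m'" by (metis not0_implies_Suc)
      \<comment> \<open>Here W is the value of \<open>b\<close> and U its value after the function
        was inserted. Writing U as f W plus the commutator of \<open>b\<close> separates the two
        contributions.\<close>
      have sum: "c ((rem i Xs)[j - 1 := U]) x - f x * c ((rem i Xs)[j - 1 := W]) x =
          c ((rem i Xs)[j - 1 := (\<lambda>x. U x - f x *\<^sub>R W x)]) x + \<delta> (j - 1) f c ((rem i Xs)[j - 1 := W]) x"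
        if Xs: "Xs \<in> args E (Suc p)" and f: "f \<in> Cinf E" and UW: "U \<in> Sec E" "W \<in> Sec E" for Xs f U W x
      proof -
        have R: "rem i Xs \<in> args E p" using ij Xs by (intro rem_args) auto
        have V: "(\<lambda>x. U x - f x *\<^sub>R W x) \<in> Sec E"
          using Sec_diff[OF UW(1) Sec_fmult[OF f UW(2)]] by (simp add: fmult_def)
        have "U = (\<lambda>x. 1 *\<^sub>R fmult f W x + 1 *\<^sub>R (U x - f x *\<^sub>R W x))" by (simp add: fmult_def)
        then have "c ((rem i Xs)[j - 1 := U]) x =
            c ((rem i Xs)[j - 1 := fmult f W]) x + c ((rem i Xs)[j - 1 := (\<lambda>x. U x - f x *\<^sub>R W x)]) x"
          using slot_linearD[OF cb(1) R _ Sec_fmult[OF f UW(2)] V, of "j - 1" 1 1] ij by simp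
        then show ?thesis using ij by (simp add: \<delta>_def args_length[OF R])
      qed
      have "tot E (Suc p) r (\<delta> k f (subst i j c b))" if k: "k < Suc p" and f: "f \<in> Cinf E" for k f
      proof -
        have jp: "j - 1 < p" using ij by auto
        have c': "tot E (Suc p) r (subst i j (\<delta> l f c) b)" if "l < p" for l
          using Suc.prems nm f that by (intro Suc.IH[of _ _ n' m]) (auto intro: slot_linear_\<delta>)
        have b': "tot E (Suc p) r (subst i j c (\<delta> l f b))" if "l < 2" for l
          using Suc.prems nm f that by (intro Suc.IH[of _ _ n m']) (auto intro: Sec_\<delta>)
        consider "k = i" | "k = j" | "k \<noteq> i" "k \<noteq> j" by blast
        then show ?thesis
        proof cases
          case 1
          show ?thesis
          proof (rule tot_cong[OF _ tot_add[OF b'[of 0] c'[OF jp]]])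
            fix Xs assume Xs: "Xs \<in> args E (Suc p)"
            have X: "Xs ! i \<in> Sec E" "Xs ! j \<in> Sec E" using ij by (auto intro!: args_nth[OF Xs])
            show "(\<lambda>x. subst i j c (\<delta> 0 f b) Xs x + subst i j (\<delta> (j - 1) f c) b Xs x) = \<delta> k f (subst i j c b) Xs"
              using sum[OF Xs f cb(2)[OF args_2[OF Sec_fmult[OF f X(1)] X(2)]] cb(2)[OF args_2[OF X]]]
                1 ij k args_length[OF Xs]
              by (simp add: fun_eq_iff subst_def \<delta>_def[of i] \<delta>_def[of 0] rem_update_same)
          qed simp
        next
          case 2
          show ?thesis
          proof (rule tot_cong[OF _ tot_add[OF b'[of "Suc 0"] c'[OF jp]]])
            fix Xs assume Xs: "Xs \<in> args E (Suc p)"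
            have X: "Xs ! i \<in> Sec E" "Xs ! j \<in> Sec E" using ij by (auto intro!: args_nth[OF Xs])
            have "rem i (Xs[j := W]) = (rem i Xs)[j - 1 := W]" for W
              using rem_update(1)[of j i Xs W] ij args_length[OF Xs] by auto
            then show "(\<lambda>x. subst i j c (\<delta> (Suc 0) f b) Xs x + subst i j (\<delta> (j - 1) f c) b Xs x) = \<delta> k f (subst i j c b) Xs"
              using sum[OF Xs f cb(2)[OF args_2[OF X(1) Sec_fmult[OF f X(2)]]] cb(2)[OF args_2[OF X]]]
                2 ij k args_length[OF Xs]
              by (simp add: fun_eq_iff subst_def \<delta>_def[of j] \<delta>_def[of "Suc 0"])
          qed simp
        next
          case 3
          define l where "l = (if k < i then k else k - 1)"
          have kp: "l < p" "l \<noteq> j - 1" using 3 k ij by (auto simp: l_def)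
          show ?thesis
          proof (rule tot_cong[OF _ c'[OF kp(1)]])
            fix Xs assume Xs: "Xs \<in> args E (Suc p)"
            have u: "rem i (Xs[k := Z]) = (rem i Xs)[l := Z]" "rem i Xs ! l = Xs ! k" for Z
              using rem_update[of k i Xs, folded l_def] 3 k ij args_length[OF Xs] by auto
            show "subst i j (\<delta> l f c) b Xs = \<delta> k f (subst i j c b) Xs"
              using 3 kp by (simp add: subst_def \<delta>_def u list_update_swap[OF kp(2)])
          qed
        qed
      qed
      then show ?thesis by simp
    qed
  }
qed

lemma slot_linear_subst:
  assumes ij: "i < j" "j \<le> p" and c: "slot_linear E p c" and b: "slot_linear E 2 b"
    and bS: "\<And>Ys. Ys \<in> args E 2 \<Longrightarrow> b Ys \<in> Sec E"
  shows "slot_linear E (Suc p) (subst i j c b)"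
  unfolding slot_linear_def
proof (intro ballI allI impI)
  fix Xs k Y Z and r s :: real
  assume Xs: "Xs \<in> args E (Suc p)" and k: "k < Suc p" and YZ: "Y \<in> Sec E" "Z \<in> Sec E"
  have R: "rem i Xs \<in> args E p" using ij Xs by (intro rem_args) auto
  have X: "Xs ! i \<in> Sec E" "Xs ! j \<in> Sec E" using ij by (auto intro!: args_nth[OF Xs])
  have jp: "j - 1 < p" using ij by auto
  note len = args_length[OF Xs]
  consider "k = i" | "k = j" | "k \<noteq> i" "k \<noteq> j" by blast
  then show "subst i j c b (Xs[k := (\<lambda>x. r *\<^sub>R Y x + s *\<^sub>R Z x)]) =
      (\<lambda>x. r *\<^sub>R subst i j c b (Xs[k := Y]) x + s *\<^sub>R subst i j c b (Xs[k := Z]) x)"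
  proof cases
    case 1
    have "b [(\<lambda>x. r *\<^sub>R Y x + s *\<^sub>R Z x), Xs ! j] = (\<lambda>x. r *\<^sub>R b [Y, Xs ! j] x + s *\<^sub>R b [Z, Xs ! j] x)"
      using slot_linearD[OF b args_2[OF X] _ YZ, of 0 r s] by simp
    then show ?thesis
      using 1 ij len slot_linearD[OF c R jp bS[OF args_2[OF YZ(1) X(2)]] bS[OF args_2[OF YZ(2) X(2)]], of r s]
      by (simp add: subst_def rem_update_same)
  next
    case 2
    have u: "rem i (Xs[j := W]) = (rem i Xs)[j - 1 := W]" for W
      using rem_update(1)[of j i Xs W] ij len by auto
    have "b [Xs ! i, (\<lambda>x. r *\<^sub>R Y x + s *\<^sub>R Z x)] = (\<lambda>x. r *\<^sub>R b [Xs ! i, Y] x + s *\<^sub>R b [Xs ! i, Z] x)"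
      using slot_linearD[OF b args_2[OF X] _ YZ, of 1 r s] by (simp add: One_nat_def)
    then show ?thesis
      using 2 ij len slot_linearD[OF c R jp bS[OF args_2[OF X(1) YZ(1)]] bS[OF args_2[OF X(1) YZ(2)]], of r s]
      by (simp add: subst_def u)
  next
    case 3
    define l where "l = (if k < i then k else k - 1)"
    have kp: "l < p" "l \<noteq> j - 1" using 3 k ij by (auto simp: l_def)
    let ?W = "b [Xs ! i, Xs ! j]"
    have u: "subst i j c b (Xs[k := V]) = c ((rem i Xs)[j - 1 := ?W, l := V])" for V
      using 3 k ij len rem_update(1)[of k i Xs V, folded l_def]
      by (simp add: subst_def list_update_swap[OF kp(2)])
    show ?thesis unfolding u
      by (rule slot_linearD[OF c args_update[OF R bS[OF args_2[OF X]]] kp(1) YZ])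
  qed
qed

end

section \<open>The reduced shuffle algebra\<close>

lemma shuffle_zero_left: "((\<lambda>Ys y. 0) \<pitchfork> b) Xs x = 0"
  by (simp add: shuffle_def)

lemma shuffle_zero_right: "(a \<pitchfork> (\<lambda>Ys y. 0)) Xs x = 0"
  by (simp add: shuffle_def)

lemma shuffle_fn_left:
  fixes b :: "('m, 'v) cochain"
  shows "(fn f \<pitchfork> b) Xs x = f x * b Xs x"
proof (induction Xs arbitrary: b)
  case Nil
  then show ?case by (simp add: shuffle_Nil fn_def)
next
  case (Cons X Xs)
  have "ins X (fn f) = (\<lambda>Ys y. 0)" "par (fn f :: ('m, 'v) cochain) = fn f"
    by (auto simp: ins_def par_def fn_def fun_eq_iff)
  then show ?case using Cons by (simp add: shuffle_Cons shuffle_zero_left ins_def[of X b])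
qed

lemma shuffle_two:
  "(a \<pitchfork> b) [X, Y] x = a [X, Y] x * b [] x + a [X] x * b [Y] x - a [Y] x * b [X] x + a [] x * b [X, Y] x"
  by (simp add: shuffle_Cons shuffle_Nil ins_def par_def)

lemma shuffle_homogeneous_left:
  assumes "\<And>Ys. length Ys \<noteq> p \<Longrightarrow> a Ys = (\<lambda>x. 0)"
  shows "(a \<pitchfork> b) Xs x = (if p \<le> length Xs then shuffle_part p (length Xs - p) a b Xs x else 0)"
proof -
  have "shuffle_part r q a b Xs x = 0" if "r \<noteq> p" for r q
    using assms that by (simp add: shuffle_part_def)
  then have "(a \<pitchfork> b) Xs x = (\<Sum>r\<le>length Xs. if r = p then shuffle_part r (length Xs - r) a b Xs x else 0)"
    unfolding shuffle_eq_parts by (intro sum.cong) auto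
  then show ?thesis by (simp add: sum.delta)
qed

lemma shuffle_vanishes_outside:
  assumes "\<And>Ys. \<not> set Ys \<subseteq> S \<Longrightarrow> a Ys = (\<lambda>x. 0)" "\<And>Ys. \<not> set Ys \<subseteq> S \<Longrightarrow> b Ys = (\<lambda>x. 0)"
    "\<not> set Xs \<subseteq> S"
  shows "(a \<pitchfork> b) Xs x = 0"
  using assms
proof (induction Xs arbitrary: a b)
  case (Cons X Xs)
  show ?case
  proof (cases "X \<in> S")
    case True
    have "(ins X a \<pitchfork> b) Xs x = 0" "(par a \<pitchfork> ins X b) Xs x = 0"
      by (rule Cons.IH; use Cons.prems True in \<open>simp add: ins_def par_def\<close>)+
    then show ?thesis by (simp add: shuffle_Cons)
  next
    case False
    then have "ins X a = (\<lambda>Ys y. 0)" "ins X b = (\<lambda>Ys y. 0)"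
      using Cons.prems by (auto simp: ins_def)
    then show ?thesis by (simp add: shuffle_Cons shuffle_zero_left shuffle_zero_right)
  qed
qed simp

lemma (in cartan_calculus) dif_homogeneous:
  assumes "\<And>Ys. length Ys \<noteq> k \<Longrightarrow> c Ys = (\<lambda>x. 0)" "length Xs \<noteq> Suc k" "set Xs \<subseteq> S"
  shows "dif Xs c = (\<lambda>x. 0)"
  using assms
proof (induction Xs arbitrary: c k)
  case (Cons X Xs)
  have "Lie X c Xs = (\<lambda>x. 0)" using Cons.prems by (simp add: Lie_def \<rho>_zero)
  moreover have "dif Xs (ins X c) = (\<lambda>x. 0)"
  proof (cases k)
    case 0
    \<comment> \<open>Inserting into a cochain of degree 0 gives zero, which is homogeneous of every
      degree; \<open>length Xs\<close> is a degree that meets the length condition.\<close>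
    then show ?thesis using Cons.prems by (intro Cons.IH[where k = "length Xs"]) (auto simp: ins_def)
  next
    case (Suc j)
    then show ?thesis using Cons.prems by (intro Cons.IH[where k = j]) (auto simp: ins_def)
  qed
  ultimately show ?case by simp
qed simp

context smooth_vector_bundle
begin

text \<open>Order 0 in the last variable, stated for all lengths at once so that it passes to
  \<open>ins X c\<close> and to sums of several degrees.\<close>

definition last_linear :: "('m, 'v) cochain \<Rightarrow> bool" where
  "last_linear c \<longleftrightarrow> (\<forall>Xs Y f. set Xs \<subseteq> Sec E \<longrightarrow> Y \<in> Sec E \<longrightarrow> f \<in> Cinf E \<longrightarrow>
     c (Xs @ [fmult f Y]) = (\<lambda>x. f x * c (Xs @ [Y]) x))"

lemma last_linearD:
  assumes "last_linear c" "set Xs \<subseteq> Sec E" "Y \<in> Sec E" "f \<in> Cinf E"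
  shows "c (Xs @ [fmult f Y]) = (\<lambda>x. f x * c (Xs @ [Y]) x)"
  using assms(1)[unfolded last_linear_def, rule_format, OF assms(2-)] .

text \<open>Working form of membership: total order at most k - 1 is the annihilation count k.
  Degree 0 carries no such condition, since count 0 would force the element to vanish.\<close>

lemma reduced_ops_iff:
  "c \<in> reduced_ops E k \<longleftrightarrow> (\<forall>Xs. Xs \<notin> args E k \<longrightarrow> c Xs = (\<lambda>x. 0)) \<and> (\<forall>Xs\<in>args E k. c Xs \<in> Cinf E) \<and>
     slot_linear E k c \<and> last_linear c \<and> (k \<ge> 1 \<longrightarrow> tot E k k c)" (is "?L \<longleftrightarrow> ?R")
proof (cases k)
  case 0
  have ll: "last_linear c" if "\<forall>Xs. Xs \<notin> args E 0 \<longrightarrow> c Xs = (\<lambda>x. 0)"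
    using that by (simp add: last_linear_def args_def)
  have "args E 0 = {[]}" by (auto simp: args_def)
  then show ?thesis
    using 0 ll unfolding reduced_ops_def diff_ops_def multidifferential_def slot_linear_iff by auto
next
  case (Suc j)
  have t: "total_order_le E k j c \<longleftrightarrow> tot E k k c" by (simp add: Suc total_order_le_iff_tot)
  \<comment> \<open>The order bound in each separate variable follows from the total order.\<close>
  have m: "\<exists>r. \<forall>i<k. order_le E k i r c" if "total_order_le E k j c"
    using total_order_imp_order_le[OF that] by blast
  have o: "order_le E k j 0 c \<longleftrightarrow> last_linear c" if out: "\<forall>Xs. Xs \<notin> args E k \<longrightarrow> c Xs = (\<lambda>x. 0)"
  proof
    assume *: "order_le E k j 0 c"
    show "last_linear c"
      unfolding last_linear_def
    proof (intro allI impI)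
      fix Xs Y f assume h: "set Xs \<subseteq> Sec E" "Y \<in> Sec E" "f \<in> Cinf E"
      show "c (Xs @ [fmult f Y]) = (\<lambda>x. f x * c (Xs @ [Y]) x)"
      proof (cases "length Xs = j")
        case True
        then have "foldr (\<delta> j) [f] c (Xs @ [Y]) = (\<lambda>x. 0)"
          using *[unfolded order_le_def, rule_format, of "[f]" "Xs @ [Y]"] h Suc by (simp add: args_def)
        then show ?thesis by (simp add: \<delta>_def fun_eq_iff flip: True)
      next
        case False
        then have "Xs @ [fmult f Y] \<notin> args E k" "Xs @ [Y] \<notin> args E k" using Suc by (auto simp: args_def)
        then show ?thesis using out by simp
      qed
    qed
  next
    assume *: "last_linear c"
    show "order_le E k j 0 c"
      unfolding order_le_def
    proof (intro allI impI ballI)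
      fix fs Xs assume fs: "length fs = 0 + 1 \<and> set fs \<subseteq> Cinf E" and Xs: "Xs \<in> args E k"
      from fs obtain f where f: "fs = [f]" "f \<in> Cinf E" by (auto simp: One_nat_def length_Suc_conv)
      obtain Ys Y where Y: "Xs = Ys @ [Y]" using Xs Suc by (cases Xs rule: rev_cases) (auto simp: args_def)
      have "length Ys = j" using Xs Y Suc by (simp add: args_def)
      then show "foldr (\<delta> j) fs c Xs = (\<lambda>x. 0)"
        using last_linearD[OF *, of Ys Y f] Xs f Y by (auto simp: \<delta>_def args_def)
    qed
  qed
  show ?thesis
  proof
    assume ?L
    then show ?R using t o unfolding reduced_ops_def diff_ops_def multidifferential_def slot_linear_iff
      by (simp add: Suc One_nat_def)
  next
    assume ?R
    then show ?L using t o m unfolding reduced_ops_def diff_ops_def multidifferential_def slot_linear_iff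
      by (simp add: Suc One_nat_def)
  qed
qed

lemma
  assumes "c \<in> reduced_ops E k"
  shows reduced_outside: "Xs \<notin> args E k \<Longrightarrow> c Xs = (\<lambda>x. 0)"
    and reduced_Cinf: "set Xs \<subseteq> Sec E \<Longrightarrow> c Xs \<in> Cinf E"
    and reduced_slot_linear: "slot_linear E k c"
    and reduced_last_linear: "last_linear c"
    and reduced_tot: "k \<ge> 1 \<Longrightarrow> tot E k k c"
    and reduced_length: "length Xs \<noteq> k \<Longrightarrow> c Xs = (\<lambda>x. 0)"
proof -
  note * = assms[unfolded reduced_ops_iff]
  show "Xs \<notin> args E k \<Longrightarrow> c Xs = (\<lambda>x. 0)" "slot_linear E k c" "last_linear c" "k \<ge> 1 \<Longrightarrow> tot E k k c"
    using * by simp_all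
  show "length Xs \<noteq> k \<Longrightarrow> c Xs = (\<lambda>x. 0)" using * by (simp add: args_def)
  show "c Xs \<in> Cinf E" if "set Xs \<subseteq> Sec E"
    using * that Cinf_const[of 0] by (cases "Xs \<in> args E k") auto
qed

section \<open>Closure of the reduced operators under sums and products\<close>

lemma reduced_lin:
  assumes "a \<in> reduced_ops E k" "b \<in> reduced_ops E k"
  shows "(\<lambda>Xs x. r * a Xs x + s * b Xs x) \<in> reduced_ops E k"
proof -
  have "last_linear (\<lambda>Xs x. r * a Xs x + s * b Xs x)"
    using assms[THEN reduced_last_linear] by (simp add: last_linear_def algebra_simps)
  moreover have "(\<lambda>x. r * a Xs x + s * b Xs x) \<in> Cinf E" if "Xs \<in> args E k" for Xs
    using assms that by (intro Cinf_add Cinf_mult Cinf_const) (auto intro: reduced_Cinf simp: args_def)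
  ultimately show ?thesis
    using assms slot_linear_lin[OF assms[THEN reduced_slot_linear], of r s]
      tot_lin[OF assms[THEN reduced_tot], of r s]
    by (simp add: reduced_ops_iff)
qed

lemma reduced_zero: "(\<lambda>Xs x. 0) \<in> reduced_ops E k"
  unfolding reduced_ops_iff
  by (auto simp: Cinf_const slot_linear_zero_fun last_linear_def intro: tot_zero)

lemma fn_reduced: "f \<in> Cinf E \<Longrightarrow> fn f \<in> reduced_ops E 0"
  by (simp add: reduced_ops_iff fn_def args_def slot_linear_def last_linear_def)

lemma reduced_0_eq_fn: "c \<in> reduced_ops E 0 \<Longrightarrow> c = fn (c []) \<and> c [] \<in> Cinf E"
  using reduced_length[of c 0] reduced_Cinf[of c 0 "[]"] by (auto simp: fn_def fun_eq_iff)

lemma component_reduced: "c \<in> reduced_ops E p \<Longrightarrow> component q c = (if q = p then c else (\<lambda>Xs x. 0))"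
  using reduced_length by (auto simp: component_def fun_eq_iff)

lemma reduced_subset: "c \<in> reduced_ops E p \<Longrightarrow> c \<in> reduced_shuffle E"
  unfolding reduced_shuffle_def by (auto simp: component_reduced reduced_zero)

lemma shuffle_component: "c \<in> reduced_shuffle E \<Longrightarrow> component p c \<in> reduced_ops E p"
  unfolding reduced_shuffle_def by blast

lemma component_eq: "component (length Xs) c Xs = c Xs"
  by (simp add: component_def)

lemma
  assumes c: "c \<in> reduced_shuffle E"
  shows rs_outside: "\<not> set Xs \<subseteq> Sec E \<Longrightarrow> c Xs = (\<lambda>x. 0)"
    and rs_Cinf: "set Xs \<subseteq> Sec E \<Longrightarrow> c Xs \<in> Cinf E"
proof -
  show "\<not> set Xs \<subseteq> Sec E \<Longrightarrow> c Xs = (\<lambda>x. 0)"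
    using reduced_outside[OF shuffle_component[OF c], of Xs "length Xs"] by (simp add: component_eq args_def)
  show "set Xs \<subseteq> Sec E \<Longrightarrow> c Xs \<in> Cinf E"
    using reduced_Cinf[OF shuffle_component[OF c], of Xs "length Xs"] by (simp add: component_eq)
qed

lemma rs_slot_add:
  assumes c: "c \<in> reduced_shuffle E" and h: "set Ys \<subseteq> Sec E" "set Zs \<subseteq> Sec E" "Y \<in> Sec E" "Z \<in> Sec E"
  shows "c (Ys @ (\<lambda>x. Y x + Z x) # Zs) = (\<lambda>x. c (Ys @ Y # Zs) x + c (Ys @ Z # Zs) x)"
proof -
  let ?n = "length (Ys @ Y # Zs)"
  have "Ys @ Y # Zs \<in> args E ?n" using h by (simp add: args_def)
  from slot_linearD[OF reduced_slot_linear[OF shuffle_component[OF c]] this, of "length Ys" Y Z 1 1] h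
  show ?thesis by (simp add: component_def)
qed

lemma rs_lin:
  assumes "a \<in> reduced_shuffle E" "b \<in> reduced_shuffle E"
  shows "(\<lambda>Xs x. r * a Xs x + s * b Xs x) \<in> reduced_shuffle E"
proof -
  have eq: "component p (\<lambda>Xs x. r * a Xs x + s * b Xs x) = (\<lambda>Xs x. r * component p a Xs x + s * component p b Xs x)" for p
    by (auto simp: component_def fun_eq_iff)
  have "{p. component p (\<lambda>Xs x. r * a Xs x + s * b Xs x) \<noteq> (\<lambda>Xs x. 0)}
      \<subseteq> {p. component p a \<noteq> (\<lambda>Xs x. 0)} \<union> {p. component p b \<noteq> (\<lambda>Xs x. 0)}"
    unfolding eq by auto
  moreover have "finite ({p. component p a \<noteq> (\<lambda>Xs x. 0)} \<union> {p. component p b \<noteq> (\<lambda>Xs x. 0)})"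
    using assms unfolding reduced_shuffle_def by blast
  ultimately have "finite {p. component p (\<lambda>Xs x. r * a Xs x + s * b Xs x) \<noteq> (\<lambda>Xs x. 0)}"
    by (rule finite_subset)
  moreover have "component p (\<lambda>Xs x. r * a Xs x + s * b Xs x) \<in> reduced_ops E p" for p
    unfolding eq using assms by (intro reduced_lin shuffle_component)
  ultimately show ?thesis unfolding reduced_shuffle_def by blast
qed

lemma last_linear_ins: "last_linear c \<Longrightarrow> X \<in> Sec E \<Longrightarrow> last_linear (ins X c)"
  unfolding last_linear_def[of "ins X c"] using last_linearD[of c "X # _"] by (simp add: ins_def)

lemma last_linear_par: "last_linear c \<Longrightarrow> last_linear (par c)"
  unfolding last_linear_def par_def by (simp add: mult.left_commute)

lemma last_linear_shuffle:
  assumes "last_linear a" "last_linear b"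
  shows "last_linear (a \<pitchfork> b)"
proof -
  have "(a \<pitchfork> b) (Xs @ [fmult f Y]) x = f x * (a \<pitchfork> b) (Xs @ [Y]) x"
    if "last_linear a" "last_linear b" "set Xs \<subseteq> Sec E" "Y \<in> Sec E" "f \<in> Cinf E" for a b Xs Y f x
    using that
  proof (induction Xs arbitrary: a b)
    case Nil
    then show ?case
      using last_linearD[of a "[]" Y f] last_linearD[of b "[]" Y f]
      by (simp add: shuffle_Cons shuffle_Nil ins_def par_def algebra_simps)
  next
    case (Cons X Xs)
    then show ?case by (simp add: shuffle_Cons last_linear_ins last_linear_par distrib_left)
  qed
  then show ?thesis unfolding last_linear_def[of "a \<pitchfork> b"] using assms by (simp add: fun_eq_iff)
qed

text \<open>Smoothness of the values enters as a hypothesis because it is proved in the abstract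
  calculus, as closure of \<open>good\<close> under products.\<close>

lemma reduced_shuffle_homogeneous:
  assumes a: "a \<in> reduced_ops E p" and b: "b \<in> reduced_ops E q" and good: "\<And>Xs. set Xs \<subseteq> Sec E \<Longrightarrow> (a \<pitchfork> b) Xs \<in> Cinf E"
  shows "a \<pitchfork> b \<in> reduced_ops E (p + q)"
proof -
  have bS: "\<not> set Ys \<subseteq> Sec E \<Longrightarrow> b Ys = (\<lambda>x. 0)" and aS: "\<not> set Ys \<subseteq> Sec E \<Longrightarrow> a Ys = (\<lambda>x. 0)" for Ys
    using reduced_outside[OF a, of Ys] reduced_outside[OF b, of Ys] by (auto simp: args_def)
  have part: "(a \<pitchfork> b) Xs x = (if p \<le> length Xs then shuffle_part p (length Xs - p) a b Xs x else 0)" for Xs x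
    by (rule shuffle_homogeneous_left) (rule reduced_length[OF a])
  have out: "(a \<pitchfork> b) Xs = (\<lambda>x. 0)" if "Xs \<notin> args E (p + q)" for Xs
  proof (cases "set Xs \<subseteq> Sec E")
    case True
    then have "length Xs \<noteq> p + q" using that by (simp add: args_def)
    then have "shuffle_part p (length Xs - p) a b Xs x = 0" if "p \<le> length Xs" for x
      using that reduced_length[OF b] by (simp add: shuffle_part_def)
    then show ?thesis by (simp add: fun_eq_iff part)
  next
    case False
    show ?thesis by (rule ext, rule shuffle_vanishes_outside[where S = "Sec E"]) (simp_all add: aS bS False)
  qed
  have eq: "(\<lambda>x. \<Sum>\<sigma>\<in>sh p q. of_int (sign \<sigma>) *\<^sub>R part_prod p q \<sigma> a b Xs x) = (a \<pitchfork> b) Xs"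
    if "Xs \<in> args E (p + q)" for Xs
    using args_length[OF that]
    by (simp add: fun_eq_iff part shuffle_part_def part_prod_def lpart_def rpart_def mult.assoc)
  have perm: "\<sigma> permutes {..<p + q}" if "\<sigma> \<in> sh p q" for \<sigma> using that by (simp add: sh_def)
  have "slot_linear E (p + q) (\<lambda>Xs x. \<Sum>\<sigma>\<in>sh p q. of_int (sign \<sigma>) *\<^sub>R part_prod p q \<sigma> a b Xs x)"
    by (intro slot_linear_sum slot_linear_scale slot_linear_part_prod perm reduced_slot_linear[OF a] reduced_slot_linear[OF b])
  then have sl: "slot_linear E (p + q) (a \<pitchfork> b)" by (rule slot_linear_cong[rotated]) (rule eq)
  have t: "tot E (p + q) (p + q) (a \<pitchfork> b)" if pq: "p + q \<ge> 1"
  proof -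
    \<comment> \<open>A function has no slots, so count 1 holds vacuously. Using at least 1 for each
      factor still meets the bound p + q + 1 on the sum of counts, as one of the degrees is
      positive.\<close>
    have v: "tot E 0 1 c" for c :: "('m, 'v) cochain" by (simp add: One_nat_def)
    have "tot E p (max p 1) a" "tot E q (max q 1) b"
      using reduced_tot[OF a] reduced_tot[OF b] v by (cases p; cases q; simp add: One_nat_def)+
    then have "tot E (p + q) (p + q) (part_prod p q \<sigma> a b)" if "\<sigma> \<in> sh p q" for \<sigma>
      using pq by (intro tot_part_prod[OF perm[OF that], of "max p 1" a "max q 1" b]) auto
    then have "tot E (p + q) (p + q) (\<lambda>Xs x. \<Sum>\<sigma>\<in>sh p q. of_int (sign \<sigma>) *\<^sub>R part_prod p q \<sigma> a b Xs x)"
      by (intro tot_sum tot_scale)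
    then show ?thesis by (rule tot_cong[rotated]) (rule eq)
  qed
  show ?thesis
    unfolding reduced_ops_iff using out good sl t last_linear_shuffle[OF reduced_last_linear[OF a] reduced_last_linear[OF b]]
    by (auto simp: args_def)
qed

end

section \<open>The Loday differential\<close>

text \<open>The anchor is a parameter because in rank 0 the bracket does not determine it. The added
  axioms control how anchor and bracket depend on their arguments over functions, which is what the
  order conditions on the differential require.\<close>

locale loday_structure = smooth_vector_bundle E + cartan_calculus "Sec E" "Cinf E" B \<rho>
  for E :: "('m::{t2_space,second_countable_topology}, 'e::real_inner, 'v::real_vector, 'f::real_inner) vbundle"
    and B \<rho> +
  assumes \<rho>_fmult: "X \<in> Sec E \<Longrightarrow> f \<in> Cinf E \<Longrightarrow> g \<in> Cinf E \<Longrightarrow> \<rho> (fmult f X) g = (\<lambda>x. f x * \<rho> X g x)"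
    and \<rho>_slot: "X \<in> Sec E \<Longrightarrow> Y \<in> Sec E \<Longrightarrow> g \<in> Cinf E \<Longrightarrow>
      \<rho> (\<lambda>x. r *\<^sub>R X x + s *\<^sub>R Y x) g = (\<lambda>x. r * \<rho> X g x + s * \<rho> Y g x)"
    and B_fmult: "X \<in> Sec E \<Longrightarrow> Y \<in> Sec E \<Longrightarrow> f \<in> Cinf E \<Longrightarrow>
      B X (fmult f Y) = (\<lambda>x. f x *\<^sub>R B X Y x + \<rho> X f x *\<^sub>R Y x)"
    and B_slot: "slot_linear E 2 (\<lambda>Xs. B (Xs ! 0) (Xs ! 1))"
    and B_tot: "tot E 2 2 (\<lambda>Xs. B (Xs ! 0) (Xs ! 1))"
    and B_outside: "\<not> (X \<in> Sec E \<and> Y \<in> Sec E) \<Longrightarrow> B X Y = (\<lambda>x. 0)"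
begin

text \<open>The anchor costs one order: a commutator outside slot i produces, by the Leibniz rule,
  the derivative of f times \<open>c\<close>, which is no worse than \<open>c\<close>. In slot i it
  vanishes since the anchor is function-linear.\<close>

lemma tot_anchor:
  assumes i: "i \<le> p"
  shows "(\<And>Ys. Ys \<in> args E p \<Longrightarrow> c Ys \<in> Cinf E) \<Longrightarrow> tot E p n c \<Longrightarrow>
    tot E (Suc p) (Suc n) (\<lambda>Xs. \<rho> (Xs ! i) (c (rem i Xs)))"
proof (induction n arbitrary: c)
  case 0
  show ?case
    by (rule tot_zero) (use 0 i in \<open>simp add: rem_args \<rho>_zero args_nth\<close>)
next
  case (Suc n)
  let ?T = "\<lambda>c Xs. \<rho> (Xs ! i) (c (rem i Xs))"
  have "tot E (Suc p) (Suc n) (\<delta> j f (?T c))" if j: "j < Suc p" and f: "f \<in> Cinf E" for j f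
  proof (cases "j = i")
    case True
    show ?thesis
      by (rule tot_zero)
        (use True j f i Suc.prems(1) in \<open>simp add: \<delta>_def rem_update_same args_length args_nth rem_args \<rho>_fmult\<close>)
  next
    case False
    define l where "l = (if j < i then j else j - 1)"
    have l: "l < p" using False i j by (auto simp: l_def)
    have 1: "tot E (Suc p) (Suc n) (?T (\<delta> l f c))"
      using Suc.prems l f by (intro Suc.IH Cinf_\<delta>) auto
    have 2: "tot E (Suc p) (Suc n) (\<lambda>Xs x. \<rho> (Xs ! i) f x * c (rem i Xs) x)"
      by (rule tot_pointwise_mult[where h = "\<lambda>X. \<rho> X f"]) (use f i Suc.prems(2) in \<open>auto simp: \<rho>_fmult\<close>)
    show ?thesis
    proof (rule tot_cong[OF _ tot_add[OF 1 2]])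
      fix Xs assume Xs: "Xs \<in> args E (Suc p)"
      have u: "rem i (Xs[j := Z]) = (rem i Xs)[l := Z]" "rem i Xs ! l = Xs ! j" for Z
        using rem_update[of j i Xs, folded l_def] False i j args_length[OF Xs] by auto
      have X: "Xs ! i \<in> Sec E" "Xs ! j \<in> Sec E" using i j by (auto intro!: args_nth[OF Xs])
      have R: "rem i Xs \<in> args E p" using rem_args[OF Xs i] .
      let ?c = "c (rem i Xs)" and ?c' = "c ((rem i Xs)[l := fmult f (Xs ! j)])"
      have cc: "?c \<in> Cinf E" "?c' \<in> Cinf E"
        using Suc.prems(1) R args_update[OF R Sec_fmult[OF f X(2)]] by auto
      have "\<rho> (Xs ! i) (\<lambda>x. 1 * ?c' x + (- 1) * (f x * ?c x))
          = (\<lambda>x. 1 * \<rho> (Xs ! i) ?c' x + (- 1) * \<rho> (Xs ! i) (\<lambda>x. f x * ?c x) x)"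
        by (rule \<rho>_lin[OF X(1) cc(2) Cinf_mult[OF f cc(1)]])
      then show "(\<lambda>x. ?T (\<delta> l f c) Xs x + \<rho> (Xs ! i) f x * c (rem i Xs) x) = \<delta> j f (?T c) Xs"
        using False by (simp add: \<delta>_def u \<rho>_mult[OF X(1) f cc(1)] fun_eq_iff)
    qed
  qed
  then show ?case by simp
qed

lemma slot_linear_anchor:
  assumes i: "i \<le> p" and cC: "\<And>Ys. Ys \<in> args E p \<Longrightarrow> c Ys \<in> Cinf E" and c: "slot_linear E p c"
  shows "slot_linear E (Suc p) (\<lambda>Xs. \<rho> (Xs ! i) (c (rem i Xs)))"
  unfolding slot_linear_def
proof (intro ballI allI impI)
  fix Xs j Y Z and r s :: real
  assume Xs: "Xs \<in> args E (Suc p)" and j: "j < Suc p" and YZ: "Y \<in> Sec E" "Z \<in> Sec E"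
  have R: "rem i Xs \<in> args E p" using rem_args[OF Xs i] .
  have X: "Xs ! i \<in> Sec E" using i by (auto intro!: args_nth[OF Xs])
  note len = args_length[OF Xs]
  let ?T = "\<lambda>Xs. \<rho> (Xs ! i) (c (rem i Xs))"
  show "?T (Xs[j := (\<lambda>x. r *\<^sub>R Y x + s *\<^sub>R Z x)]) = (\<lambda>x. r *\<^sub>R ?T (Xs[j := Y]) x + s *\<^sub>R ?T (Xs[j := Z]) x)"
  proof (cases "j = i")
    case True
    then show ?thesis using j len cC[OF R] by (simp add: rem_update_same \<rho>_slot[OF YZ])
  next
    case False
    define l where "l = (if j < i then j else j - 1)"
    have l: "l < p" using False i j by (auto simp: l_def)
    have u: "rem i (Xs[j := Z]) = (rem i Xs)[l := Z]" for Z
      using rem_update[of j i Xs, folded l_def] False i j len by auto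
    show ?thesis
      using False slot_linearD[OF c R l YZ, of r s]
        \<rho>_lin[OF X cC[OF args_update[OF R YZ(1)]] cC[OF args_update[OF R YZ(2)]], where r = r and s = s]
      by (simp add: u)
  qed
qed

text \<open>The alternating sum over i of anchor terms minus bracket terms with i < j, arranged so
  that the estimates for sums, multiples and substitutions apply to it directly.\<close>

lemma dif_expand:
  assumes "length Xs = Suc p"
  shows "dif Xs c = (\<lambda>y. \<Sum>i<Suc p. (- 1) ^ i *\<^sub>R (\<rho> (Xs ! i) (c (rem i Xs)) y
      + (- 1) *\<^sub>R (\<Sum>j<p - i. subst i (Suc i + j) c (\<lambda>Xs. B (Xs ! 0) (Xs ! 1)) Xs y)))"
proof
  fix y
  have "Lie (Xs ! i) (\<lambda>Zs. c (take i Xs @ Zs)) (drop (Suc i) Xs) y = \<rho> (Xs ! i) (c (rem i Xs)) y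
      - (\<Sum>j<p - i. subst i (Suc i + j) c (\<lambda>Xs. B (Xs ! 0) (Xs ! 1)) Xs y)" if "i < Suc p" for i
  proof -
    have "c (take i Xs @ (drop (Suc i) Xs)[j := B (Xs ! i) (drop (Suc i) Xs ! j)])
        = subst i (Suc i + j) c (\<lambda>Xs. B (Xs ! 0) (Xs ! 1)) Xs" if "j < p - i" for j
      using that assms by (simp add: subst_def rem_def list_update_append One_nat_def)
    then show ?thesis using assms by (simp add: Lie_def rem_def)
  qed
  then show "dif Xs c y = (\<Sum>i<Suc p. (- 1) ^ i *\<^sub>R (\<rho> (Xs ! i) (c (rem i Xs)) y
      + (- 1) *\<^sub>R (\<Sum>j<p - i. subst i (Suc i + j) c (\<lambda>Xs. B (Xs ! 0) (Xs ! 1)) Xs y)))"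
    unfolding dif_eq_sum assms by (intro sum.cong) auto
qed

text \<open>The term with the derivative of f coming from the anchor acting on the value of
  \<open>c\<close> cancels against the one coming from \<open>B X\<close> acting on the last
  argument.\<close>

lemma Lie_last_linear:
  assumes c: "last_linear c" "madd c" "good c" and X: "X \<in> Sec E" and Xs: "set Xs \<subseteq> Sec E" "Y \<in> Sec E" "f \<in> Cinf E"
  shows "Lie X c (Xs @ [fmult f Y]) x = f x * Lie X c (Xs @ [Y]) x"
proof -
  have cC: "c (Xs @ [Y]) \<in> Cinf E" using goodD[OF c(3)] Xs by simp
  have 1: "\<rho> X (c (Xs @ [fmult f Y])) x = \<rho> X f x * c (Xs @ [Y]) x + f x * \<rho> X (c (Xs @ [Y])) x"
    using last_linearD[OF c(1) Xs] \<rho>_mult[OF X Xs(3) cC] by simp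
  have eq: "fmult f (B X Y) = (\<lambda>x. f x *\<^sub>R B X Y x)" "fmult (\<rho> X f) Y = (\<lambda>x. \<rho> X f x *\<^sub>R Y x)"
    by (simp_all add: fmult_def)
  have BS: "B X Y \<in> Sec E" "\<rho> X f \<in> Cinf E" using X Xs by (simp_all add: B_closed \<rho>_closed)
  have "c (Xs @ [B X (fmult f Y)]) = c (Xs @ (\<lambda>x. fmult f (B X Y) x + fmult (\<rho> X f) Y x) # [])"
    unfolding B_fmult[OF X Xs(2,3)] eq by simp
  also have "\<dots> = (\<lambda>x. c (Xs @ [fmult f (B X Y)]) x + c (Xs @ [fmult (\<rho> X f) Y]) x)"
    using BS Xs by (intro madd_append[OF c(2)] Sec_fmult) auto
  finally have 2: "c (Xs @ [B X (fmult f Y)]) x = f x * c (Xs @ [B X Y]) x + \<rho> X f x * c (Xs @ [Y]) x"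
    using last_linearD[OF c(1) Xs(1) BS(1) Xs(3)] last_linearD[OF c(1) Xs(1,2) BS(2)] by simp
  have 3: "c (Xs[j := B X (Xs ! j)] @ [fmult f Y]) x = f x * c (Xs[j := B X (Xs ! j)] @ [Y]) x" if "j < length Xs" for j
  proof -
    have "B X (Xs ! j) \<in> Sec E" using that Xs X by (intro B_closed) auto
    then have "set (Xs[j := B X (Xs ! j)]) \<subseteq> Sec E" using Xs(1) by (intro set_update_subset)
    from last_linearD[OF c(1) this Xs(2,3)] show ?thesis by simp
  qed
  have e: "Lie X c (Xs @ [W]) x = \<rho> X (c (Xs @ [W])) x - (\<Sum>j<length Xs. c (Xs[j := B X (Xs ! j)] @ [W]) x) - c (Xs @ [B X W]) x" for W
    unfolding Lie_def by (simp add: list_update_append nth_append)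
  show ?thesis unfolding e 1 2 using 3 by (simp add: sum_distrib_left algebra_simps)
qed

text \<open>When a single argument is left, only the anchor in the direction of that argument
  remains, and it is function-linear there.\<close>

lemma dif_last_linear:
  assumes "last_linear c" "madd c" "good c" "set Xs \<subseteq> Sec E" "Y \<in> Sec E" "f \<in> Cinf E"
  shows "dif (Xs @ [fmult f Y]) c x = f x * dif (Xs @ [Y]) c x"
  using assms
proof (induction Xs arbitrary: c)
  case Nil
  have "c [] \<in> Cinf E" using goodD[OF Nil(3)] by simp
  then show ?case using Nil by (simp add: Lie_def \<rho>_fmult)
next
  case (Cons X Xs)
  then have "dif (Xs @ [fmult f Y]) (ins X c) x = f x * dif (Xs @ [Y]) (ins X c) x"
    by (intro Cons.IH last_linear_ins madd_ins good_ins) auto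
  then show ?case using Lie_last_linear[OF Cons.prems(1-3), of X Xs Y f x] Cons.prems by (simp add: algebra_simps)
qed

lemma rs_good: "c \<in> reduced_shuffle E \<Longrightarrow> good c"
  unfolding good_def using rs_Cinf by blast

lemma rs_madd: "c \<in> reduced_shuffle E \<Longrightarrow> madd c"
  unfolding madd_def using rs_slot_add by blast

text \<open>Two conventions meet here: elements of the algebra vanish on lists that are not made of
  sections, and derivations are \<open>undefined\<close> outside the algebra.\<close>

definition ce_field :: "('m, 'v) cochain \<Rightarrow> ('m, 'v) cochain" where
  "ce_field c = (if c \<in> reduced_shuffle E then (\<lambda>Xs. if set Xs \<subseteq> Sec E then dif Xs c else (\<lambda>x. 0)) else undefined)"

lemma ce_field_Sec: "c \<in> reduced_shuffle E \<Longrightarrow> set Xs \<subseteq> Sec E \<Longrightarrow> ce_field c Xs = dif Xs c"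
  by (simp add: ce_field_def)

lemma ce_field_reduced:
  assumes c: "c \<in> reduced_ops E k"
  shows "ce_field c \<in> reduced_ops E (Suc k)"
proof -
  note crs = reduced_subset[OF c]
  have f: "ce_field c = (\<lambda>Xs. if set Xs \<subseteq> Sec E then dif Xs c else (\<lambda>x. 0))"
    using crs by (simp add: ce_field_def)
  have out: "ce_field c Xs = (\<lambda>x. 0)" if "Xs \<notin> args E (Suc k)" for Xs
    using that dif_homogeneous[OF reduced_length[OF c], where Xs = Xs] by (auto simp: f args_def)
  have val: "ce_field c Xs \<in> Cinf E" if "Xs \<in> args E (Suc k)" for Xs
    using that dif_in_A[OF rs_good[OF crs]] by (simp add: f args_def)
  have cC: "c Ys \<in> Cinf E" if "Ys \<in> args E k" for Ys using that reduced_Cinf[OF c] by (simp add: args_def)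
  have bS: "B (Ys ! 0) (Ys ! 1) \<in> Sec E" if "Ys \<in> args E 2" for Ys
    using that by (intro B_closed args_nth[OF that]) auto
  let ?D = "\<lambda>Xs y. \<Sum>i<Suc k. (- 1) ^ i *\<^sub>R (\<rho> (Xs ! i) (c (rem i Xs)) y
      + (- 1) *\<^sub>R (\<Sum>j<k - i. subst i (Suc i + j) c (\<lambda>Xs. B (Xs ! 0) (Xs ! 1)) Xs y))"
  have eq: "?D Xs = ce_field c Xs" if "Xs \<in> args E (Suc k)" for Xs
    using that dif_expand[of Xs k c] by (simp add: f args_def del: sum.lessThan_Suc)
  have "slot_linear E (Suc k) ?D"
  proof (intro slot_linear_sum slot_linear_scale slot_linear_lin[where a = 1, simplified scaleR_one])
    fix i assume "i \<in> {..<Suc k}"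
    then show "slot_linear E (Suc k) (\<lambda>Xs. \<rho> (Xs ! i) (c (rem i Xs)))"
      by (intro slot_linear_anchor cC reduced_slot_linear[OF c]) auto
    show "slot_linear E (Suc k) (subst i (Suc i + j) c (\<lambda>Xs. B (Xs ! 0) (Xs ! 1)))" if "j \<in> {..<k - i}" for j
      using that by (intro slot_linear_subst reduced_slot_linear[OF c] B_slot bS) auto
  qed
  then have sl: "slot_linear E (Suc k) (ce_field c)" by (rule slot_linear_cong[rotated]) (rule eq)
  have ll: "last_linear (ce_field c)"
    unfolding last_linear_def
    using dif_last_linear[OF reduced_last_linear[OF c] rs_madd[OF crs] rs_good[OF crs]]
    by (simp add: f Sec_fmult fun_eq_iff)
  \<comment> \<open>In degree 0 there is no bound to start from; the differential of a function has
    total order 0 because its only argument is also its last.\<close>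
  have t: "tot E (Suc k) (Suc k) (ce_field c)"
  proof (cases "k = 0")
    case True
    have "\<delta> 0 g (ce_field c) [Y] = (\<lambda>x. 0)" if "g \<in> Cinf E" "Y \<in> Sec E" for g Y
      using last_linearD[OF ll, of "[]" Y g] that by (simp add: \<delta>_def)
    then show ?thesis using True by (auto simp: args_def length_Suc_conv)
  next
    case False
    then have tc: "tot E k k c" using reduced_tot[OF c] by simp
    \<comment> \<open>The counts fit exactly: the anchor raises k to k + 1, and substituting the
      bracket of count 2 gives k + 2 - 1.\<close>
    have "tot E (Suc k) (Suc k) ?D"
    proof (intro tot_sum tot_scale tot_add)
      fix i assume "i \<in> {..<Suc k}"
      then show "tot E (Suc k) (Suc k) (\<lambda>Xs. \<rho> (Xs ! i) (c (rem i Xs)))"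
        by (intro tot_anchor cC tc) auto
      show "tot E (Suc k) (Suc k) (subst i (Suc i + j) c (\<lambda>Xs. B (Xs ! 0) (Xs ! 1)))" if "j \<in> {..<k - i}" for j
        using that by (intro tot_subst[OF _ _ reduced_slot_linear[OF c] bS tc B_tot]) auto
    qed
    then show ?thesis by (rule tot_cong[rotated]) (rule eq)
  qed
  show ?thesis unfolding reduced_ops_iff using out val sl ll t by blast
qed

text \<open>Each component of the differential sees one component of \<open>c\<close>, which reduces
  membership in the direct sum to the homogeneous case.\<close>

lemma component_ce_field:
  assumes c: "c \<in> reduced_shuffle E"
  shows "component (Suc p) (ce_field c) = ce_field (component p c)" "component 0 (ce_field c) = (\<lambda>Xs x. 0)"
proof -
  have pc: "component p c \<in> reduced_shuffle E" using reduced_subset[OF shuffle_component[OF c]] .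
  show "component (Suc p) (ce_field c) = ce_field (component p c)"
  proof
    fix Xs
    show "component (Suc p) (ce_field c) Xs = ce_field (component p c) Xs"
    proof (cases "set Xs \<subseteq> Sec E")
      case S: True
      show ?thesis
      proof (cases "length Xs = Suc p")
        case True
        then have "rem i Xs \<in> args E p" if "i < Suc p" for i
          using that S by (intro rem_args) (auto simp: args_def)
        then have r: "length (rem i Xs) = p" if "i < Suc p" for i using that args_length by blast
        then have "dif Xs (component p c) = dif Xs c"
          unfolding dif_expand[OF True]
          by (intro ext sum.cong arg_cong2[where f = scaleR] arg_cong2[where f = "(+)"] refl) (simp_all add: component_def subst_def)
        then show ?thesis using S True c pc by (simp add: component_def[of "Suc p"] ce_field_Sec)
      next
        case False
        have "dif Xs (component p c) = (\<lambda>x. 0)"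
          by (rule dif_homogeneous[OF _ False S]) (simp add: component_def)
        then show ?thesis using S False pc by (simp add: component_def[of "Suc p"] ce_field_Sec)
      qed
    next
      case False
      then show ?thesis using c pc by (simp add: component_def[of "Suc p"] ce_field_def)
    qed
  qed
  show "component 0 (ce_field c) = (\<lambda>Xs x. 0)"
    using c by (auto simp: component_def ce_field_def fun_eq_iff)
qed

lemma ce_field_zero: "ce_field (\<lambda>Xs x. 0) = (\<lambda>Xs x. 0)"
proof
  fix Xs
  show "ce_field (\<lambda>Xs x. 0) Xs = (\<lambda>x. 0)"
  proof (cases "set Xs \<subseteq> Sec E")
    case True
    have "dif Xs (\<lambda>Xs x. 0) = (\<lambda>x. 0)" by (rule dif_homogeneous[of "length Xs"]) (use True in auto)
    then show ?thesis using True reduced_subset[OF reduced_zero] by (simp add: ce_field_Sec)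
  next
    case False
    then show ?thesis using reduced_subset[OF reduced_zero] by (simp add: ce_field_def)
  qed
qed

lemma ce_field_rs:
  assumes c: "c \<in> reduced_shuffle E"
  shows "ce_field c \<in> reduced_shuffle E"
proof -
  have "component p (ce_field c) \<in> reduced_ops E p" for p
    using component_ce_field[OF c] ce_field_reduced[OF shuffle_component[OF c]] reduced_zero
    by (cases p) auto
  moreover have "{p. component p (ce_field c) \<noteq> (\<lambda>Xs x. 0)} \<subseteq> Suc ` {p. component p c \<noteq> (\<lambda>Xs x. 0)}"
  proof
    fix p assume "p \<in> {p. component p (ce_field c) \<noteq> (\<lambda>Xs x. 0)}"
    then show "p \<in> Suc ` {p. component p c \<noteq> (\<lambda>Xs x. 0)}"
      using component_ce_field[OF c] ce_field_zero by (cases p) auto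
  qed
  moreover have "finite (Suc ` {p. component p c \<noteq> (\<lambda>Xs x. 0)})"
    using c unfolding reduced_shuffle_def by blast
  ultimately show ?thesis unfolding reduced_shuffle_def using finite_subset by blast
qed

lemma shuffle_rs:
  assumes a: "a \<in> reduced_ops E p" and b: "b \<in> reduced_shuffle E"
  shows "a \<pitchfork> b \<in> reduced_shuffle E"
proof -
  \<comment> \<open>The left factor has degree p, so degree n of the product involves degree n - p
    of the right factor only.\<close>
  have comp: "component n (a \<pitchfork> b) = (if p \<le> n then a \<pitchfork> component (n - p) b else (\<lambda>Xs x. 0))" for n
  proof (intro ext)
    fix Xs x
    have h: "(a \<pitchfork> d) Xs x = (if p \<le> length Xs then shuffle_part p (length Xs - p) a d Xs x else 0)" for d
      by (rule shuffle_homogeneous_left) (rule reduced_length[OF a])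
    show "component n (a \<pitchfork> b) Xs x = (if p \<le> n then a \<pitchfork> component (n - p) b else (\<lambda>Xs x. 0)) Xs x"
    proof (cases "length Xs = n")
      case True
      then show ?thesis by (simp add: component_def h shuffle_part_def)
    next
      case False
      have "(a \<pitchfork> component (n - p) b) Xs x = 0" if "p \<le> n"
      proof (cases "p \<le> length Xs")
        case True
        then have "length Xs - p \<noteq> n - p" using False that by linarith
        then show ?thesis by (simp add: h shuffle_part_def component_def)
      qed (simp add: h)
      then show ?thesis using False by (simp add: component_def[of n])
    qed
  qed
  have "component n (a \<pitchfork> b) \<in> reduced_ops E n" for n
  proof (cases "p \<le> n")
    case True
    have "a \<pitchfork> component (n - p) b \<in> reduced_ops E (p + (n - p))"
    proof (rule reduced_shuffle_homogeneous[OF a shuffle_component[OF b]])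
      show "(a \<pitchfork> component (n - p) b) Xs \<in> Cinf E" if "set Xs \<subseteq> Sec E" for Xs
        using that by (intro goodD good_shuffle rs_good reduced_subset[OF a] reduced_subset[OF shuffle_component[OF b]])
    qed
    then show ?thesis using True by (simp add: comp)
  qed (simp add: comp reduced_zero)
  moreover have "{n. component n (a \<pitchfork> b) \<noteq> (\<lambda>Xs x. 0)} \<subseteq> (+) p ` {q. component q b \<noteq> (\<lambda>Xs x. 0)}"
  proof
    fix n assume n: "n \<in> {n. component n (a \<pitchfork> b) \<noteq> (\<lambda>Xs x. 0)}"
    then have "p \<le> n" by (auto simp: comp split: if_splits)
    moreover have "component (n - p) b \<noteq> (\<lambda>Xs x. 0)"
    proof
      assume z: "component (n - p) b = (\<lambda>Xs x. 0)"
      have "a \<pitchfork> component (n - p) b = (\<lambda>Xs x. 0)" by (intro ext) (simp add: z shuffle_zero_right)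
      then show False using n \<open>p \<le> n\<close> by (simp add: comp)
    qed
    ultimately show "n \<in> (+) p ` {q. component q b \<noteq> (\<lambda>Xs x. 0)}"
      by (intro image_eqI[of _ _ "n - p"]) auto
  qed
  moreover have "finite ((+) p ` {q. component q b \<noteq> (\<lambda>Xs x. 0)})"
    using b unfolding reduced_shuffle_def by blast
  ultimately show ?thesis unfolding reduced_shuffle_def using finite_subset by blast
qed

lemma ce_field_lin:
  assumes "a \<in> reduced_shuffle E" "b \<in> reduced_shuffle E"
  shows "ce_field (\<lambda>Xs x. r * a Xs x + s * b Xs x) = (\<lambda>Xs x. r * ce_field a Xs x + s * ce_field b Xs x)"
  using assms rs_lin[OF assms, of r s] dif_lin[OF rs_good[OF assms(1)] rs_good[OF assms(2)]]
  by (auto simp: ce_field_def fun_eq_iff)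

lemma ce_field_derivation:
  assumes a: "a \<in> reduced_ops E p" and b: "b \<in> reduced_shuffle E"
  shows "ce_field (a \<pitchfork> b) = (\<lambda>Xs x. (ce_field a \<pitchfork> b) Xs x + (- 1) ^ p * (a \<pitchfork> ce_field b) Xs x)"
proof (intro ext)
  fix Xs x
  note ars = reduced_subset[OF a] and abrs = shuffle_rs[OF a b]
  have par: "par a = (\<lambda>Ys y. (- 1) ^ p * a Ys y)"
  proof (intro ext)
    fix Ys y
    show "par a Ys y = (- 1) ^ p * a Ys y"
      by (cases "length Ys = p") (simp_all add: par_def reduced_length[OF a])
  qed
  show "ce_field (a \<pitchfork> b) Xs x = (ce_field a \<pitchfork> b) Xs x + (- 1) ^ p * (a \<pitchfork> ce_field b) Xs x"
  proof (cases "set Xs \<subseteq> Sec E")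
    case True
    have "(ce_field a \<pitchfork> b) Xs = ((\<lambda>Xs. dif Xs a) \<pitchfork> b) Xs" "(a \<pitchfork> ce_field b) Xs = (a \<pitchfork> (\<lambda>Xs. dif Xs b)) Xs"
      by (rule shuffle_cong[OF _ _ True]; use ars b in \<open>simp add: ce_field_Sec\<close>)+
    then show ?thesis
      using dif_shuffle[OF rs_good[OF ars] rs_good[OF b] True, of x] True abrs
      by (simp add: ce_field_Sec par shuffle_scale_left)
  next
    case False
    have "(ce_field a \<pitchfork> b) Xs x = 0" "(a \<pitchfork> ce_field b) Xs x = 0"
      by (rule shuffle_vanishes_outside[OF _ _ False]; simp add: rs_outside ars b ce_field_rs)+
    then show ?thesis using False abrs by (simp add: ce_field_def)
  qed
qed

lemma ce_field_square:
  assumes c: "c \<in> reduced_shuffle E"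
  shows "ce_field (ce_field c) = (\<lambda>Xs x. 0)"
proof (intro ext)
  fix Xs x
  show "ce_field (ce_field c) Xs x = 0"
  proof (cases "set Xs \<subseteq> Sec E")
    case True
    have "dif Xs (ce_field c) = dif Xs (\<lambda>Ys. dif Ys c)"
      by (rule dif_cong[OF _ True]) (simp add: ce_field_Sec c)
    then show ?thesis
      using dif_dif[OF rs_good[OF c] rs_madd[OF c] True] True ce_field_rs[OF c] by (simp add: ce_field_Sec)
  next
    case False
    then show ?thesis using ce_field_rs[OF c] by (simp add: ce_field_def)
  qed
qed

lemma ce_field_fn: "f \<in> Cinf E \<Longrightarrow> X \<in> Sec E \<Longrightarrow> ce_field (fn f) [X] = \<rho> X f"
  using reduced_subset[OF fn_reduced] by (simp add: ce_field_Sec Lie_def fn_def)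

text \<open>For a covector l the differential on X, Y is the two anchor terms minus l on the
  bracket, so the defining formula of the derived bracket returns l on \<open>B X Y\<close>;
  covectors separate sections.\<close>

lemma ce_field_bracket: "derived_bracket E ce_field = B"
proof (intro ext)
  fix X Y x
  show "derived_bracket E ce_field X Y x = B X Y x"
  proof (cases "X \<in> Sec E \<and> Y \<in> Sec E")
    case True
    then have XY: "X \<in> Sec E" "Y \<in> Sec E" by auto
    have eq: "(\<lambda>x. ce_field (fn (l [Y])) [X] x - ce_field (fn (l [X])) [Y] x - ce_field l [X, Y] x) = l [B X Y]"
      if l: "l \<in> reduced_ops E 1" for l
      using XY reduced_subset[OF l] by (simp add: ce_field_fn dual_Cinf[OF l] ce_field_Sec Lie_def ins_def)
    have "(THE Z. Z \<in> Sec E \<and> (\<forall>l\<in>reduced_ops E 1. l [Z] =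
        (\<lambda>x. ce_field (fn (l [Y])) [X] x - ce_field (fn (l [X])) [Y] x - ce_field l [X, Y] x))) = B X Y"
    proof (rule the_equality)
      show "B X Y \<in> Sec E \<and> (\<forall>l\<in>reduced_ops E 1. l [B X Y] =
          (\<lambda>x. ce_field (fn (l [Y])) [X] x - ce_field (fn (l [X])) [Y] x - ce_field l [X, Y] x))"
        using eq XY by (simp add: B_closed)
      show "Z = B X Y" if "Z \<in> Sec E \<and> (\<forall>l\<in>reduced_ops E 1. l [Z] =
          (\<lambda>x. ce_field (fn (l [Y])) [X] x - ce_field (fn (l [X])) [Y] x - ce_field l [X, Y] x))" for Z
        using that eq XY by (intro dual_eqI B_closed) auto
    qed
    then show ?thesis using True by (simp add: derived_bracket_def)
  next
    case False
    then show ?thesis using B_outside by (auto simp: derived_bracket_def)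
  qed
qed

lemma ce_field_homological: "ce_field \<in> homological_fields E"
proof -
  have "ce_field \<in> graded_derivations E"
    unfolding graded_derivations_def
  proof (intro CollectI conjI allI ballI)
    show "ce_field \<in> extensional (reduced_shuffle E)" by (simp add: extensional_def ce_field_def)
    show "ce_field c \<in> reduced_ops E (Suc k)" if "c \<in> reduced_ops E k" for c k
      using that by (rule ce_field_reduced)
    show "ce_field (\<lambda>Xs x. a Xs x + b Xs x) = (\<lambda>Xs x. ce_field a Xs x + ce_field b Xs x)"
      if "a \<in> reduced_shuffle E" "b \<in> reduced_shuffle E" for a b
      using ce_field_lin[OF that, of 1 1] by simp
    show "ce_field (\<lambda>Xs x. r * a Xs x) = (\<lambda>Xs x. r * ce_field a Xs x)" if "a \<in> reduced_shuffle E" for a r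
      using ce_field_lin[OF that that, of r 0] by simp
    show "ce_field (a \<pitchfork> b) = (\<lambda>Xs x. (ce_field a \<pitchfork> b) Xs x + (- 1) ^ p * (a \<pitchfork> ce_field b) Xs x)"
      if "a \<in> reduced_ops E p" "b \<in> reduced_shuffle E" for a b p
      using that by (rule ce_field_derivation)
  qed
  \<comment> \<open>Unrolling Cartan's recursion over three arguments gives the form that
    \<open>Der1\<close> prescribes.\<close>
  moreover have "ce_field c [X1, X2, X3] = (\<lambda>x.
         ce_field (fn (c [X2, X3])) [X1] x - ce_field (fn (c [X1, X3])) [X2] x + ce_field (fn (c [X1, X2])) [X3] x
       - c [B X1 X2, X3] x - c [X2, B X1 X3] x + c [X1, B X2 X3] x)"
    if c: "c \<in> reduced_ops E 2" and X: "X1 \<in> Sec E" "X2 \<in> Sec E" "X3 \<in> Sec E" for c X1 X2 X3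
    using X reduced_subset[OF c]
    by (simp add: ce_field_fn reduced_Cinf[OF c] ce_field_Sec Lie_def ins_def numeral_2_eq_2 fun_eq_iff)
  ultimately have "ce_field \<in> Der1 E" unfolding Der1_def by (simp add: ce_field_bracket)
  then show ?thesis unfolding homological_fields_def by (simp add: ce_field_square)
qed

end

section \<open>The derived bracket\<close>

lemma shuffle_one: "(a \<pitchfork> b) [X] x = a [X] x * b [] x + a [] x * b [X] x"
  by (simp add: shuffle_Cons shuffle_Nil ins_def par_def)

lemma fn_Nil: "fn f [] = f" and fn_Cons: "fn f (X # Xs) = (\<lambda>x. 0)"
  by (simp_all add: fn_def)

lemma fn_lin: "fn (\<lambda>x. r * f x + s * g x) = (\<lambda>Xs x. r * fn f Xs x + s * fn g Xs x)"
  by (auto simp: fn_def fun_eq_iff)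

lemma all_less_two: "(\<forall>i<2. P i) \<longleftrightarrow> P 0 \<and> P (Suc 0)"
  by (auto simp: less_2_cases_iff One_nat_def)

lemma ball_args_2: "(\<forall>Xs\<in>args E 2. P Xs) \<longleftrightarrow> (\<forall>X\<in>Sec E. \<forall>Y\<in>Sec E. P [X, Y])"
proof -
  have "args E 2 = {[X, Y] | X Y. X \<in> Sec E \<and> Y \<in> Sec E}"
    by (auto simp: args_def length_Suc_conv numeral_2_eq_2)
  then show ?thesis by auto
qed

context smooth_vector_bundle
begin

lemma dual_lin:
  assumes "l \<in> reduced_ops E 1" "X \<in> Sec E" "Y \<in> Sec E"
  shows "l [\<lambda>x. r *\<^sub>R X x + s *\<^sub>R Y x] = (\<lambda>x. r * l [X] x + s * l [Y] x)"
  by (simp add: dual_add[OF assms(1) Sec_scale[OF assms(2)] Sec_scale[OF assms(3)]]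
      dual_scale[OF assms(1,2)] dual_scale[OF assms(1,3)])

end

locale homological = smooth_vector_bundle E
  for E :: "('m::{t2_space,second_countable_topology}, 'e::real_inner, 'v::real_vector, 'f::real_inner) vbundle" +
  fixes d :: "('m, 'v) cochain \<Rightarrow> ('m, 'v) cochain"
  assumes homological: "d \<in> homological_fields E"
begin

abbreviation \<rho> :: "('m \<Rightarrow> 'v) \<Rightarrow> ('m \<Rightarrow> real) \<Rightarrow> 'm \<Rightarrow> real" where
  "\<rho> X f \<equiv> d (fn f) [X]"

abbreviation B :: "('m \<Rightarrow> 'v) \<Rightarrow> ('m \<Rightarrow> 'v) \<Rightarrow> 'm \<Rightarrow> 'v" where
  "B \<equiv> derived_bracket E d"

section \<open>Derivation rules on functions and covectors\<close>

lemma derivation: "d \<in> graded_derivations E"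
  using homological by (simp add: homological_fields_def Der1_def)

lemma d_reduced: "c \<in> reduced_ops E k \<Longrightarrow> d c \<in> reduced_ops E (Suc k)"
  using derivation by (simp add: graded_derivations_def)

lemma d_reduced_1: "l \<in> reduced_ops E 1 \<Longrightarrow> d l \<in> reduced_ops E 2"
  using d_reduced[of l 1] by (simp add: numeral_2_eq_2 One_nat_def)

lemma d_fn: "f \<in> Cinf E \<Longrightarrow> d (fn f) \<in> reduced_ops E 1"
  using d_reduced[OF fn_reduced] by (simp add: One_nat_def)

lemma d_lin:
  assumes "a \<in> reduced_shuffle E" "b \<in> reduced_shuffle E"
  shows "d (\<lambda>Xs x. r * a Xs x + s * b Xs x) = (\<lambda>Xs x. r * d a Xs x + s * d b Xs x)"
proof -
  have add: "\<And>a b. a \<in> reduced_shuffle E \<Longrightarrow> b \<in> reduced_shuffle E \<Longrightarrow>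
        d (\<lambda>Xs x. a Xs x + b Xs x) = (\<lambda>Xs x. d a Xs x + d b Xs x)"
    and sc: "\<And>r a. a \<in> reduced_shuffle E \<Longrightarrow> d (\<lambda>Xs x. r * a Xs x) = (\<lambda>Xs x. r * d a Xs x)"
    using derivation unfolding graded_derivations_def by simp_all
  have "(\<lambda>Xs x. r * a Xs x) \<in> reduced_shuffle E" "(\<lambda>Xs x. s * b Xs x) \<in> reduced_shuffle E"
    using rs_lin[OF assms(1,1), of r 0] rs_lin[OF assms(2,2), of s 0] by simp_all
  then show ?thesis using add sc assms by simp
qed

lemma d_mult:
  assumes "f \<in> Cinf E" "b \<in> reduced_shuffle E"
  shows "d (\<lambda>Xs x. f x * b Xs x) = (\<lambda>Xs x. (d (fn f) \<pitchfork> b) Xs x + f x * d b Xs x)"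
proof -
  have "fn f \<pitchfork> b = (\<lambda>Xs x. f x * b Xs x)" by (intro ext) (rule shuffle_fn_left)
  moreover have "d (fn f \<pitchfork> b) = (\<lambda>Xs x. (d (fn f) \<pitchfork> b) Xs x + (- 1) ^ 0 * (fn f \<pitchfork> d b) Xs x)"
    using derivation fn_reduced[OF assms(1)] assms(2) unfolding graded_derivations_def by blast
  ultimately show ?thesis by (simp add: shuffle_fn_left)
qed

lemma d_d: "c \<in> reduced_shuffle E \<Longrightarrow> d (d c) Xs x = 0"
  using homological by (simp add: homological_fields_def)

lemma rho_Cinf: "X \<in> Sec E \<Longrightarrow> f \<in> Cinf E \<Longrightarrow> \<rho> X f \<in> Cinf E"
  by (rule dual_Cinf[OF d_fn])

lemma rho_lin:
  assumes "f \<in> Cinf E" "g \<in> Cinf E"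
  shows "\<rho> X (\<lambda>x. r * f x + s * g x) = (\<lambda>x. r * \<rho> X f x + s * \<rho> X g x)"
  unfolding fn_lin using d_lin[OF reduced_subset[OF fn_reduced[OF assms(1)]] reduced_subset[OF fn_reduced[OF assms(2)]]]
  by simp

lemma rho_diff3:
  assumes "f \<in> Cinf E" "g \<in> Cinf E" "h \<in> Cinf E"
  shows "\<rho> X (\<lambda>x. f x - g x - h x) = (\<lambda>x. \<rho> X f x - \<rho> X g x - \<rho> X h x)"
  using rho_lin[OF Cinf_diff[OF assms(1,2)] assms(3), of 1 "-1" X] rho_lin[OF assms(1,2), of 1 "-1" X] by simp

lemma rho_mult:
  assumes "f \<in> Cinf E" "g \<in> Cinf E"
  shows "\<rho> X (\<lambda>x. f x * g x) = (\<lambda>x. \<rho> X f x * g x + f x * \<rho> X g x)"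
proof -
  have "(fn (\<lambda>x. f x * g x) :: ('m, 'v) cochain) = (\<lambda>Xs x. f x * fn g Xs x)" by (auto simp: fn_def fun_eq_iff)
  then show ?thesis
    using d_mult[OF assms(1) reduced_subset[OF fn_reduced[OF assms(2)]]]
    by (simp add: shuffle_one fn_Nil fn_Cons)
qed

text \<open>The description by \<open>THE\<close> is meaningful because \<open>?T\<close> is
  function-linear in the covector, hence represented by a section, and that section is
  unique.\<close>

lemma bracket:
  assumes X: "X \<in> Sec E" and Y: "Y \<in> Sec E"
  shows bracket_Sec: "B X Y \<in> Sec E"
    and bracket_pairing: "l \<in> reduced_ops E 1 \<Longrightarrow> l [B X Y] = (\<lambda>x. \<rho> X (l [Y]) x - \<rho> Y (l [X]) x - d l [X, Y] x)"
proof -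
  let ?T = "\<lambda>l x. \<rho> X (l [Y]) x - \<rho> Y (l [X]) x - d l [X, Y] x"
  obtain Z where Z: "Z \<in> Sec E" "\<And>l. l \<in> reduced_ops E 1 \<Longrightarrow> l [Z] = ?T l"
  proof (rule dual_reflexive[of ?T])
    show "?T l \<in> Cinf E" if l: "l \<in> reduced_ops E 1" for l
      using X Y by (intro Cinf_diff rho_Cinf dual_Cinf[OF l] reduced_Cinf[OF d_reduced_1[OF l]]) auto
    show "?T (\<lambda>Xs x. l Xs x + l' Xs x) = (\<lambda>x. ?T l x + ?T l' x)"
      if l: "l \<in> reduced_ops E 1" "l' \<in> reduced_ops E 1" for l l'
      using d_lin[OF reduced_subset[OF l(1)] reduced_subset[OF l(2)], of 1 1]
        rho_lin[OF dual_Cinf[OF l(1) Y] dual_Cinf[OF l(2) Y], of 1 1 X]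
        rho_lin[OF dual_Cinf[OF l(1) X] dual_Cinf[OF l(2) X], of 1 1 Y]
      by (simp add: fun_eq_iff)
    \<comment> \<open>The derivation rule adds the shuffle product of the differential of f with l.
      On X, Y this consists of the two Leibniz terms of the anchor, so they cancel.\<close>
    show "?T (\<lambda>Xs x. f x * l Xs x) = (\<lambda>x. f x * ?T l x)" if f: "f \<in> Cinf E" and l: "l \<in> reduced_ops E 1" for f l
      using d_mult[OF f reduced_subset[OF l]] rho_mult[OF f dual_Cinf[OF l Y], of X]
        rho_mult[OF f dual_Cinf[OF l X], of Y] reduced_length[OF l, of "[]"] reduced_length[OF d_fn[OF f], of "[X, Y]"]
        reduced_length[OF d_fn[OF f], of "[]"]
      by (simp add: fun_eq_iff shuffle_two algebra_simps One_nat_def)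
  qed blast
  have "B X Y = (THE Z. Z \<in> Sec E \<and> (\<forall>l\<in>reduced_ops E 1. l [Z] = ?T l))"
    using X Y by (simp add: derived_bracket_def)
  also have "\<dots> = Z"
  proof (rule the_equality)
    show "Z \<in> Sec E \<and> (\<forall>l\<in>reduced_ops E 1. l [Z] = ?T l)" using Z by blast
    show "W = Z" if "W \<in> Sec E \<and> (\<forall>l\<in>reduced_ops E 1. l [W] = ?T l)" for W
      using that Z by (intro dual_eqI) auto
  qed
  finally have "B X Y = Z" .
  then show "B X Y \<in> Sec E" "l \<in> reduced_ops E 1 \<Longrightarrow> l [B X Y] = ?T l" using Z by auto
qed

lemma bracket_lin_right:
  assumes X: "X \<in> Sec E" and Y: "Y \<in> Sec E" and Z: "Z \<in> Sec E"
  shows "B X (\<lambda>x. r *\<^sub>R Y x + s *\<^sub>R Z x) = (\<lambda>x. r *\<^sub>R B X Y x + s *\<^sub>R B X Z x)"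
proof (rule dual_eqI)
  fix l assume l: "l \<in> reduced_ops E 1"
  have "d l [X, \<lambda>x. r *\<^sub>R Y x + s *\<^sub>R Z x] = (\<lambda>x. r * d l [X, Y] x + s * d l [X, Z] x)"
    using slot_linearD[OF reduced_slot_linear[OF d_reduced_1[OF l]] args_2[OF X Y] _ Y Z, of 1 r s]
    by (simp add: One_nat_def)
  then show "l [B X (\<lambda>x. r *\<^sub>R Y x + s *\<^sub>R Z x)] = l [\<lambda>x. r *\<^sub>R B X Y x + s *\<^sub>R B X Z x]"
    unfolding dual_lin[OF l bracket_Sec[OF X Y] bracket_Sec[OF X Z]] bracket_pairing[OF X Sec_lin[OF Y Z] l]
      bracket_pairing[OF X Y l] bracket_pairing[OF X Z l] dual_lin[OF l Y Z]
      rho_lin[OF dual_Cinf[OF l Y] dual_Cinf[OF l Z]] dual_lin[OF d_fn[OF dual_Cinf[OF l X]] Y Z]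
    by (simp add: fun_eq_iff algebra_simps)
qed (intro bracket_Sec Sec_lin X Y Z)+

lemma bracket_lin_left:
  assumes X: "X \<in> Sec E" and Y: "Y \<in> Sec E" and Z: "Z \<in> Sec E"
  shows "B (\<lambda>x. r *\<^sub>R Y x + s *\<^sub>R Z x) X = (\<lambda>x. r *\<^sub>R B Y X x + s *\<^sub>R B Z X x)"
proof (rule dual_eqI)
  fix l assume l: "l \<in> reduced_ops E 1"
  have "d l [\<lambda>x. r *\<^sub>R Y x + s *\<^sub>R Z x, X] = (\<lambda>x. r * d l [Y, X] x + s * d l [Z, X] x)"
    using slot_linearD[OF reduced_slot_linear[OF d_reduced_1[OF l]] args_2[OF Y X] _ Y Z, of 0 r s] by simp
  then show "l [B (\<lambda>x. r *\<^sub>R Y x + s *\<^sub>R Z x) X] = l [\<lambda>x. r *\<^sub>R B Y X x + s *\<^sub>R B Z X x]"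
    unfolding dual_lin[OF l bracket_Sec[OF Y X] bracket_Sec[OF Z X]] bracket_pairing[OF Sec_lin[OF Y Z] X l]
      bracket_pairing[OF Y X l] bracket_pairing[OF Z X l] dual_lin[OF l Y Z]
      rho_lin[OF dual_Cinf[OF l Y] dual_Cinf[OF l Z]] dual_lin[OF d_fn[OF dual_Cinf[OF l X]] Y Z]
    by (simp add: fun_eq_iff algebra_simps)
qed (intro bracket_Sec Sec_lin X Y Z)+

text \<open>Since \<open>d l\<close> has order 0 in its last argument, the only term with a
  derivative of f is the one from the anchor of X applied to f times the value of l on Y.\<close>

lemma bracket_fmult_right:
  assumes X: "X \<in> Sec E" and Y: "Y \<in> Sec E" and f: "f \<in> Cinf E"
  shows "B X (fmult f Y) = (\<lambda>x. f x *\<^sub>R B X Y x + \<rho> X f x *\<^sub>R Y x)"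
proof -
  have "B X (fmult f Y) = (\<lambda>x. 1 *\<^sub>R fmult f (B X Y) x + 1 *\<^sub>R fmult (\<rho> X f) Y x)"
  proof (rule dual_eqI)
    fix l assume l: "l \<in> reduced_ops E 1"
    have "d l [X, fmult f Y] = (\<lambda>x. f x * d l [X, Y] x)"
      using last_linearD[OF reduced_last_linear[OF d_reduced_1[OF l]], of "[X]" Y f] X Y f by simp
    then show "l [B X (fmult f Y)] = l [\<lambda>x. 1 *\<^sub>R fmult f (B X Y) x + 1 *\<^sub>R fmult (\<rho> X f) Y x]"
      unfolding dual_lin[OF l Sec_fmult[OF f bracket_Sec[OF X Y]] Sec_fmult[OF rho_Cinf[OF X f] Y]]
        bracket_pairing[OF X Sec_fmult[OF f Y] l] dual_fmult[OF l f bracket_Sec[OF X Y]]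
        dual_fmult[OF l rho_Cinf[OF X f] Y] bracket_pairing[OF X Y l] dual_fmult[OF l f Y]
        dual_fmult[OF d_fn[OF dual_Cinf[OF l X]] f Y] rho_mult[OF f dual_Cinf[OF l Y]]
      by (simp add: fun_eq_iff algebra_simps)
  qed (intro bracket_Sec Sec_lin Sec_fmult rho_Cinf X Y f)+
  then show ?thesis by (simp add: fmult_def)
qed

text \<open>\<open>d l\<close> may have order 1 in its first argument, so the commutator survives.
  Pairing with l shows that it is accounted for by the commutator of \<open>d l\<close> and a
  function-linear term.\<close>

lemma dual_bracket_commutator_left:
  assumes l: "l \<in> reduced_ops E 1" and X: "X \<in> Sec E" and Y: "Y \<in> Sec E" and f: "f \<in> Cinf E"
  shows "l [\<delta> 0 f (\<lambda>Xs. B (Xs ! 0) (Xs ! 1)) [X, Y]] = (\<lambda>x. - (\<rho> Y f x * l [X] x) - \<delta> 0 f (d l) [X, Y] x)"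
proof -
  note S = bracket_Sec[OF Sec_fmult[OF f X] Y] Sec_fmult[OF f bracket_Sec[OF X Y]]
  have "\<delta> 0 f (\<lambda>Xs. B (Xs ! 0) (Xs ! 1)) [X, Y] = (\<lambda>x. B (fmult f X) Y x - fmult f (B X Y) x)"
    by (simp add: \<delta>_def fmult_def[of f "B X Y"] One_nat_def)
  then show ?thesis
    using dual_diff[OF l S] dual_fmult[OF l f bracket_Sec[OF X Y]] bracket_pairing[OF Sec_fmult[OF f X] Y l]
      bracket_pairing[OF X Y l] dual_fmult[OF l f X] dual_fmult[OF d_fn[OF dual_Cinf[OF l Y]] f X]
      rho_mult[OF f dual_Cinf[OF l X], of Y]
    by (simp add: \<delta>_def fun_eq_iff algebra_simps)
qed

lemma bracket_commutator_right:
  assumes "X \<in> Sec E" "Y \<in> Sec E" "f \<in> Cinf E"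
  shows "\<delta> (Suc 0) f (\<lambda>Xs. B (Xs ! 0) (Xs ! 1)) [X, Y] = (\<lambda>x. \<rho> X f x *\<^sub>R Y x)"
  using bracket_fmult_right[OF assms] by (simp add: \<delta>_def One_nat_def)

text \<open>If the inner commutator is in the second slot, the Leibniz rule computes it as the
  anchor times the section, which is function-linear in both arguments. If it is in the first slot,
  the claim is tested on covectors.\<close>

lemma bracket_total_order: "tot E 2 2 (\<lambda>Xs. B (Xs ! 0) (Xs ! 1))" (is "tot E 2 2 ?B")
proof -
  have 1: "\<delta> 0 g (\<delta> (Suc 0) f ?B) [X, Y] = (\<lambda>x. 0)" "\<delta> (Suc 0) g (\<delta> (Suc 0) f ?B) [X, Y] = (\<lambda>x. 0)"
    if X: "X \<in> Sec E" and Y: "Y \<in> Sec E" and f: "f \<in> Cinf E" and g: "g \<in> Cinf E" for X Y f g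
    unfolding \<delta>_def[of 0 g] \<delta>_def[of "Suc 0" g]
    using bracket_commutator_right[OF X Y f] bracket_commutator_right[OF Sec_fmult[OF g X] Y f]
      bracket_commutator_right[OF X Sec_fmult[OF g Y] f] dual_fmult[OF d_fn[OF f] g X]
    by (simp_all add: fmult_def[of g Y] mult.commute)
  have BS: "?B Ys \<in> Sec E" if "Ys \<in> args E 2" for Ys
    using that by (intro bracket_Sec args_nth[OF that]) auto
  have 2: "\<delta> j g (\<delta> 0 f ?B) [X, Y] = (\<lambda>x. 0)"
    if j: "j < 2" and X: "X \<in> Sec E" and Y: "Y \<in> Sec E" and f: "f \<in> Cinf E" and g: "g \<in> Cinf E" for j X Y f g
  proof (rule dual_eqI)
    have dS: "\<delta> 0 f ?B Ys \<in> Sec E" if "Ys \<in> args E 2" for Ys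
      using that f by (intro Sec_\<delta>[of 2] BS) auto
    show "\<delta> j g (\<delta> 0 f ?B) [X, Y] \<in> Sec E"
      using j g args_2[OF X Y] by (intro Sec_\<delta>[of 2] dS) auto
    show "(\<lambda>x. 0) \<in> Sec E" by (rule Sec_zero)
    fix l assume l: "l \<in> reduced_ops E 1"
    have t: "tot E 2 (Suc (Suc 0)) (d l)" using reduced_tot[OF d_reduced_1[OF l]] by (simp add: numeral_2_eq_2)
    have t0: "\<delta> j g (\<delta> 0 f (d l)) [X, Y] x = 0" for x
      using t j f g args_2[OF X Y] by simp
    let ?Xs = "[X, Y][j := fmult g ([X, Y] ! j)]"
    have j': "j = 0 \<or> j = Suc 0" using j by auto
    have a: "?Xs \<in> args E 2" using args_2[OF X Y] j g by (intro args_fmult) auto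
    have "\<delta> j g (\<delta> 0 f ?B) [X, Y] = (\<lambda>x. \<delta> 0 f ?B ?Xs x - fmult g (\<delta> 0 f ?B [X, Y]) x)"
      by (simp add: \<delta>_def[of j] fmult_def)
    then have "l [\<delta> j g (\<delta> 0 f ?B) [X, Y]] = (\<lambda>x. l [\<delta> 0 f ?B ?Xs] x - g x * l [\<delta> 0 f ?B [X, Y]] x)"
      using dual_diff[OF l dS[OF a] Sec_fmult[OF g dS[OF args_2[OF X Y]]]] dual_fmult[OF l g dS[OF args_2[OF X Y]]]
      by simp
    \<comment> \<open>The outer commutator kills the anchor term, which is function-linear in both
      arguments. What remains is a double commutator of \<open>d l\<close>, zero because
      \<open>d l\<close> has total order at most 1.\<close>
    also have "\<dots> = (\<lambda>x. - \<delta> j g (\<delta> 0 f (d l)) [X, Y] x)"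
      using j'
      by (auto simp: dual_bracket_commutator_left[OF l X Y f] dual_bracket_commutator_left[OF l Sec_fmult[OF g X] Y f]
          dual_bracket_commutator_left[OF l X Sec_fmult[OF g Y] f] dual_fmult[OF l g X] dual_fmult[OF d_fn[OF f] g Y]
          \<delta>_def[of _ g] fun_eq_iff algebra_simps)
    finally show "l [\<delta> j g (\<delta> 0 f ?B) [X, Y]] = l [\<lambda>x. 0]" by (simp add: t0 dual_zero[OF l])
  qed
  have "tot E 2 (Suc (Suc 0)) ?B"
    using 1 2[of 0] 2[of "Suc 0"] by (simp add: all_less_two ball_args_2)
  then show ?thesis by (simp add: numeral_2_eq_2)
qed

text \<open>The bracket formula for the covector \<open>d (fn f)\<close>, whose differential
  vanishes.\<close>

lemma rho_bracket:
  assumes X: "X \<in> Sec E" and Y: "Y \<in> Sec E" and f: "f \<in> Cinf E"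
  shows "\<rho> (B X Y) f = (\<lambda>x. \<rho> X (\<rho> Y f) x - \<rho> Y (\<rho> X f) x)"
  using bracket_pairing[OF X Y d_fn[OF f]] d_d[OF reduced_subset[OF fn_reduced[OF f]]] by simp

lemma d_two:
  assumes "l \<in> reduced_ops E 1" "X \<in> Sec E" "Y \<in> Sec E"
  shows "d l [X, Y] = (\<lambda>x. \<rho> X (l [Y]) x - \<rho> Y (l [X]) x - l [B X Y] x)"
  unfolding bracket_pairing[OF assms(2,3,1)] by simp

lemma rho_d_two:
  assumes l: "l \<in> reduced_ops E 1" and "X \<in> Sec E" "Y \<in> Sec E" "Z \<in> Sec E"
  shows "\<rho> Z (d l [X, Y]) = (\<lambda>x. \<rho> Z (\<rho> X (l [Y])) x - \<rho> Z (\<rho> Y (l [X])) x - \<rho> Z (l [B X Y]) x)"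
  unfolding d_two[OF l assms(2,3)]
  using assms by (intro rho_diff3 rho_Cinf dual_Cinf[OF l] bracket_Sec)

text \<open>The \<open>Der1\<close> formula for the 2-cochain \<open>d l\<close> equals zero. Terms
  with two anchors cancel by \<open>rho_bracket\<close>, those with one anchor cancel in pairs, and
  l applied to the Jacobi identity is left.\<close>

lemma bracket_jacobi:
  assumes X: "X \<in> Sec E" and Y: "Y \<in> Sec E" and Z: "Z \<in> Sec E"
  shows "B X (B Y Z) = (\<lambda>x. B (B X Y) Z x + B Y (B X Z) x)"
proof (rule dual_eqI)
  note XY = bracket_Sec[OF X Y] and XZ = bracket_Sec[OF X Z] and YZ = bracket_Sec[OF Y Z]
  show "B X (B Y Z) \<in> Sec E" "(\<lambda>x. B (B X Y) Z x + B Y (B X Z) x) \<in> Sec E"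
    by (intro bracket_Sec Sec_add X Y Z)+
  fix l assume l: "l \<in> reduced_ops E 1"
  have "d \<in> Der1 E" using homological by (simp add: homological_fields_def)
  then have "d (d l) [X, Y, Z] = (\<lambda>x.
      \<rho> X (d l [Y, Z]) x - \<rho> Y (d l [X, Z]) x + \<rho> Z (d l [X, Y]) x
      - d l [B X Y, Z] x - d l [Y, B X Z] x + d l [X, B Y Z] x)"
    using d_reduced_1[OF l] X Y Z unfolding Der1_def by blast
  then have *: "\<rho> X (d l [Y, Z]) x - \<rho> Y (d l [X, Z]) x + \<rho> Z (d l [X, Y]) x
      - d l [B X Y, Z] x - d l [Y, B X Z] x + d l [X, B Y Z] x = 0" for x
    using d_d[OF reduced_subset[OF l]] by (metis (no_types, lifting))
  show "l [B X (B Y Z)] = l [\<lambda>x. B (B X Y) Z x + B Y (B X Z) x]"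
  proof
    fix x
    show "l [B X (B Y Z)] x = l [\<lambda>x. B (B X Y) Z x + B Y (B X Z) x] x"
      using *[of x] unfolding dual_add[OF l bracket_Sec[OF XY Z] bracket_Sec[OF Y XZ]]
        rho_d_two[OF l Y Z X] rho_d_two[OF l X Z Y] rho_d_two[OF l X Y Z]
        d_two[OF l XY Z] d_two[OF l Y XZ] d_two[OF l X YZ]
        rho_bracket[OF X Y dual_Cinf[OF l Z]] rho_bracket[OF X Z dual_Cinf[OF l Y]]
        rho_bracket[OF Y Z dual_Cinf[OF l X]]
      by simp
  qed
qed

lemma bracket_loday: "B \<in> loday_algebroids E"
proof -
  let ?B = "\<lambda>Xs. B (Xs ! 0) (Xs ! 1)"
  have t: "total_order_le E 2 1 ?B"
    unfolding total_order_le_iff_tot using bracket_total_order by (simp add: numeral_2_eq_2 One_nat_def)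
  have "slot_linear E 2 ?B"
    unfolding slot_linear_def ball_args_2 all_less_two
    by (simp add: bracket_lin_left bracket_lin_right One_nat_def)
  then have ml: "multilinear E 2 ?B" by (simp add: slot_linear_iff)
  have md: "multidifferential E 2 (Sec E) ?B"
    unfolding multidifferential_def
    using ml total_order_imp_order_le[OF t] by (auto simp: ball_args_2 bracket_Sec One_nat_def)
  have der: "\<exists>g\<in>Cinf E. \<forall>Y\<in>Sec E. (\<lambda>x. B X (fmult f Y) x - f x *\<^sub>R B X Y x) = fmult g Y"
    if "X \<in> Sec E" "f \<in> Cinf E" for X f
    using that by (intro bexI[of _ "\<rho> X f"]) (auto simp: bracket_fmult_right fmult_def[of "\<rho> X f"] rho_Cinf)
  show ?thesis
    unfolding loday_algebroids_def
  proof (intro CollectI conjI allI ballI impI)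
    show "B X Y = (\<lambda>x. 0)" if "\<not> (X \<in> Sec E \<and> Y \<in> Sec E)" for X Y
      unfolding derived_bracket_def by (rule if_not_P[OF that])
  qed (fact md t | erule (2) bracket_jacobi | erule (1) der)+
qed

end

section \<open>The correspondence\<close>

lemma (in smooth_vector_bundle) homologicalI: "d \<in> homological_fields E \<Longrightarrow> homological E d"
  by unfold_locales

text \<open>The bracket formula applies d to functions and covectors only, so it is constant on
  equivalence classes.\<close>

lemma (in smooth_vector_bundle) derived_bracket_cong:
  assumes "\<And>c. c \<in> reduced_ops E 0 \<union> reduced_ops E 1 \<Longrightarrow> d c = d' c"
  shows "derived_bracket E d = derived_bracket E d'"
proof (intro ext)
  fix X Y x
  have "(\<lambda>x. d (fn (l [Y])) [X] x - d (fn (l [X])) [Y] x - d l [X, Y] x)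
      = (\<lambda>x. d' (fn (l [Y])) [X] x - d' (fn (l [X])) [Y] x - d' l [X, Y] x)"
    if "X \<in> Sec E" "Y \<in> Sec E" "l \<in> reduced_ops E 1" for l
    using assms[of l] assms[of "fn (l [Y])"] assms[of "fn (l [X])"] that by (simp add: fn_reduced dual_Cinf)
  then show "derived_bracket E d X Y x = derived_bracket E d' X Y x"
    unfolding derived_bracket_def by (simp cong: conj_cong)
qed

lemma (in smooth_vector_bundle) derived_bracket_inject:
  assumes d: "d \<in> homological_fields E" and d': "d' \<in> homological_fields E"
    and eq: "derived_bracket E d = derived_bracket E d'" and c: "c \<in> reduced_ops E 0 \<union> reduced_ops E 1"
  shows "d c = d' c"
proof -
  interpret h: homological E d using homologicalI[OF d] .
  interpret h': homological E d' using homologicalI[OF d'] .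
  have fn: "d (fn f) = d' (fn f)" if f: "f \<in> Cinf E" for f
  proof
    fix Xs
    show "d (fn f) Xs = d' (fn f) Xs"
    proof (cases "Xs \<in> args E 1")
      case True
      then obtain X where X: "Xs = [X]" "X \<in> Sec E" by (auto simp: args_1)
      have "d (fn f) [X] x = d' (fn f) [X] x" for x
      proof (cases "\<exists>Y\<in>Sec E. Y x \<noteq> 0")
        case True
        then obtain Y where Y: "Y \<in> Sec E" "Y x \<noteq> 0" by blast
        have "d (fn f) [X] x *\<^sub>R Y x = d' (fn f) [X] x *\<^sub>R Y x"
          using fun_cong[OF h.bracket_fmult_right[OF X(2) Y(1) f], of x]
            fun_cong[OF h'.bracket_fmult_right[OF X(2) Y(1) f], of x] by (auto simp: eq)
        then show ?thesis using Y(2) by simp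
      next
        case False
        \<comment> \<open>Here every section vanishes at x, in particular X, so both covectors take
          the value 0 on it.\<close>
        then show ?thesis
          using dual_vanishes[OF h.d_fn[OF f] X(2), of x] dual_vanishes[OF h'.d_fn[OF f] X(2), of x] X(2) by simp
      qed
      then show ?thesis using X by blast
    next
      case False
      then show ?thesis using dual_outside[OF h.d_fn[OF f]] dual_outside[OF h'.d_fn[OF f]] by simp
    qed
  qed
  show ?thesis
  proof (cases "c \<in> reduced_ops E 0")
    case True
    then show ?thesis using fn[of "c []"] reduced_0_eq_fn by metis
  next
    case False
    then have c1: "c \<in> reduced_ops E 1" using c by blast
    show ?thesis
    proof
      fix Xs
      show "d c Xs = d' c Xs"
      proof (cases "Xs \<in> args E 2")
        case True
        then have "\<exists>X Y. Xs = [X, Y] \<and> X \<in> Sec E \<and> Y \<in> Sec E"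
          by (auto simp: args_def length_Suc_conv numeral_2_eq_2)
        then obtain X Y where X: "Xs = [X, Y]" "X \<in> Sec E" "Y \<in> Sec E" by blast
        show ?thesis
          unfolding X(1) h.d_two[OF c1 X(2,3)] h'.d_two[OF c1 X(2,3)]
          by (simp add: eq fn dual_Cinf[OF c1] X)
      next
        case False
        then show ?thesis
          using reduced_outside[OF h.d_reduced_1[OF c1]] reduced_outside[OF h'.d_reduced_1[OF c1]] by simp
      qed
    qed
  qed
qed

section \<open>From a Loday bracket to an anchor and a homological field\<close>

locale loday_bracket = smooth_vector_bundle E
  for E :: "('m::{t2_space,second_countable_topology}, 'e::real_inner, 'v::real_vector, 'f::real_inner) vbundle" +
  fixes B :: "('m \<Rightarrow> 'v) \<Rightarrow> ('m \<Rightarrow> 'v) \<Rightarrow> 'm \<Rightarrow> 'v"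
  assumes loday: "B \<in> loday_algebroids E"
begin

lemma
  shows B_outside: "\<not> (X \<in> Sec E \<and> Y \<in> Sec E) \<Longrightarrow> B X Y = (\<lambda>x. 0)"
    and B_multidifferential: "multidifferential E 2 (Sec E) (\<lambda>Xs. B (Xs ! 0) (Xs ! 1))"
    and B_total_order: "total_order_le E 2 1 (\<lambda>Xs. B (Xs ! 0) (Xs ! 1))"
    and B_jacobi: "X \<in> Sec E \<Longrightarrow> Y \<in> Sec E \<Longrightarrow> Z \<in> Sec E \<Longrightarrow>
      B X (B Y Z) = (\<lambda>x. B (B X Y) Z x + B Y (B X Z) x)"
    and B_derivative: "X \<in> Sec E \<Longrightarrow> f \<in> Cinf E \<Longrightarrow>
      \<exists>g\<in>Cinf E. \<forall>Y\<in>Sec E. (\<lambda>x. B X (fmult f Y) x - f x *\<^sub>R B X Y x) = fmult g Y"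
proof -
  note * = loday[unfolded loday_algebroids_def mem_Collect_eq]
  show "\<not> (X \<in> Sec E \<and> Y \<in> Sec E) \<Longrightarrow> B X Y = (\<lambda>x. 0)"
    by (rule conjunct1[OF *, rule_format])
  show "multidifferential E 2 (Sec E) (\<lambda>Xs. B (Xs ! 0) (Xs ! 1))"
    by (rule conjunct1[OF conjunct2[OF *]])
  show "total_order_le E 2 1 (\<lambda>Xs. B (Xs ! 0) (Xs ! 1))"
    by (rule conjunct1[OF conjunct2[OF conjunct2[OF *]]])
  show "X \<in> Sec E \<Longrightarrow> Y \<in> Sec E \<Longrightarrow> Z \<in> Sec E \<Longrightarrow> B X (B Y Z) = (\<lambda>x. B (B X Y) Z x + B Y (B X Z) x)"
    by (rule conjunct1[OF conjunct2[OF conjunct2[OF conjunct2[OF *]]], rule_format])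
  show "X \<in> Sec E \<Longrightarrow> f \<in> Cinf E \<Longrightarrow>
      \<exists>g\<in>Cinf E. \<forall>Y\<in>Sec E. (\<lambda>x. B X (fmult f Y) x - f x *\<^sub>R B X Y x) = fmult g Y"
    using conjunct2[OF conjunct2[OF conjunct2[OF conjunct2[OF *]]]] by simp
qed

lemma B_tot: "tot E 2 2 (\<lambda>Xs. B (Xs ! 0) (Xs ! 1))"
  using B_total_order by (simp add: total_order_le_iff_tot numeral_2_eq_2 One_nat_def)

lemma B_slot: "slot_linear E 2 (\<lambda>Xs. B (Xs ! 0) (Xs ! 1))"
  using B_multidifferential by (simp add: multidifferential_def slot_linear_iff)

lemma B_Sec: "X \<in> Sec E \<Longrightarrow> Y \<in> Sec E \<Longrightarrow> B X Y \<in> Sec E"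
  using B_multidifferential by (simp add: multidifferential_def ball_args_2 One_nat_def)

lemma B_lin_right:
  "X \<in> Sec E \<Longrightarrow> Y \<in> Sec E \<Longrightarrow> Z \<in> Sec E \<Longrightarrow>
    B X (\<lambda>x. r *\<^sub>R Y x + s *\<^sub>R Z x) = (\<lambda>x. r *\<^sub>R B X Y x + s *\<^sub>R B X Z x)"
  using slot_linearD[OF B_slot args_2, of X Y 1 Y Z r s] by (simp add: One_nat_def)

lemma B_lin_left:
  "X \<in> Sec E \<Longrightarrow> Y \<in> Sec E \<Longrightarrow> Z \<in> Sec E \<Longrightarrow>
    B (\<lambda>x. r *\<^sub>R Y x + s *\<^sub>R Z x) X = (\<lambda>x. r *\<^sub>R B Y X x + s *\<^sub>R B Z X x)"
  using slot_linearD[OF B_slot args_2, of Y X 0 Y Z r s] by (simp add: One_nat_def)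

text \<open>In rank 0 the bracket carries no information on the anchor, which has to be set to 0.\<close>

lemma anchor_exists_trivial:
  assumes triv: "\<not> (\<exists>w::'f. w \<noteq> 0)"
  shows "loday_structure E B (\<lambda>X f x. 0)"
proof unfold_locales
  show "B X (fmult f Y) = (\<lambda>x. f x *\<^sub>R B X Y x + 0 *\<^sub>R Y x)" if "X \<in> Sec E" "Y \<in> Sec E" "f \<in> Cinf E" for X Y f
    using Sec_trivial[OF triv B_Sec[OF that(1) Sec_fmult[OF that(3,2)]]] Sec_trivial[OF triv B_Sec[OF that(1,2)]] by simp
qed (simp_all add: Cinf_const Cinf_add Cinf_mult B_Sec B_slot B_tot B_outside, rule B_jacobi)

text \<open>In positive rank some section is nonzero at any given point, so an identity of functions
  may be checked after multiplication with sections. There each property of the anchor becomes a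
  property of the bracket.\<close>

lemma anchor_exists_nontrivial:
  assumes nt: "\<exists>w::'f. w \<noteq> 0"
  shows "\<exists>\<rho>. loday_structure E B \<rho>"
proof -
  \<comment> \<open>The functions are chosen independently for each X and f, so nothing is known at
    first about the dependence on either.\<close>
  have "\<forall>X f. \<exists>g. X \<in> Sec E \<longrightarrow> f \<in> Cinf E \<longrightarrow> g \<in> Cinf E \<and>
      (\<forall>Y\<in>Sec E. (\<lambda>x. B X (fmult f Y) x - f x *\<^sub>R B X Y x) = fmult g Y)"
    using B_derivative by blast
  then obtain \<rho> where \<rho>: "\<And>X f. X \<in> Sec E \<Longrightarrow> f \<in> Cinf E \<Longrightarrow> \<rho> X f \<in> Cinf E"
    "\<And>X f Y. X \<in> Sec E \<Longrightarrow> f \<in> Cinf E \<Longrightarrow> Y \<in> Sec E \<Longrightarrow>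
      (\<lambda>x. B X (fmult f Y) x - f x *\<^sub>R B X Y x) = fmult (\<rho> X f) Y"
    by (metis (no_types))
  have B_fmult: "B X (fmult f Y) = (\<lambda>x. f x *\<^sub>R B X Y x + \<rho> X f x *\<^sub>R Y x)"
    if "X \<in> Sec E" "Y \<in> Sec E" "f \<in> Cinf E" for X Y f
    using \<rho>(2)[OF that(1,3,2)] by (auto simp: fmult_def[of "\<rho> X f"] fun_eq_iff algebra_simps)
  have eqI: "u = v" if "\<And>Y x. Y \<in> Sec E \<Longrightarrow> u x *\<^sub>R Y x = v x *\<^sub>R Y x" for u v :: "'m \<Rightarrow> real"
  proof
    fix x
    obtain Y where "Y \<in> Sec E" "Y x \<noteq> 0" using nonvanishing_section[OF nt] .
    then show "u x = v x" using that[of Y x] by simp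
  qed
  have lin: "\<rho> X (\<lambda>x. r * f x + s * g x) = (\<lambda>x. r * \<rho> X f x + s * \<rho> X g x)"
    if X: "X \<in> Sec E" and f: "f \<in> Cinf E" and g: "g \<in> Cinf E" for X f g r s
  proof (rule eqI)
    fix Y x assume Y: "Y \<in> Sec E"
    have rs: "(\<lambda>x. r * f x + s * g x) \<in> Cinf E" using f g by (intro Cinf_add Cinf_mult Cinf_const)
    have "fmult (\<lambda>x. r * f x + s * g x) Y = (\<lambda>x. r *\<^sub>R fmult f Y x + s *\<^sub>R fmult g Y x)"
      by (simp add: fmult_def algebra_simps)
    then have "B X (fmult (\<lambda>x. r * f x + s * g x) Y) x = r *\<^sub>R B X (fmult f Y) x + s *\<^sub>R B X (fmult g Y) x"
      using B_lin_right[OF X Sec_fmult[OF f Y] Sec_fmult[OF g Y]] by simp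
    then show "\<rho> X (\<lambda>x. r * f x + s * g x) x *\<^sub>R Y x = (r * \<rho> X f x + s * \<rho> X g x) *\<^sub>R Y x"
      by (simp add: B_fmult[OF X Y rs] B_fmult[OF X Y f] B_fmult[OF X Y g] algebra_simps)
  qed
  have "loday_structure E B \<rho>"
  proof unfold_locales
    show "\<rho> X f \<in> Cinf E" if "X \<in> Sec E" "f \<in> Cinf E" for X f using that by (rule \<rho>(1))
    show "\<rho> X (\<lambda>x. f x + g x) = (\<lambda>x. \<rho> X f x + \<rho> X g x)" if "X \<in> Sec E" "f \<in> Cinf E" "g \<in> Cinf E" for X f g
      using lin[OF that, of 1 1] by simp
    show "\<rho> X (\<lambda>x. r * f x) = (\<lambda>x. r * \<rho> X f x)" if "X \<in> Sec E" "f \<in> Cinf E" for X f r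
      using lin[OF that(1,2,2), of r 0] by simp
    show "\<rho> X (\<lambda>x. f x * g x) = (\<lambda>x. \<rho> X f x * g x + f x * \<rho> X g x)"
      if X: "X \<in> Sec E" and f: "f \<in> Cinf E" and g: "g \<in> Cinf E" for X f g
    proof (rule eqI)
      fix Y x assume Y: "Y \<in> Sec E"
      have "fmult (\<lambda>x. f x * g x) Y = fmult f (fmult g Y)" by (simp add: fmult_def)
      then have "B X (fmult (\<lambda>x. f x * g x) Y) x = B X (fmult f (fmult g Y)) x" by simp
      then show "\<rho> X (\<lambda>x. f x * g x) x *\<^sub>R Y x = (\<rho> X f x * g x + f x * \<rho> X g x) *\<^sub>R Y x"
        unfolding B_fmult[OF X Y Cinf_mult[OF f g]] B_fmult[OF X Sec_fmult[OF g Y] f] B_fmult[OF X Y g]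
        by (simp add: fmult_def algebra_simps)
    qed
    show "\<rho> (B X Y) f = (\<lambda>x. \<rho> X (\<rho> Y f) x - \<rho> Y (\<rho> X f) x)"
      if X: "X \<in> Sec E" and Y: "Y \<in> Sec E" and f: "f \<in> Cinf E" for X Y f
    proof (rule eqI)
      fix Z x assume Z: "Z \<in> Sec E"
      \<comment> \<open>For the Jacobi identity on X, Y and f Z: the two middle terms are symmetric
        in U and V and cancel, the terms with f cancel by the Jacobi identity for Z, and the
        coefficients of Z remain.\<close>
      have e: "B U (B V (fmult f Z)) x = f x *\<^sub>R B U (B V Z) x + \<rho> U f x *\<^sub>R B V Z x
          + \<rho> V f x *\<^sub>R B U Z x + \<rho> U (\<rho> V f) x *\<^sub>R Z x" if U: "U \<in> Sec E" and V: "V \<in> Sec E" for U V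
      proof -
        have "B V (fmult f Z) = (\<lambda>x. 1 *\<^sub>R fmult f (B V Z) x + 1 *\<^sub>R fmult (\<rho> V f) Z x)"
          unfolding B_fmult[OF V Z f] by (simp add: fmult_def)
        then have "B U (B V (fmult f Z)) x = B U (fmult f (B V Z)) x + B U (fmult (\<rho> V f) Z) x"
          using B_lin_right[OF U Sec_fmult[OF f B_Sec[OF V Z]] Sec_fmult[OF \<rho>(1)[OF V f] Z], of 1 1] by simp
        then show ?thesis
          by (simp add: B_fmult[OF U B_Sec[OF V Z] f] B_fmult[OF U Z \<rho>(1)[OF V f]])
      qed
      have "B X (B Y (fmult f Z)) x = B (B X Y) (fmult f Z) x + B Y (B X (fmult f Z)) x"
        by (rule fun_cong[OF B_jacobi[OF X Y Sec_fmult[OF f Z]]])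
      moreover have "f x *\<^sub>R B X (B Y Z) x = f x *\<^sub>R B (B X Y) Z x + f x *\<^sub>R B Y (B X Z) x"
        by (simp only: fun_cong[OF B_jacobi[OF X Y Z], of x] scaleR_add_right)
      ultimately show "\<rho> (B X Y) f x *\<^sub>R Z x = (\<rho> X (\<rho> Y f) x - \<rho> Y (\<rho> X f) x) *\<^sub>R Z x"
        unfolding e[OF X Y] e[OF Y X] B_fmult[OF B_Sec[OF X Y] Z f] by (simp add: scaleR_diff_left)
    qed
    show "\<rho> (fmult f X) g = (\<lambda>x. f x * \<rho> X g x)"
      if X: "X \<in> Sec E" and f: "f \<in> Cinf E" and g: "g \<in> Cinf E" for X f g
    proof (rule eqI)
      fix Y x assume Y: "Y \<in> Sec E"
      \<comment> \<open>Function-linearity of the anchor is the mixed part of the order condition: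
        the commutator in the second slot is the anchor times Y, and a further one in the first slot
        annihilates it.\<close>
      have "tot E 2 (Suc (Suc 0)) (\<lambda>Xs. B (Xs ! 0) (Xs ! 1))" using B_tot by (simp add: numeral_2_eq_2)
      then have "\<delta> 0 f (\<delta> (Suc 0) g (\<lambda>Xs. B (Xs ! 0) (Xs ! 1))) [X, Y] = (\<lambda>x. 0)"
        using X Y f g by (simp add: all_less_two ball_args_2)
      then have "\<delta> (Suc 0) g (\<lambda>Xs. B (Xs ! 0) (Xs ! 1)) [fmult f X, Y] x
          = f x *\<^sub>R \<delta> (Suc 0) g (\<lambda>Xs. B (Xs ! 0) (Xs ! 1)) [X, Y] x"
        by (simp add: \<delta>_def[of 0] fun_eq_iff)
      then show "\<rho> (fmult f X) g x *\<^sub>R Y x = (f x * \<rho> X g x) *\<^sub>R Y x"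
        by (simp add: \<delta>_def One_nat_def B_fmult[OF Sec_fmult[OF f X] Y g] B_fmult[OF X Y g])
    qed
    show "\<rho> (\<lambda>x. r *\<^sub>R X x + s *\<^sub>R Y x) g = (\<lambda>x. r * \<rho> X g x + s * \<rho> Y g x)"
      if X: "X \<in> Sec E" and Y: "Y \<in> Sec E" and g: "g \<in> Cinf E" for X Y g r s
    proof (rule eqI)
      fix Z x assume Z: "Z \<in> Sec E"
      show "\<rho> (\<lambda>x. r *\<^sub>R X x + s *\<^sub>R Y x) g x *\<^sub>R Z x = (r * \<rho> X g x + s * \<rho> Y g x) *\<^sub>R Z x"
        using fun_cong[OF B_lin_left[OF Sec_fmult[OF g Z] X Y, of r s], of x]
          fun_cong[OF B_lin_left[OF Z X Y, of r s], of x]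
        by (simp add: B_fmult[OF Sec_lin[OF X Y] Z g] B_fmult[OF X Z g] B_fmult[OF Y Z g] algebra_simps)
    qed
  qed (simp_all add: Cinf_const Cinf_add Cinf_mult B_Sec B_slot B_tot B_outside B_fmult, rule B_jacobi)
  then show ?thesis by blast
qed

lemma homological_field_exists: "\<exists>d\<in>homological_fields E. derived_bracket E d = B"
proof -
  have "\<exists>\<rho>. loday_structure E B \<rho>"
  proof (cases "\<exists>w::'f. w \<noteq> 0")
    case True
    then show ?thesis by (rule anchor_exists_nontrivial)
  next
    case False
    then show ?thesis by (intro exI) (rule anchor_exists_trivial)
  qed
  then obtain \<rho> where "loday_structure E B \<rho>" ..
  then interpret loday_structure E B \<rho> .
  show ?thesis using ce_field_homological ce_field_bracket by blast
qed

end

theorem theorem8p6: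
  fixes E :: "('m::{t2_space,second_countable_topology}, 'e::real_inner, 'v::real_vector, 'f::real_inner) vbundle"
  assumes "vector_bundle E"
  shows "\<exists>\<Theta>. bij_betw \<Theta> (homological_fields E // field_equiv E) (loday_algebroids E) \<and>
             (\<forall>d\<in>homological_fields E. \<Theta> (field_equiv E `` {d}) = derived_bracket E d)"
proof -
  interpret smooth_vector_bundle E by unfold_locales (rule assms)
  let ?H = "homological_fields E" and ?R = "field_equiv E"
  \<comment> \<open>A representative is picked from each class; the derived bracket does not depend
    on it.\<close>
  define \<Theta> where "\<Theta> K = derived_bracket E (SOME d. d \<in> K)" for K
  have self: "d \<in> ?R `` {d}" if "d \<in> ?H" for d using that by (simp add: field_equiv_def)
  have rep: "\<Theta> (?R `` {d}) = derived_bracket E d" if d: "d \<in> ?H" for d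
  proof -
    have "(SOME d'. d' \<in> ?R `` {d}) \<in> ?R `` {d}" 
      by (rule someI[of "\<lambda>d'. d' \<in> ?R `` {d}", OF self[OF d]])
    then show ?thesis unfolding \<Theta>_def
      by (intro derived_bracket_cong) (simp add: field_equiv_def)
  qed
  have "inj_on \<Theta> (?H // ?R)"
  proof (rule inj_onI)
    fix K K' assume "K \<in> ?H // ?R" "K' \<in> ?H // ?R" and eq: "\<Theta> K = \<Theta> K'"
    then obtain d d' where d: "d \<in> ?H" "K = ?R `` {d}" "d' \<in> ?H" "K' = ?R `` {d'}"
      by (auto simp: quotient_def)
    then have "d c = d' c" if "c \<in> reduced_ops E 0 \<union> reduced_ops E 1" for c
      using derived_bracket_inject[OF d(1,3) _ that] rep eq by simp
    then show "K = K'" using d by (auto simp: field_equiv_def)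
  qed
  moreover have "\<Theta> ` (?H // ?R) = loday_algebroids E"
  proof
    show "\<Theta> ` (?H // ?R) \<subseteq> loday_algebroids E"
      using rep homological.bracket_loday[OF homologicalI] by (auto simp: quotient_def)
    show "loday_algebroids E \<subseteq> \<Theta> ` (?H // ?R)"
    proof
      fix B assume "B \<in> loday_algebroids E"
      then interpret loday_bracket E B by unfold_locales
      obtain d where "d \<in> ?H" "derived_bracket E d = B" using homological_field_exists by blast
      then show "B \<in> \<Theta> ` (?H // ?R)"
        using rep[of d] by (intro image_eqI[of _ _ "?R `` {d}"] quotientI) auto
    qed
  qed
  ultimately show ?thesis using rep unfolding bij_betw_def by blast
qed

end
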